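(* Let $\Omega\subset\mathbb{R}^n$ be a bounded domain with smooth boundary and $p\in(1,\infty)$. Let $\mathbf{v}$ be a weak solution of $$\begin{cases}|\mathbf{v}_t|^{p-2}\mathbf{v}_t=\operatorname{div}(|D\mathbf{v}|^{p-2}D\mathbf{v}), & \Omega\times(0,\infty)\\ \mathbf{v}=\mathbf{0}, & \partial\Omega\times[0,\infty)\\ \mathbf{v}=\mathbf{g}, & \Omega\times\{0\}\end{cases}$$ with $\mathbf{g}\in W^{1,p}_0(\Omega;\mathbb{R}^m)$. Then for almost every $t>0$ $$\Upsilon_p\int_\Omega|D\mathbf{v}(x,t)|^p\,dx\le\int_\Omega|\mathbf{v}_t(x,t)|^p\,dx$$ and $$\int_\Omega|D\mathbf{v}(x,t)|^p\,dx\le e^{-(p\Upsilon_p)t}\int_\Omega|D\mathbf{g}(x)|^p\,dx$$ for each $t>0$.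
   Context: For matrices, $M\cdot N=\operatorname{tr}(M^tN)$ and $|M|=\sqrt{M\cdot M}$; $D\mathbf v=(v^i_{x_j})$ is the spatial gradient matrix. $$\Lambda_p:=\inf\left\{\frac{\int_\Omega|D\mathbf u|^pdx}{\int_\Omega|\mathbf u|^pdx}:\mathbf u\in W^{1,p}_0(\Omega;\mathbb R^m)\setminus\{\mathbf 0\}\right\},\qquad \Upsilon_p:=\Lambda_p^{\frac1{p-1}}.$$ A weak solution of the initial value problem is a mapping $\mathbf v$ such that for every $T>0$: $\mathbf v_t\in L^p(\Omega\times(0,T);\mathbb R^m)$, $\mathbf v\in L^\infty([0,T];W^{1,p}_0(\Omega;\mathbb R^m))$, $$\int_\Omega|\mathbf v_t(x,t)|^{p-2}\mathbf v_t(x,t)\cdot\mathbf w(x)\,dx+\int_\Omega|D\mathbf v(x,t)|^{p-2}D\mathbf v(x,t)\cdot D\mathbf w(x)\,dx=0$$ for each $\mathbf w\in W^{1,p}_0(\Omega;\mathbb R^m)$ and a.e. $t\in[0,T]$; and $\mathbf v(\cdot,0)=\mathbf g$. Here $\mathbf v$ is identified with its representative in $C([0,\infty);L^p(\Omega;\mathbb R^m))$, and $|z|^{p-2}z:=0$ for $z=0$. *)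

theory Defs
  imports "HOL-Analysis.Analysis"
begin

text \<open>
  Functions on an open set \<open>\<Omega>\<close> are represented by total functions; only their values on
  \<open>\<Omega>\<close> matter, and up to Lebesgue null sets. A map of the space-time variables is curried
  with time first: \<open>v t x\<close> stands for the value of the map at \<open>(x, t)\<close>.
  A gradient matrix has type \<open>real^'n^'m\<close>, the entry \<open>$ i $ j\<close> being the \<open>j\<close>-th
  partial derivative of the \<open>i\<close>-th component; on this type the library's inner product and norm
  are the Frobenius ones.
\<close>

subsection \<open>Smooth functions and domains\<close>

primrec C_diff :: "nat \<Rightarrow> ('a::euclidean_space \<Rightarrow> 'b::real_normed_vector) \<Rightarrow> bool" where
  "C_diff 0 f \<longleftrightarrow> continuous_on UNIV f"
| "C_diff (Suc k) f \<longleftrightarrow>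
     (\<forall>x. f differentiable (at x)) \<and> (\<forall>e. C_diff k (\<lambda>x. frechet_derivative f (at x) e))"

definition smooth :: "('a::euclidean_space \<Rightarrow> 'b::real_normed_vector) \<Rightarrow> bool" where
  "smooth f \<longleftrightarrow> (\<forall>k. C_diff k f)"

definition test_fun :: "'a::euclidean_space set \<Rightarrow> ('a \<Rightarrow> 'b::real_normed_vector) \<Rightarrow> bool" where
  "test_fun U \<phi> \<longleftrightarrow>
     smooth \<phi> \<and> compact (closure {x. \<phi> x \<noteq> 0}) \<and> closure {x. \<phi> x \<noteq> 0} \<subseteq> U"

text \<open>
  Near each boundary point the set lies strictly above a smooth graph in the direction of a unit
  vector \<open>e\<close>. The graph function \<open>\<gamma>\<close> is only evaluated on the hyperplane
  orthogonal to \<open>e\<close>, which plays the role of the space of the other coordinates.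
\<close>
definition smooth_boundary :: "'a::euclidean_space set \<Rightarrow> bool" where
  "smooth_boundary \<Omega> \<longleftrightarrow>
     (\<forall>x0\<in>frontier \<Omega>. \<exists>r>0. \<exists>e \<gamma>. norm e = 1 \<and> smooth (\<gamma> :: 'a \<Rightarrow> real) \<and>
        \<Omega> \<inter> ball x0 r = {x \<in> ball x0 r. x \<bullet> e > \<gamma> (x - (x \<bullet> e) *\<^sub>R e)})"

definition bounded_smooth_domain :: "'a::euclidean_space set \<Rightarrow> bool" where
  "bounded_smooth_domain \<Omega> \<longleftrightarrow>
     open \<Omega> \<and> connected \<Omega> \<and> \<Omega> \<noteq> {} \<and> bounded \<Omega> \<and> smooth_boundary \<Omega>"

subsection \<open>Lebesgue spaces and weak derivatives\<close>

definition Lp :: "real \<Rightarrow> 'a::euclidean_space set \<Rightarrow> ('a \<Rightarrow> 'b::euclidean_space) set" where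
  "Lp p S = {f. f \<in> borel_measurable (lebesgue_on S) \<and>
                integrable (lebesgue_on S) (\<lambda>x. norm (f x) powr p)}"

definition locally_integrable ::
    "'a::euclidean_space set \<Rightarrow> ('a \<Rightarrow> 'b::euclidean_space) \<Rightarrow> bool" where
  "locally_integrable U f \<longleftrightarrow> (\<forall>K. compact K \<and> K \<subseteq> U \<longrightarrow> integrable (lebesgue_on K) f)"

definition has_weak_deriv ::
    "'a::euclidean_space set \<Rightarrow> 'a \<Rightarrow> ('a \<Rightarrow> 'b::euclidean_space) \<Rightarrow> ('a \<Rightarrow> 'b) \<Rightarrow> bool" where
  "has_weak_deriv U e f h \<longleftrightarrow>
     locally_integrable U f \<and> locally_integrable U h \<and>
     (\<forall>\<phi> :: 'a \<Rightarrow> real. test_fun U \<phi> \<longrightarrow>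
        (\<integral>x. frechet_derivative \<phi> (at x) e *\<^sub>R f x \<partial>lebesgue_on U)
          = - (\<integral>x. \<phi> x *\<^sub>R h x \<partial>lebesgue_on U))"

definition has_weak_grad ::
    "(real^'n) set \<Rightarrow> (real^'n \<Rightarrow> real^'m) \<Rightarrow> (real^'n \<Rightarrow> real^'n^'m) \<Rightarrow> bool" where
  "has_weak_grad \<Omega> u G \<longleftrightarrow> (\<forall>j. has_weak_deriv \<Omega> (axis j 1) u (\<lambda>x. column j (G x)))"

definition weak_grad ::
    "(real^'n) set \<Rightarrow> (real^'n \<Rightarrow> real^'m) \<Rightarrow> real^'n \<Rightarrow> real^'n^'m" where
  "weak_grad \<Omega> u = (SOME G. has_weak_grad \<Omega> u G)"

definition has_weak_dt ::
    "(real^'n) set \<Rightarrow> (real \<Rightarrow> real^'n \<Rightarrow> real^'m) \<Rightarrow> (real \<Rightarrow> real^'n \<Rightarrow> real^'m) \<Rightarrow> bool" where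
  "has_weak_dt \<Omega> v h \<longleftrightarrow>
     has_weak_deriv ({0<..} \<times> \<Omega>) (1, 0) (\<lambda>(t, x). v t x) (\<lambda>(t, x). h t x)"

definition weak_dt ::
    "(real^'n) set \<Rightarrow> (real \<Rightarrow> real^'n \<Rightarrow> real^'m) \<Rightarrow> real \<Rightarrow> real^'n \<Rightarrow> real^'m" where
  "weak_dt \<Omega> v = (SOME h. has_weak_dt \<Omega> v h)"

subsection \<open>Sobolev spaces\<close>

definition W1p :: "real \<Rightarrow> (real^'n) set \<Rightarrow> (real^'n \<Rightarrow> real^'m) set" where
  "W1p p \<Omega> = {u. u \<in> Lp p \<Omega> \<and> (\<exists>G. has_weak_grad \<Omega> u G \<and> G \<in> Lp p \<Omega>)}"

definition W1p_norm :: "real \<Rightarrow> (real^'n) set \<Rightarrow> (real^'n \<Rightarrow> real^'m) \<Rightarrow> real" where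
  "W1p_norm p \<Omega> u =
     ((\<integral>x. norm (u x) powr p \<partial>lebesgue_on \<Omega>)
       + (\<integral>x. norm (weak_grad \<Omega> u x) powr p \<partial>lebesgue_on \<Omega>)) powr (1 / p)"

definition W01p :: "real \<Rightarrow> (real^'n) set \<Rightarrow> (real^'n \<Rightarrow> real^'m) set" where
  "W01p p \<Omega> = {u \<in> W1p p \<Omega>. \<exists>\<phi> :: nat \<Rightarrow> real^'n \<Rightarrow> real^'m.
      (\<forall>k. test_fun \<Omega> (\<phi> k)) \<and> (\<lambda>k. W1p_norm p \<Omega> (\<lambda>x. \<phi> k x - u x)) \<longlonglongrightarrow> 0}"

text \<open>The \<open>itself\<close> argument fixes the dimension of the target space.\<close>
definition Lambda_p :: "'m::finite itself \<Rightarrow> real \<Rightarrow> (real^'n) set \<Rightarrow> real" where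
  "Lambda_p _ p \<Omega> =
     Inf {(\<integral>x. norm (weak_grad \<Omega> u x) powr p \<partial>lebesgue_on \<Omega>)
            / (\<integral>x. norm (u x) powr p \<partial>lebesgue_on \<Omega>) | u :: real^'n \<Rightarrow> real^'m.
          u \<in> W01p p \<Omega> \<and> \<not> (AE x in lebesgue_on \<Omega>. u x = 0)}"

definition Upsilon_p :: "'m::finite itself \<Rightarrow> real \<Rightarrow> (real^'n) set \<Rightarrow> real" where
  "Upsilon_p M p \<Omega> = Lambda_p M p \<Omega> powr (1 / (p - 1))"

subsection \<open>Weak solutions\<close>

text \<open>
  Bochner measurability: a.e. pointwise limit, in the norm of the Sobolev space, of measurable
  functions taking finitely many values.
\<close>
definition strongly_measurable_W01p ::
    "real \<Rightarrow> (real^'n) set \<Rightarrow> real \<Rightarrow> (real \<Rightarrow> real^'n \<Rightarrow> real^'m) \<Rightarrow> bool" where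
  "strongly_measurable_W01p p \<Omega> T v \<longleftrightarrow>
     (\<exists>s :: nat \<Rightarrow> real \<Rightarrow> real^'n \<Rightarrow> real^'m.
        (\<forall>k. finite (s k ` {0..T}) \<and> s k ` {0..T} \<subseteq> W01p p \<Omega> \<and>
             (\<forall>w. {t \<in> {0..T}. s k t = w} \<in> sets lebesgue)) \<and>
        (AE t in lebesgue_on {0..T}. (\<lambda>k. W1p_norm p \<Omega> (\<lambda>x. s k t x - v t x)) \<longlonglongrightarrow> 0))"

definition Linf_W01p ::
    "real \<Rightarrow> (real^'n) set \<Rightarrow> real \<Rightarrow> (real \<Rightarrow> real^'n \<Rightarrow> real^'m) set" where
  "Linf_W01p p \<Omega> T = {v.
     (AE t in lebesgue_on {0..T}. v t \<in> W01p p \<Omega>) \<and>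
     strongly_measurable_W01p p \<Omega> T v \<and>
     (\<exists>C. AE t in lebesgue_on {0..T}. W1p_norm p \<Omega> (v t) \<le> C)}"

definition cont_Lp ::
    "real \<Rightarrow> (real^'n) set \<Rightarrow> (real \<Rightarrow> real^'n \<Rightarrow> real^'m) \<Rightarrow> bool" where
  "cont_Lp p \<Omega> v \<longleftrightarrow>
     (\<forall>t\<ge>0. v t \<in> Lp p \<Omega> \<and>
        ((\<lambda>s. \<integral>x. norm (v s x - v t x) powr p \<partial>lebesgue_on \<Omega>) \<longlongrightarrow> 0) (at t within {0..}))"

definition pflux :: "real \<Rightarrow> 'a::real_normed_vector \<Rightarrow> 'a" where
  "pflux p z = norm z powr (p - 2) *\<^sub>R z"

definition weak_solution ::
    "real \<Rightarrow> (real^'n) set \<Rightarrow> (real^'n \<Rightarrow> real^'m) \<Rightarrow> (real \<Rightarrow> real^'n \<Rightarrow> real^'m) \<Rightarrow> bool" where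
  "weak_solution p \<Omega> g v \<longleftrightarrow>
     cont_Lp p \<Omega> v \<and>
     (\<exists>h. has_weak_dt \<Omega> v h) \<and>
     (\<forall>T>0.
        (\<lambda>(t, x). weak_dt \<Omega> v t x) \<in> Lp p ({0<..<T} \<times> \<Omega>) \<and>
        v \<in> Linf_W01p p \<Omega> T \<and>
        (\<forall>w \<in> W01p p \<Omega>. AE t in lebesgue_on {0..T}.
           (\<integral>x. pflux p (weak_dt \<Omega> v t x) \<bullet> w x \<partial>lebesgue_on \<Omega>)
             + (\<integral>x. pflux p (weak_grad \<Omega> (v t) x) \<bullet> weak_grad \<Omega> w x \<partial>lebesgue_on \<Omega>) = 0)) \<and>
     (AE x in lebesgue_on \<Omega>. v 0 x = g x)"

end

theory Submission
  imports Defs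
begin

text \<open>
  Write \<open>E t\<close> for the integral of \<open>|Dv(t)|^p\<close> over \<open>\<Omega>\<close>, \<open>N t\<close> for that of
  \<open>|v_t(t)|^p\<close>, and \<open>\<xi> = |v_t|^(p-2) v_t\<close>.

  Testing the equation at time \<open>t\<close> with \<open>v(t)\<close> itself shows that \<open>E t\<close> is minus the integral of
  \<open>\<xi>(t) \<bullet> v(t)\<close>. Young's inequality bounds this by multiples of \<open>N t\<close> and of the integral of
  \<open>|v(t)|^p\<close>, and the latter is at most \<open>E t\<close> divided by the infimum of the Rayleigh quotient. With the
  right weight in Young's inequality this is the first claim (\<open>Upsilon_energy_le\<close>).

  For the decay, the equation says that \<open>-\<xi>(t)\<close> is a subgradient at \<open>v(t)\<close> of the convex functional
  that sends a map to the integral of \<open>|Du|^p / p\<close>. So \<open>E t + p \<integral> \<xi>(t) \<bullet> (v(t) - v(q)) \<le> E q\<close>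
  for almost all \<open>t\<close> and \<open>q\<close> (\<open>energy_subgradient\<close>). Taking \<open>q = t - h\<close>, integrating over \<open>t\<close>, dividing
  by \<open>h\<close> and letting \<open>h\<close> tend to \<open>0\<close> yields the dissipation inequality
  \<open>E r + p \<integral> N \<le> E s\<close>, the integral being taken from \<open>s\<close> to \<open>r\<close> (\<open>energy_dissipation\<close>).
  The passage to the limit rests on three facts.

  \<^item> For almost every \<open>x\<close>, the increment \<open>v(t) - v(q)\<close> is the time integral of \<open>v_t\<close>
    (\<open>increment_eq_integral\<close>). This follows from the distributional definition of \<open>v_t\<close> by testing with
    products of a function of \<open>t\<close> and a function of \<open>x\<close>.
  \<^item> Averages of \<open>v_t\<close> over \<open>(t - h, t)\<close>, paired with \<open>\<xi>\<close>, converge to the integral of \<open>N\<close>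
    (\<open>steklov_average\<close>), because translations act continuously on \<open>L^p\<close>.
  \<^item> \<open>W_0^{1,p}\<close> is closed, and the energy lower semicontinuous, under \<open>L^p\<close> convergence of sequences of
    bounded energy (\<open>W01p_weakly_closed\<close>). By continuity of \<open>v\<close> into \<open>L^p\<close>, statements about almost
    every time thus become statements about every time. Uniform convexity of \<open>|\<cdot>|^p\<close> takes the place
    of weak compactness here.

  The equation at time \<open>t\<close> holds for each test function outside a null set that depends on this function.
  Strong measurability of \<open>v\<close> provides countably many test functions whose closure contains \<open>v(q)\<close> for
  almost every \<open>q\<close>, so one null set suffices (\<open>AE_equation_at\<close>).

  Finally, \<open>E\<close> is nonincreasing and \<open>N\<close> dominates \<open>\<Upsilon> E\<close>, so the dissipation inequality gives
  \<open>E r (1 + p \<Upsilon> (r - s)) \<le> E s\<close>. Iterating over \<open>n\<close> equal steps and letting \<open>n\<close> grow produces the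
  exponential factor (\<open>energy_decay\<close>).
\<close>

section \<open>Calculus of smooth functions\<close>

(* Unfolded by the simplifier, this equation would split every goal about C_diff into goals about
   frechet_derivative; C_diff_SucI introduces derivatives that are known explicitly instead. *)
declare C_diff.simps(2)[simp del]

lemma C_diff_SucI:
  assumes "\<And>x. (f has_derivative f' x) (at x)" and "\<And>e. C_diff k (\<lambda>x. f' x e)"
  shows "C_diff (Suc k) f"
  using assms frechet_derivative_at[OF assms(1)] by (auto simp: differentiable_def C_diff.simps(2))

lemma C_diff_SucE:
  assumes "C_diff (Suc k) f"
  shows "(f has_derivative frechet_derivative f (at x)) (at x)"
    and "C_diff k (\<lambda>x. frechet_derivative f (at x) e)"
  using assms frechet_derivative_works by (auto simp: C_diff.simps(2))

lemma C_diff_SucD: "C_diff (Suc k) f \<Longrightarrow> C_diff k f"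
proof (induction k arbitrary: f)
  case 0
  then show ?case
    by (simp add: C_diff.simps(2) continuous_at_imp_continuous_on differentiable_imp_continuous_within)
next
  case (Suc k)
  show ?case
    by (rule C_diff_SucI[OF C_diff_SucE(1)[OF Suc.prems] Suc.IH[OF C_diff_SucE(2)[OF Suc.prems]]])
qed

lemma C_diff_continuous: "C_diff k f \<Longrightarrow> continuous_on UNIV f"
  by (induction k arbitrary: f) (simp, metis C_diff_SucD)

lemma C_diff_const: "C_diff k (\<lambda>x. c)"
proof (induction k arbitrary: c)
  case (Suc k)
  then show ?case
    by (intro C_diff_SucI[where f' = "\<lambda>x e. 0"]) auto
qed simp

lemma C_diff_linear: "bounded_linear L \<Longrightarrow> C_diff k L"
proof (cases k)
  case (Suc l)
  then show "bounded_linear L \<Longrightarrow> ?thesis"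
    by (auto intro: C_diff_SucI[where f' = "\<lambda>x. L"] bounded_linear_imp_has_derivative C_diff_const)
qed (simp add: linear_continuous_on)

lemma C_diff_add: "C_diff k f \<Longrightarrow> C_diff k g \<Longrightarrow> C_diff k (\<lambda>x. f x + g x)"
proof (induction k arbitrary: f g)
  case (Suc k)
  show ?case
    by (rule C_diff_SucI, rule has_derivative_add[OF Suc.prems[THEN C_diff_SucE(1)]])
      (rule Suc.IH[OF Suc.prems[THEN C_diff_SucE(2)]])
qed (simp add: continuous_on_add)

text \<open>
  The product rule contains the undifferentiated factors, so the induction on the order uses
  that these, too, have the lower order of differentiability.
\<close>
lemma C_diff_bilinear:
  assumes "bounded_bilinear B"
  shows "C_diff k f \<Longrightarrow> C_diff k g \<Longrightarrow> C_diff k (\<lambda>x. B (f x) (g x))"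
proof (induction k arbitrary: f g)
  case 0
  then show ?case using bounded_bilinear.continuous_on[OF assms] by auto
next
  case (Suc k)
  show ?case
    by (rule C_diff_SucI, rule bounded_bilinear.FDERIV[OF assms Suc.prems[THEN C_diff_SucE(1)]])
      (intro C_diff_add Suc.IH Suc.prems[THEN C_diff_SucE(2)] Suc.prems[THEN C_diff_SucD])
qed

lemmas C_diff_scaleR = C_diff_bilinear[OF bounded_bilinear_scaleR]
lemmas C_diff_mult = C_diff_bilinear[OF bounded_bilinear_mult]

lemma C_diff_compose_linear:
  assumes L: "bounded_linear L"
  shows "C_diff k f \<Longrightarrow> C_diff k (\<lambda>x. f (L x))"
proof (induction k arbitrary: f)
  case 0
  then show ?case
    using continuous_on_compose2[OF _ linear_continuous_on[OF L]] by auto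
next
  case (Suc k)
  show ?case
    by (rule C_diff_SucI, rule has_derivative_compose[OF bounded_linear_imp_has_derivative[OF L]
          C_diff_SucE(1)[OF Suc.prems]])
      (rule Suc.IH[OF C_diff_SucE(2)[OF Suc.prems]])
qed

text \<open>
  Since the inner function is real, the derivative of the composition is the product of the real
  number \<open>g' e\<close> with the vector \<open>f' 1\<close>, and the order is lowered by the rule for products.
\<close>
lemma C_diff_compose_real:
  fixes f :: "real \<Rightarrow> 'b::real_normed_vector" and g :: "'a::euclidean_space \<Rightarrow> real"
  shows "C_diff k f \<Longrightarrow> C_diff k g \<Longrightarrow> C_diff k (\<lambda>x. f (g x))"
proof (induction k arbitrary: f g)
  case 0
  then show ?case
    using continuous_on_compose2[of UNIV f UNIV g] by auto
next
  case (Suc k)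
  note f = C_diff_SucE[OF Suc.prems(1)] and g = C_diff_SucE[OF Suc.prems(2)]
  have "C_diff k (\<lambda>x. frechet_derivative g (at x) e *\<^sub>R frechet_derivative f (at (g x)) 1)" for e
    by (intro C_diff_scaleR g(2) Suc.IH f(2) C_diff_SucD[OF Suc.prems(2)])
  moreover have lin: "frechet_derivative f (at y) c = c *\<^sub>R frechet_derivative f (at y) 1" for y c
    using linear_scale[OF has_derivative_linear[OF f(1)], of y c 1] by simp
  ultimately have "C_diff k (\<lambda>x. frechet_derivative f (at (g x)) (frechet_derivative g (at x) e))" for e
    by (subst lin)
  then show ?case
    by (rule C_diff_SucI[OF has_derivative_compose[OF g(1) f(1)]])
qed

lemma C_diff_prod:
  fixes f :: "'i \<Rightarrow> 'a::euclidean_space \<Rightarrow> real"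
  assumes "finite I" "\<And>i. i \<in> I \<Longrightarrow> C_diff k (f i)"
  shows "C_diff k (\<lambda>x. \<Prod>i\<in>I. f i x)"
  using assms by (induction I) (auto intro: C_diff_const C_diff_mult)

lemma smooth_derivative: "smooth f \<Longrightarrow> smooth (\<lambda>x. frechet_derivative f (at x) e)"
  and smooth_has_derivative: "smooth f \<Longrightarrow> (f has_derivative frechet_derivative f (at x)) (at x)"
  and smooth_continuous: "smooth f \<Longrightarrow> continuous_on UNIV f"
  unfolding smooth_def using C_diff_SucE C_diff_continuous by blast+

section \<open>Smooth bumps\<close>

text \<open>
  The standard smooth function that is positive exactly on the positive half-line.
\<close>
definition flat_exp :: "real \<Rightarrow> real" where
  "flat_exp s = (if s > 0 then exp (- inverse s) else 0)"

text \<open>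
  Differentiation produces powers of \<open>1/s\<close> in front of the exponential, so smoothness is an induction
  over all these powers at once. At \<open>0\<close> the exponential beats every power.
\<close>
lemma has_derivative_flat_exp_power:
  defines "F \<equiv> \<lambda>n s::real. if s > 0 then inverse s ^ n * exp (- inverse s) else 0"
  shows "(F n has_real_derivative - real n * F (Suc n) x + F (n + 2) x) (at x)"
proof -
  have lim: "((\<lambda>s. F n s) \<longlongrightarrow> 0) (at_right 0)" for n
  proof -
    have "((\<lambda>y::real. y ^ n / exp y) \<longlongrightarrow> 0) at_top"
      by (rule tendsto_power_div_exp_0)
    then have "((\<lambda>s::real. inverse s ^ n / exp (inverse s)) \<longlongrightarrow> 0) (at_right 0)"
      by (rule filterlim_compose[OF _ filterlim_inverse_at_top_right])
    then show ?thesis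
      by (rule Lim_transform_eventually)
        (use eventually_at_right_less[of "0::real"] in \<open>eventually_elim, simp add: F_def exp_minus divide_inverse\<close>)
  qed
  consider "x > 0" | "x < 0" | "x = 0" by linarith
  then show ?thesis
  proof cases
    case 1
    have "((\<lambda>s. inverse s ^ n * exp (- inverse s)) has_real_derivative
        - real n * F (Suc n) x + F (n + 2) x) (at x)"
    proof (rule DERIV_cong)
      have inv: "(inverse has_real_derivative - (inverse x * inverse x)) (at x)"
        using DERIV_inverse[of x UNIV] 1 by (simp add: power2_eq_square)
      show "((\<lambda>s. inverse s ^ n * exp (- inverse s)) has_real_derivative
          inverse x ^ n * (exp (- inverse x) * - (- (inverse x * inverse x)))
          + real n * inverse x ^ (n - 1) * - (inverse x * inverse x) * exp (- inverse x)) (at x)"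
      proof (rule DERIV_mult'[OF DERIV_cong[OF DERIV_power[OF inv]]])
        show "((\<lambda>s. exp (- inverse s)) has_real_derivative
            exp (- inverse x) * - (- (inverse x * inverse x))) (at x)"
          by (intro DERIV_fun_exp DERIV_minus inv)
      qed simp
      show "inverse x ^ n * (exp (- inverse x) * - (- (inverse x * inverse x)))
          + real n * inverse x ^ (n - 1) * - (inverse x * inverse x) * exp (- inverse x)
          = - real n * F (Suc n) x + F (n + 2) x"
        using 1 unfolding F_def by (cases n) (simp_all add: algebra_simps)
    qed
    then show ?thesis
      by (rule has_field_derivative_transform_within_open[of _ _ _ "{0<..}"]) (use 1 in \<open>auto simp: F_def\<close>)
  next
    case 2
    have "((\<lambda>s. 0) has_real_derivative - real n * F (Suc n) x + F (n + 2) x) (at x)"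
      using 2 by (auto simp: F_def)
    then show ?thesis
      by (rule has_field_derivative_transform_within_open[of _ _ _ "{..<0}"]) (use 2 in \<open>auto simp: F_def\<close>)
  next
    case 3
    have "((\<lambda>s. (F n s - F n 0) / (s - 0)) \<longlongrightarrow> 0) (at 0)"
    proof (rule filterlim_split_at)
      show "((\<lambda>s. (F n s - F n 0) / (s - 0)) \<longlongrightarrow> 0) (at_left 0)"
        by (rule Lim_transform_eventually[OF tendsto_const])
          (simp add: F_def eventually_at_filter)
      show "((\<lambda>s. (F n s - F n 0) / (s - 0)) \<longlongrightarrow> 0) (at_right 0)"
        by (rule Lim_transform_eventually[OF lim[of "Suc n"]])
          (use eventually_at_right_less[of "0::real"] in \<open>eventually_elim, simp add: F_def divide_inverse\<close>)
    qed
    then show ?thesis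
      using 3 by (simp add: has_field_derivative_iff F_def)
  qed
qed

lemma smooth_flat_exp: "smooth flat_exp"
proof -
  have "C_diff k (\<lambda>s::real. if s > 0 then inverse s ^ n * exp (- inverse s) else 0)" for k n
  proof (induction k arbitrary: n)
    case 0
    have "isCont (\<lambda>s::real. if s > 0 then inverse s ^ n * exp (- inverse s) else 0) x" for x
      by (rule DERIV_isCont[OF has_derivative_flat_exp_power])
    then show ?case
      by (simp add: continuous_at_imp_continuous_on)
  next
    case (Suc k)
    show ?case
      by (rule C_diff_SucI, rule has_derivative_flat_exp_power[unfolded has_field_derivative_def])
        (intro C_diff_mult C_diff_add C_diff_const Suc.IH)
  qed
  from this[where n = 0] have "C_diff k flat_exp" for k
    unfolding flat_exp_def[abs_def] power_0 mult_1_left .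
  then show ?thesis by (simp add: smooth_def)
qed

lemma flat_exp_bounds: "0 \<le> flat_exp s" "flat_exp s \<le> 1"
  by (auto simp: flat_exp_def)

lemma flat_exp_eq_0 [simp]: "flat_exp s = 0 \<longleftrightarrow> s \<le> 0"
  by (auto simp: flat_exp_def)

lemma flat_exp_tendsto: "s > 0 \<Longrightarrow> (\<lambda>k. flat_exp (real k * s)) \<longlonglongrightarrow> 1"
proof -
  assume s: "s > 0"
  have "(\<lambda>k. exp (- (inverse (real k) * inverse s))) \<longlonglongrightarrow> exp (- (0 * inverse s))"
    by (intro tendsto_intros lim_inverse_n)
  then have "(\<lambda>k. exp (- (inverse (real k) * inverse s))) \<longlonglongrightarrow> 1" by simp
  then show ?thesis
    by (rule Lim_transform_eventually)
      (use s in \<open>auto simp: flat_exp_def intro!: eventually_sequentiallyI[of 1]\<close>)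
qed

text \<open>
  \<open>P\<close> is the primitive of a bump \<open>\<beta>\<close> on the unit interval. Differences of rescaled copies of \<open>P\<close> are
  test functions in time whose derivatives concentrate at two instants.
\<close>
lemma smooth_step_exists:
  obtains P \<beta> :: "real \<Rightarrow> real" and c :: real where
    "smooth P" "\<And>y. (P has_real_derivative \<beta> y) (at y)" "\<And>y. y \<le> 0 \<Longrightarrow> P y = 0"
    "\<And>y. y \<ge> 1 \<Longrightarrow> P y = c" "c > 0" "\<And>y. 0 \<le> P y" "\<And>y. P y \<le> c"
    "\<And>y. 0 \<le> \<beta> y" "\<And>y. y \<notin> {0<..<1} \<Longrightarrow> \<beta> y = 0" "continuous_on UNIV \<beta>"
proof -
  define \<beta> where "\<beta> = (\<lambda>y. flat_exp y * flat_exp (1 - y))"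
  have sm: "C_diff k \<beta>" for k
    unfolding \<beta>_def using smooth_flat_exp[unfolded smooth_def]
      C_diff_add[OF C_diff_const C_diff_linear[OF bounded_linear_minus[OF bounded_linear_ident]], of k 1]
    by (intro C_diff_mult C_diff_compose_real[of k flat_exp "\<lambda>y. 1 - y"]) simp_all
  have cont: "continuous_on UNIV \<beta>" using sm C_diff_continuous by blast
  have \<beta>: "0 \<le> \<beta> y" "y \<notin> {0<..<1} \<Longrightarrow> \<beta> y = 0" "y \<in> {0<..<1} \<Longrightarrow> 0 < \<beta> y" for y
    by (auto simp: \<beta>_def flat_exp_bounds order.strict_iff_order)
  obtain F where "\<forall>x::real. - \<infinity> < x \<longrightarrow> x < \<infinity> \<longrightarrow> (F has_vector_derivative \<beta> x) (at x)"
    using einterval_antiderivative[of "-\<infinity>" "\<infinity>" \<beta>] cont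
    by (auto simp: continuous_on_eq_continuous_at)
  then have F: "(F has_real_derivative \<beta> y) (at y)" for y
    by (simp add: has_real_derivative_iff_has_vector_derivative)
  define P where "P y = F y - F 0" for y
  have P: "(P has_real_derivative \<beta> y) (at y)" for y
    unfolding P_def by (auto intro!: derivative_eq_intros F)
  have mono: "P x \<le> P y" if "x \<le> y" for x y
    by (rule DERIV_nonneg_imp_nondecreasing[where f = P, OF that]) (use P \<beta>(1) in blast)
  have cP: "continuous_on A P" for A
    using DERIV_isCont[OF P] by (simp add: continuous_at_imp_continuous_on)
  have P0: "P y = 0" if "y \<le> 0" for y
  proof (cases "y = 0")
    case False
    have "DERIV P x :> 0" if "x < 0" for x
      using P[of x] \<beta>(2)[of x] that by simp
    then have "P 0 = P y"
      using that False by (intro DERIV_isconst_end cP) auto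
    then show ?thesis by (simp add: P_def)
  qed (simp add: P_def)
  have P1: "P y = P 1" if "1 \<le> y" for y
  proof (cases "y = 1")
    case False
    have "DERIV P x :> 0" if "1 < x" for x
      using P[of x] \<beta>(2)[of x] that by simp
    then show ?thesis
      using that False by (intro DERIV_isconst_end cP) auto
  qed simp
  have "P 0 < P 1"
  proof (rule DERIV_pos_imp_increasing_open[where f = P and a = 0 and b = 1])
    show "\<exists>y. DERIV P x :> y \<and> y > 0" if "0 < x" "x < 1" for x
      using P[of x] \<beta>(3)[of x] that by auto
  qed (simp_all add: cP)
  then have c: "P 1 > 0" using P0[of 0] by simp
  have "smooth P"
  proof -
    have "C_diff k P" for k
    proof (cases k)
      case 0
      then show ?thesis
        by (simp add: cP)
    next
      case (Suc l)
      show ?thesis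
        unfolding Suc by (rule C_diff_SucI, rule P[unfolded has_field_derivative_def])
          (intro C_diff_mult sm C_diff_const)
    qed
    then show ?thesis by (simp add: smooth_def)
  qed
  moreover have "0 \<le> P y" "P y \<le> P 1" for y
    using mono[of 0 y] mono[of y 1] P0[of y] P1[of y] P0[of 0] c by linarith+
  ultimately show thesis
    using that[of P \<beta> "P 1"] P P0 P1 c \<beta> cont by blast
qed

lemma test_funI:
  assumes "smooth f" "compact K" "K \<subseteq> U" "\<And>x. x \<notin> K \<Longrightarrow> f x = 0"
  shows "test_fun U f"
proof -
  have "closure {x. f x \<noteq> 0} \<subseteq> K"
    using assms compact_imp_closed by (intro closure_minimal) auto
  then show ?thesis
    using assms compact_Int_closed[of K "closure {x. f x \<noteq> 0}"]
    by (auto simp: test_fun_def inf_absorb2)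
qed

text \<open>
  A product over the coordinates of flat exponentials of the scaled distances to the two faces;
  the scale \<open>k\<close> drives each positive factor to \<open>1\<close>.
\<close>
lemma box_bump:
  fixes a b :: "'a::euclidean_space"
  assumes "cbox a b \<subseteq> U"
  obtains \<psi> :: "nat \<Rightarrow> 'a \<Rightarrow> real" where
    "\<And>k. test_fun U (\<psi> k)" "\<And>k x. 0 \<le> \<psi> k x" "\<And>k x. \<psi> k x \<le> 1"
    "\<And>x. (\<lambda>k. \<psi> k x) \<longlonglongrightarrow> indicator (box a b) x"
    "\<And>k x. x \<notin> box a b \<Longrightarrow> \<psi> k x = 0"
proof
  define \<psi> where "\<psi> k x = (\<Prod>i\<in>Basis.
      flat_exp (real k * ((x - a) \<bullet> i)) * flat_exp (real k * ((b - x) \<bullet> i)))" for k x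
  show 0: "0 \<le> \<psi> k x" "\<psi> k x \<le> 1" for k x
    unfolding \<psi>_def by (auto intro!: prod_nonneg prod_le_1 mult_le_one simp: flat_exp_bounds)
  show out: "\<psi> k x = 0" if "x \<notin> box a b" for k x
    using that by (auto simp: \<psi>_def box_def inner_diff_left mult_le_0_iff not_less)
  show "test_fun U (\<psi> k)" for k
  proof (rule test_funI[OF _ compact_cbox assms])
    have lin: "C_diff l (\<lambda>x. c * (x \<bullet> i) + d)" for l c d and i :: 'a
      by (rule C_diff_add[OF C_diff_linear[OF bounded_linear_const_mult[OF bounded_linear_inner_left]] C_diff_const])
    have aff: "C_diff l (\<lambda>x. real k * ((x - a) \<bullet> i))" "C_diff l (\<lambda>x. real k * ((b - x) \<bullet> i))" for l i
    proof -
      have "(\<lambda>x. real k * ((x - a) \<bullet> i)) = (\<lambda>x. real k * (x \<bullet> i) + - real k * (a \<bullet> i))"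
        "(\<lambda>x. real k * ((b - x) \<bullet> i)) = (\<lambda>x. - real k * (x \<bullet> i) + real k * (b \<bullet> i))"
        by (auto simp: algebra_simps inner_diff_left)
      then show "C_diff l (\<lambda>x. real k * ((x - a) \<bullet> i))" "C_diff l (\<lambda>x. real k * ((b - x) \<bullet> i))"
        by (simp_all only: lin)
    qed
    show "smooth (\<psi> k)"
      unfolding smooth_def \<psi>_def
      by (intro allI C_diff_prod finite_Basis C_diff_mult
          C_diff_compose_real[OF smooth_flat_exp[unfolded smooth_def, rule_format]] aff(1) aff(2))
    show "\<And>x. x \<notin> cbox a b \<Longrightarrow> \<psi> k x = 0"
      using out box_subset_cbox by blast
  qed
  show "(\<lambda>k. \<psi> k x) \<longlonglongrightarrow> indicator (box a b) x" for x
  proof (cases "x \<in> box a b")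
    case True
    then have "(\<lambda>k. \<psi> k x) \<longlonglongrightarrow> (\<Prod>i\<in>(Basis::'a set). 1 * 1)"
      unfolding \<psi>_def
      by (intro tendsto_prod tendsto_mult flat_exp_tendsto) (auto simp: box_def inner_diff_left)
    then show ?thesis using True by simp
  qed (simp add: out)
qed

section \<open>Test functions and the fundamental lemma of the calculus of variations\<close>

lemma test_fun_smooth: "test_fun U \<phi> \<Longrightarrow> smooth \<phi>"
  by (simp add: test_fun_def)

lemma test_fun_support:
  assumes "test_fun U \<phi>"
  obtains K where "compact K" "K \<subseteq> U" "\<And>x. x \<notin> K \<Longrightarrow> \<phi> x = 0"
    "\<And>x e. x \<notin> K \<Longrightarrow> frechet_derivative \<phi> (at x) e = 0"
proof -
  define K where "K = closure {x. \<phi> x \<noteq> 0}"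
  have K: "compact K" "K \<subseteq> U"
    using assms by (auto simp: test_fun_def K_def)
  have out: "\<phi> x = 0" if "x \<notin> K" for x
    using that closure_subset[of "{x. \<phi> x \<noteq> 0}"] by (auto simp: K_def)
  have "frechet_derivative \<phi> (at x) e = 0" if "x \<notin> K" for x e
  proof -
    have "open (- K)" using K compact_imp_closed by blast
    then have "(\<phi> has_derivative (\<lambda>e. 0)) (at x)"
      using that out
      by (intro has_derivative_transform_within_open[where f = "\<lambda>x. 0" and s = "- K", OF has_derivative_const]) auto
    from frechet_derivative_at[OF this] show ?thesis by metis
  qed
  then show thesis using that K out by metis
qed

lemma test_fun_derivative:
  assumes "test_fun U \<phi>"
  shows "test_fun U (\<lambda>x. frechet_derivative \<phi> (at x) e)"
proof -
  obtain K where "compact K" "K \<subseteq> U" "\<And>x e. x \<notin> K \<Longrightarrow> frechet_derivative \<phi> (at x) e = 0"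
    by (rule test_fun_support[OF assms]) blast
  then show ?thesis
    using test_funI[OF smooth_derivative[OF test_fun_smooth[OF assms]]] by blast
qed

lemma locally_integrable_mult_test:
  fixes f :: "'a::euclidean_space \<Rightarrow> 'b::euclidean_space"
  assumes "open U" "locally_integrable U f" "test_fun U (\<phi> :: 'a \<Rightarrow> real)"
  shows "integrable (lebesgue_on U) (\<lambda>x. \<phi> x *\<^sub>R f x)"
proof -
  obtain K where K: "compact K" "K \<subseteq> U" "\<And>x. x \<notin> K \<Longrightarrow> \<phi> x = 0"
    by (rule test_fun_support[OF assms(3)]) blast
  have int: "integrable (lebesgue_on K) f"
    using assms(2) K by (auto simp: locally_integrable_def)
  have KL: "K \<in> sets lebesgue" "U \<in> sets lebesgue"
    using K assms(1) by (auto simp: compact_imp_closed)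
  have cont: "continuous_on K \<phi>"
    using smooth_continuous[OF test_fun_smooth[OF assms(3)]] continuous_on_subset by blast
  obtain B where B: "\<And>x. x \<in> K \<Longrightarrow> norm (\<phi> x) \<le> B"
    using compact_imp_bounded[OF compact_continuous_image[OF cont K(1)]] by (auto simp: bounded_iff)
  have "integrable (lebesgue_on K) (\<lambda>x. \<phi> x *\<^sub>R f x)"
  proof (rule Bochner_Integration.integrable_bound)
    show "integrable (lebesgue_on K) (\<lambda>x. B *\<^sub>R f x)" using int by auto
    show "(\<lambda>x. \<phi> x *\<^sub>R f x) \<in> borel_measurable (lebesgue_on K)"
      using int continuous_imp_measurable_on_sets_lebesgue[OF cont KL(1)] by auto
    show "AE x in lebesgue_on K. norm (\<phi> x *\<^sub>R f x) \<le> norm (B *\<^sub>R f x)"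
      using B by (intro AE_I2) (force intro!: mult_right_mono)
  qed
  then have "integrable lebesgue (\<lambda>x. if x \<in> K then \<phi> x *\<^sub>R f x else 0)"
    by (rule iffD2[OF Lebesgue_Measure.integrable_restrict_UNIV[OF KL(1)]])
  also have "(\<lambda>x. if x \<in> K then \<phi> x *\<^sub>R f x else 0) = (\<lambda>x. if x \<in> U then \<phi> x *\<^sub>R f x else 0)"
    using K(2,3) by (intro ext) auto
  finally show ?thesis
    by (rule iffD1[OF Lebesgue_Measure.integrable_restrict_UNIV[OF KL(2)]])
qed

lemma AE_lebesgue_on_UN:
  assumes "countable I" "\<And>i. i \<in> I \<Longrightarrow> AE x in lebesgue. x \<in> A i \<longrightarrow> P x" "U \<subseteq> (\<Union>i\<in>I. A i)"
    "U \<in> sets lebesgue"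
  shows "AE x in lebesgue_on U. P x"
proof -
  have "AE x in lebesgue. \<forall>i\<in>I. x \<in> A i \<longrightarrow> P x"
    using assms by (subst AE_ball_countable) auto
  then show ?thesis
    using assms(3,4) by (subst AE_restrict_space_iff) (auto elim!: eventually_mono)
qed

lemma sigma_finite_lebesgue: "sigma_finite_measure (lebesgue :: 'a::euclidean_space measure)"
proof
  obtain A :: "'a set set" where A: "countable A" "A \<subseteq> sets lborel" "\<Union>A = space lborel" "\<forall>a\<in>A. emeasure lborel a \<noteq> \<infinity>"
    using lborel.sigma_finite_countable by metis
  then show "\<exists>A. countable A \<and> A \<subseteq> sets lebesgue \<and> \<Union>A = space lebesgue \<and> (\<forall>a\<in>A. emeasure (lebesgue :: 'a measure) a \<noteq> \<infinity>)"
    by (intro exI[of _ A]) auto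
qed

text \<open>
  Boxes generate the Borel sets and are closed under intersection, so a Dynkin argument extends the
  hypothesis to all Borel sets; Lebesgue sets differ from these by null sets.
\<close>
lemma set_integral_zero_all:
  fixes h :: "'a::euclidean_space \<Rightarrow> 'b::euclidean_space"
  assumes h: "integrable lebesgue h"
    and box: "\<And>c d. (\<integral>x. indicator (box c d) x *\<^sub>R h x \<partial>lebesgue) = 0"
  shows "AE x in lebesgue. h x = 0"
proof (rule sigma_finite_measure.density_zero[OF sigma_finite_lebesgue h])
  have int: "set_integrable lebesgue A h" if "A \<in> sets lebesgue" for A
    unfolding set_integrable_def by (rule integrable_mult_indicator[OF that h])
  have gen: "A \<in> sigma_sets UNIV (range (\<lambda>(a, b). box a b)) \<Longrightarrow> A \<in> sets borel" for A :: "'a set"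
    by (simp add: borel_eq_box)
  have UN: "(\<Union>n::nat. box (- real n *\<^sub>R One) (real n *\<^sub>R One)) = (UNIV :: 'a set)"
    using UN_box_eq_UNIV by simp
  have UNIV0: "(\<integral>x. h x \<partial>lebesgue) = 0"
  proof -
    have "(\<lambda>n. \<integral>x. indicator (box (- real n *\<^sub>R One) (real n *\<^sub>R One)) x *\<^sub>R h x \<partial>lebesgue) \<longlonglongrightarrow> (\<integral>x. h x \<partial>lebesgue)"
    proof (rule integral_dominated_convergence[where w = "\<lambda>x. norm (h x)"])
      show "AE x in lebesgue. (\<lambda>n. indicat_real (box (- real n *\<^sub>R One) (real n *\<^sub>R One)) x *\<^sub>R h x) \<longlonglongrightarrow> h x"
      proof (intro AE_I2)
        fix x :: 'a
        obtain N where N: "x \<in> box (- real N *\<^sub>R One) (real N *\<^sub>R One)" using UN by blast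
        have "x \<in> box (- real n *\<^sub>R One) (real n *\<^sub>R One)" if "n \<ge> N" for n
          using N that by (force simp: box_def)
        then show "(\<lambda>n. indicat_real (box (- real n *\<^sub>R One) (real n *\<^sub>R One)) x *\<^sub>R h x) \<longlonglongrightarrow> h x"
          by (intro tendsto_eventually eventually_sequentiallyI[of N]) auto
      qed
      show "(\<lambda>x. indicat_real (box (- real n *\<^sub>R One) (real n *\<^sub>R One)) x *\<^sub>R h x) \<in> borel_measurable lebesgue" for n
        using h by (intro borel_measurable_scaleR borel_measurable_indicator) auto
    qed (use h in \<open>auto split: split_indicator\<close>)
    then show ?thesis using box by (simp add: LIMSEQ_const_iff)
  qed
  have borel0: "(LINT x:A|lebesgue. h x) = 0" if "A \<in> sigma_sets UNIV (range (\<lambda>(a, b). box a b))" for A :: "'a set"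
  proof -
    have st: "Int_stable (range (\<lambda>(a, b). box a b :: 'a set))"
      by (auto simp: Int_stable_def box_Int_box)
    have cl: "range (\<lambda>(a, b). box a b :: 'a set) \<subseteq> Pow UNIV"
      by simp
    from st cl that show ?thesis
    proof (induction rule: sigma_sets_induct_disjoint)
      case (basic A)
      then show ?case using box by (auto simp: set_lebesgue_integral_def)
    next
      case (compl A)
      have A: "A \<in> sets lebesgue" using gen[OF compl(1)] by simp
      have "(LINT x:UNIV|lebesgue. h x) = (LINT x:A \<union> (UNIV - A)|lebesgue. h x)" by simp
      also have "\<dots> = (LINT x:A|lebesgue. h x) + (LINT x:UNIV - A|lebesgue. h x)"
        using A by (intro set_integral_Un int) auto
      finally show ?case using compl(2) UNIV0 by (simp add: set_lebesgue_integral_def)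
    next
      case (union A)
      have A: "A i \<in> sets lebesgue" for i using gen[of "A i"] union(2) by (simp add: image_subset_iff)
      have "(LINT x:(\<Union>i. A i)|lebesgue. h x) = (\<Sum>i. (LINT x:(A i)|lebesgue. h x))"
        using A union(1) by (intro lebesgue_integral_countable_add int) (auto simp: disjoint_family_on_def)
      then show ?case using union(3) by simp
    qed (simp add: set_lebesgue_integral_def)
  qed
  fix A :: "'a set" assume "A \<in> sets lebesgue"
  then obtain S N N' where SN: "A = S \<union> N" "N \<subseteq> N'" "N' \<in> null_sets lborel" "S \<in> sets lborel"
    by (rule sets_completionE) auto
  have ae: "AE x in lebesgue. x \<notin> N'"
    using SN(3) by (intro AE_not_in null_sets_completionI)
  have "(LINT x:A|lebesgue. h x) = (LINT x:S|lebesgue. h x)"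
    unfolding set_lebesgue_integral_def
  proof (rule integral_cong_AE)
    show "(\<lambda>x. indicat_real A x *\<^sub>R h x) \<in> borel_measurable lebesgue"
      "(\<lambda>x. indicat_real S x *\<^sub>R h x) \<in> borel_measurable lebesgue"
      using h SN(4) \<open>A \<in> sets lebesgue\<close>
      by (auto intro!: borel_measurable_scaleR borel_measurable_indicator)
  qed (use SN(1,2) ae in \<open>auto elim!: eventually_mono split: split_indicator\<close>)
  also have "\<dots> = 0" using SN(4) borel0[of S] by (simp add: borel_eq_box)
  finally show "(LINT x:A|lebesgue. h x) = 0" .
qed

text \<open>
  Box bumps reduce the claim to integrals over boxes inside a closed box contained in \<open>U\<close>, and \<open>U\<close>
  is a countable union of closed boxes.
\<close>
lemma fundamental_lemma_variations:
  fixes f :: "'a::euclidean_space \<Rightarrow> 'b::euclidean_space"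
  assumes U: "open U" and f: "locally_integrable U f"
    and zero: "\<And>\<phi> :: 'a \<Rightarrow> real. test_fun U \<phi> \<Longrightarrow> (\<integral>x. \<phi> x *\<^sub>R f x \<partial>lebesgue_on U) = 0"
  shows "AE x in lebesgue_on U. f x = 0"
proof -
  have UL: "U \<in> sets lebesgue" using U by simp
  have cbox0: "AE x in lebesgue. x \<in> cbox a b \<longrightarrow> f x = 0" if ab: "cbox a b \<subseteq> U" for a b
  proof -
    define h where "h = (\<lambda>x. if x \<in> cbox a b then f x else 0)"
    have h: "integrable lebesgue h"
      unfolding h_def using f ab Lebesgue_Measure.integrable_restrict_UNIV[of "cbox a b" f]
      by (auto simp: locally_integrable_def)
    have small: "(\<integral>x. indicator (box c d) x *\<^sub>R h x \<partial>lebesgue) = 0" if cd: "cbox c d \<subseteq> cbox a b" for c d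
    proof -
      obtain \<psi> :: "nat \<Rightarrow> 'a \<Rightarrow> real" where \<psi>: "\<And>k. test_fun U (\<psi> k)" "\<And>k x. 0 \<le> \<psi> k x" "\<And>k x. \<psi> k x \<le> 1"
        "\<And>x. (\<lambda>k. \<psi> k x) \<longlonglongrightarrow> indicator (box c d) x" "\<And>k x. x \<notin> box c d \<Longrightarrow> \<psi> k x = 0"
        using box_bump[of c d U] cd ab by blast
      have "(\<lambda>k. \<integral>x. \<psi> k x *\<^sub>R h x \<partial>lebesgue) \<longlonglongrightarrow> (\<integral>x. indicator (box c d) x *\<^sub>R h x \<partial>lebesgue)"
      proof (rule integral_dominated_convergence[where w = "\<lambda>x. norm (h x)"])
        have "\<psi> k \<in> borel_measurable borel" for k
          using smooth_continuous[OF test_fun_smooth[OF \<psi>(1)]] by (rule borel_measurable_continuous_onI)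
        then show "(\<lambda>x. \<psi> k x *\<^sub>R h x) \<in> borel_measurable lebesgue" for k
          using h by (intro borel_measurable_scaleR[OF measurable_completion]) auto
        show "AE x in lebesgue. norm (\<psi> k x *\<^sub>R h x) \<le> norm (h x)" for k
          using \<psi>(2,3) by (auto intro!: AE_I2 mult_left_le_one_le)
        show "(\<lambda>x. indicat_real (box c d) x *\<^sub>R h x) \<in> borel_measurable lebesgue"
          using h by (intro borel_measurable_scaleR borel_measurable_indicator) auto
        show "AE x in lebesgue. (\<lambda>k. \<psi> k x *\<^sub>R h x) \<longlonglongrightarrow> indicat_real (box c d) x *\<^sub>R h x"
          by (intro AE_I2 tendsto_scaleR \<psi>(4) tendsto_const)
        show "integrable lebesgue (\<lambda>x. norm (h x))"
          using h by simp
      qed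
      moreover have "(\<integral>x. \<psi> k x *\<^sub>R h x \<partial>lebesgue) = 0" for k
      proof -
        have "\<psi> k x *\<^sub>R h x = (if x \<in> U then \<psi> k x *\<^sub>R f x else 0)" for x
          using \<psi>(5)[of x k] cd ab box_subset_cbox[of c d] by (auto simp: h_def)
        then show ?thesis
          using zero[OF \<psi>(1)[of k]] Lebesgue_Measure.integral_restrict_UNIV[OF UL, of "\<lambda>x. \<psi> k x *\<^sub>R f x"] by simp
      qed
      ultimately show ?thesis by (simp add: LIMSEQ_const_iff)
    qed
    define h0 where "h0 = (\<lambda>x. indicat_real (box a b) x *\<^sub>R h x)"
    have "AE x in lebesgue. h0 x = 0"
    proof (rule set_integral_zero_all)
      show "integrable lebesgue h0"
        unfolding h0_def using h by (intro integrable_mult_indicator) auto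
      fix c d :: 'a
      obtain c' d' where cd': "box c d \<inter> box a b = box c' d'"
        by (rule that[OF box_Int_box])
      have "(\<integral>x. indicator (box c d) x *\<^sub>R h0 x \<partial>lebesgue) = (\<integral>x. indicator (box c' d') x *\<^sub>R h x \<partial>lebesgue)"
        unfolding h0_def cd'[symmetric] by (intro Bochner_Integration.integral_cong) (auto split: split_indicator)
      also have "\<dots> = 0"
      proof (cases "box c' d' = {}")
        case False
        have "cbox c' d' = closure (box c' d')" using closure_box[OF False] by simp
        also have "\<dots> \<subseteq> cbox a b"
          using cd' box_subset_cbox[of a b] by (intro closure_minimal) auto
        finally show ?thesis by (rule small)
      qed simp
      finally show "(\<integral>x. indicator (box c d) x *\<^sub>R h0 x \<partial>lebesgue) = 0" .
    qed
    moreover have "AE x in lebesgue. x \<notin> cbox a b - box a b"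
      using negligible_frontier_interval[of a b] by (intro AE_not_in) (simp add: negligible_iff_null_sets)
    ultimately show ?thesis
      by eventually_elim (auto simp: h0_def h_def split: if_splits)
  qed
  obtain D where D: "countable D" "D \<subseteq> Pow U" "\<And>X. X \<in> D \<Longrightarrow> \<exists>a b. X = cbox a b" "\<Union>D = U"
    using open_countable_Union_open_cbox[OF U] by metis
  show ?thesis
  proof (rule AE_lebesgue_on_UN[OF D(1), where A = "\<lambda>X. X"])
    fix X assume "X \<in> D"
    with D(3) obtain a b where X: "X = cbox a b" by blast
    with \<open>X \<in> D\<close> D(2) have "cbox a b \<subseteq> U" by blast
    with X show "AE x in lebesgue. x \<in> X \<longrightarrow> f x = 0" using cbox0 by simp
  qed (use D(4) UL in auto)
qed

section \<open>Integration by parts\<close>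

lemma difference_quotient_tendsto:
  fixes f :: "'a::real_normed_vector \<Rightarrow> 'b::real_normed_vector"
  assumes f: "(f has_derivative f') (at x)"
  shows "(\<lambda>n. real (Suc n) *\<^sub>R (f (x + inverse (real (Suc n)) *\<^sub>R e) - f x)) \<longlonglongrightarrow> f' e"
proof (cases "e = 0")
  case True
  then show ?thesis using linear_0[OF has_derivative_linear[OF f]] by simp
next
  case False
  define h where "h n = inverse (real (Suc n)) *\<^sub>R e" for n
  have "h \<longlonglongrightarrow> 0 *\<^sub>R e"
    unfolding h_def by (intro tendsto_scaleR tendsto_const LIMSEQ_inverse_real_of_nat)
  then have "filterlim h (at 0) sequentially"
    using False by (auto simp: filterlim_at h_def)
  moreover have "((\<lambda>h. norm (f (x + h) - f x - f' h) / norm h) \<longlongrightarrow> 0) (at 0)"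
    using f by (simp add: has_derivative_at)
  ultimately have "(\<lambda>n. norm (f (x + h n) - f x - f' (h n)) / norm (h n)) \<longlonglongrightarrow> 0"
    by (rule filterlim_compose[rotated])
  from tendsto_mult_right_zero[OF this, of "norm e"]
  have "(\<lambda>n. norm e * (norm (f (x + h n) - f x - f' (h n)) / norm (h n))) \<longlonglongrightarrow> 0" .
  moreover have "norm e * (norm (f (x + h n) - f x - f' (h n)) / norm (h n))
      = norm (real (Suc n) *\<^sub>R (f (x + h n) - f x) - f' e)" for n
  proof -
    have "f' (h n) = inverse (real (Suc n)) *\<^sub>R f' e"
      by (simp add: h_def linear_scale[OF has_derivative_linear[OF f]])
    then have "real (Suc n) *\<^sub>R (f (x + h n) - f x) - f' e = real (Suc n) *\<^sub>R (f (x + h n) - f x - f' (h n))"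
      by (simp add: scaleR_diff_right del: of_nat_Suc)
    then have N: "norm (real (Suc n) *\<^sub>R (f (x + h n) - f x) - f' e) = real (Suc n) * norm (f (x + h n) - f x - f' (h n))"
      by (simp del: of_nat_Suc)
    have q: "norm e / norm (h n) = real (Suc n)"
      using False by (simp add: h_def inverse_eq_divide del: of_nat_Suc)
    have "norm e * (norm (f (x + h n) - f x - f' (h n)) / norm (h n)) = norm e / norm (h n) * norm (f (x + h n) - f x - f' (h n))"
      by simp
    then show ?thesis by (simp only: q N)
  qed
  ultimately have "(\<lambda>n. norm (real (Suc n) *\<^sub>R (f (x + h n) - f x) - f' e)) \<longlonglongrightarrow> 0" by simp
  from LIM_zero_cancel[OF tendsto_norm_zero_cancel[OF this]] show ?thesis
    unfolding h_def .
qed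

lemma lborel_translate:
  fixes f :: "'a::euclidean_space \<Rightarrow> 'b::euclidean_space"
  assumes f: "integrable lborel f"
  shows "integrable lborel (\<lambda>z. f (z - y))" "(\<integral>z. f (z - y) \<partial>lborel) = (\<integral>z. f z \<partial>lborel)"
proof -
  have m: "(+) (- y) \<in> lborel \<rightarrow>\<^sub>M borel" "f \<in> borel_measurable borel"
    using f by auto
  show "integrable lborel (\<lambda>z. f (z - y))"
    using integrable_distr_eq[OF m] f lborel_distr_plus[of "- y"] by simp
  show "(\<integral>z. f (z - y) \<partial>lborel) = (\<integral>z. f z \<partial>lborel)"
    using integral_distr[OF m] lborel_distr_plus[of "- y"] by simp
qed

text \<open>
  By translation invariance the difference quotients of \<open>f\<close> in direction \<open>e\<close> have integral zero. They
  are uniformly bounded by the mean value inequality and vanish off a common ball, so dominated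
  convergence applies. This treats all directions alike, without coordinates.
\<close>
lemma integral_derivative_test_fun:
  fixes f :: "'a::euclidean_space \<Rightarrow> 'b::euclidean_space"
  assumes f: "test_fun UNIV f"
  shows "(\<integral>x. frechet_derivative f (at x) e \<partial>lborel) = 0"
proof -
  obtain K where K: "compact K" "\<And>x. x \<notin> K \<Longrightarrow> f x = 0"
    "\<And>x e. x \<notin> K \<Longrightarrow> frechet_derivative f (at x) e = 0"
    by (rule test_fun_support[OF f]) blast
  define f' where "f' x = frechet_derivative f (at x) e" for x
  have der: "(f has_derivative frechet_derivative f (at x)) (at x)" for x
    by (rule smooth_has_derivative[OF test_fun_smooth[OF f]])
  have cont: "continuous_on UNIV f" "continuous_on UNIV f'"
    unfolding f'_def by (rule smooth_continuous[OF test_fun_smooth[OF f]]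
      smooth_continuous[OF test_fun_smooth[OF test_fun_derivative[OF f]]])+
  obtain B0 where B0: "\<And>x. x \<in> K \<Longrightarrow> norm (f' x) \<le> B0"
    using compact_imp_bounded[OF compact_continuous_image[OF continuous_on_subset[OF cont(2) subset_UNIV] K(1)]]
    by (auto simp: bounded_iff)
  define B where "B = max B0 0"
  have B: "norm (f' x) \<le> B" "0 \<le> B" for x
    using B0[of x] K(3)[of x e] by (cases "x \<in> K"; force simp: B_def f'_def)+
  obtain R where R: "\<And>x. x \<in> K \<Longrightarrow> norm x \<le> R"
    using compact_imp_bounded[OF K(1)] by (auto simp: bounded_iff)
  have int: "integrable lborel f"
  proof -
    have "f = (\<lambda>x. indicator (cball 0 R) x *\<^sub>R f x)"
      using K(2) R by (fastforce split: split_indicator)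
    moreover have "integrable lborel (\<lambda>x. indicator (cball 0 R) x *\<^sub>R f x)"
      by (intro borel_integrable_compact compact_cball continuous_on_subset[OF cont(1)]) simp
    ultimately show ?thesis by simp
  qed
  define D where "D n x = real (Suc n) *\<^sub>R (f (x + inverse (real (Suc n)) *\<^sub>R e) - f x)" for n x
  have "(\<lambda>n. \<integral>x. D n x \<partial>lborel) \<longlonglongrightarrow> (\<integral>x. f' x \<partial>lborel)"
  proof (rule integral_dominated_convergence[where w = "\<lambda>x. indicator (cball 0 (R + norm e)) x *\<^sub>R B"])
    show "f' \<in> borel_measurable lborel" "D n \<in> borel_measurable lborel" for n
      unfolding D_def measurable_lborel1 using cont
      by (auto intro!: borel_measurable_continuous_onI continuous_intros continuous_on_compose2[OF cont(1)])
    show "integrable lborel (\<lambda>x. indicat_real (cball 0 (R + norm e)) x *\<^sub>R B)"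
      by (intro borel_integrable_compact compact_cball continuous_on_const)
    show "AE x in lborel. (\<lambda>n. D n x) \<longlonglongrightarrow> f' x"
      unfolding D_def f'_def by (intro AE_I2 difference_quotient_tendsto der)
    show "AE x in lborel. norm (D n x) \<le> indicat_real (cball 0 (R + norm e)) x *\<^sub>R B" for n
    proof (intro AE_I2)
      fix x
      let ?h = "inverse (real (Suc n))"
      have h: "0 < ?h" "?h \<le> 1" by (auto simp: field_simps)
      show "norm (D n x) \<le> indicat_real (cball 0 (R + norm e)) x *\<^sub>R B"
      proof (cases "x \<in> cball 0 (R + norm e)")
        case True
        have "\<exists>t\<in>{0<..<?h}. norm (f (x + ?h *\<^sub>R e) - f (x + 0 *\<^sub>R e))
            \<le> norm (frechet_derivative f (at (x + t *\<^sub>R e)) ((?h - 0) *\<^sub>R e))"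
        proof (rule mvt_general[where f = "\<lambda>t. f (x + t *\<^sub>R e)" and f' = "\<lambda>t s. frechet_derivative f (at (x + t *\<^sub>R e)) (s *\<^sub>R e)"])
          show "continuous_on {0..?h} (\<lambda>t. f (x + t *\<^sub>R e))"
            by (intro continuous_on_compose2[OF cont(1)] continuous_intros) auto
          show "((\<lambda>t. f (x + t *\<^sub>R e)) has_derivative (\<lambda>s. frechet_derivative f (at (x + t *\<^sub>R e)) (s *\<^sub>R e))) (at t)" for t
            by (rule has_derivative_compose[OF _ der]) (auto intro!: derivative_eq_intros)
        qed (fact h)
        then obtain t where "norm (f (x + ?h *\<^sub>R e) - f x) \<le> norm (frechet_derivative f (at (x + t *\<^sub>R e)) (?h *\<^sub>R e))"
          by auto
        also have "\<dots> = ?h * norm (f' (x + t *\<^sub>R e))"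
          using h by (simp add: f'_def linear_scale[OF has_derivative_linear[OF der]])
        also have "\<dots> \<le> ?h * B"
          using h B(1) by (intro mult_left_mono) auto
        finally have "real (Suc n) * norm (f (x + ?h *\<^sub>R e) - f x) \<le> real (Suc n) * (?h * B)"
          by (intro mult_left_mono) auto
        also have "real (Suc n) * (?h * B) = B"
          by (simp del: of_nat_Suc)
        finally have "norm (D n x) \<le> B"
          unfolding D_def norm_scaleR by (simp only: real_norm_def abs_of_nat)
        then show ?thesis
          using True by simp
      next
        case False
        then have far: "norm x > R + norm e" by simp
        have "norm (?h *\<^sub>R e) \<le> norm e"
          using h by (simp add: mult_left_le_one_le del: of_nat_Suc)
        moreover have "norm x \<le> norm (x + ?h *\<^sub>R e) + norm (?h *\<^sub>R e)"
          using norm_triangle_ineq4[of "x + ?h *\<^sub>R e" "?h *\<^sub>R e"] by (simp del: norm_scaleR of_nat_Suc)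
        ultimately have "norm (x + ?h *\<^sub>R e) > R" "norm x > R"
          using far norm_ge_zero[of e] by linarith+
        then have "x + ?h *\<^sub>R e \<notin> K" "x \<notin> K"
          using R by (meson leD)+
        then show ?thesis using K(2) False by (simp add: D_def)
      qed
    qed
  qed
  moreover have "(\<integral>x. D n x \<partial>lborel) = 0" for n
  proof -
    have "(\<integral>x. f (x + c) - f x \<partial>lborel) = 0" for c
      using lborel_translate[OF int, of "- c"] int by simp
    then show ?thesis unfolding D_def by simp
  qed
  ultimately show ?thesis
    by (simp add: f'_def LIMSEQ_const_iff)
qed

section \<open>Weak derivatives\<close>

lemma test_fun_bounded:
  assumes "test_fun U (\<phi> :: 'a::euclidean_space \<Rightarrow> 'b::real_normed_vector)"
  obtains B where "B > 0" "\<And>x. norm (\<phi> x) \<le> B"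
proof -
  obtain K where K: "compact K" "\<And>x. x \<notin> K \<Longrightarrow> \<phi> x = 0"
    by (rule test_fun_support[OF assms]) blast
  have "continuous_on K \<phi>"
    using continuous_on_subset[OF smooth_continuous[OF test_fun_smooth[OF assms]]] by blast
  from compact_imp_bounded[OF compact_continuous_image[OF this K(1)]]
  obtain B where B: "\<And>x. x \<in> K \<Longrightarrow> norm (\<phi> x) \<le> B"
    by (auto simp: bounded_iff)
  have "norm (\<phi> x) \<le> max B 1" for x
    using B[of x] K(2)[of x] by (cases "x \<in> K") auto
  then show thesis by (intro that[of "max B 1"]) auto
qed

lemma test_fun_measurable:
  assumes "test_fun U \<phi>" shows "\<phi> \<in> borel_measurable (lebesgue_on S)"
  using smooth_continuous[OF test_fun_smooth[OF assms]]
  by (intro measurable_restrict_space1 measurable_completion) (simp add: borel_measurable_continuous_onI)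

lemma locally_integrable_continuous:
  assumes "continuous_on UNIV (f :: 'a::euclidean_space \<Rightarrow> 'b::euclidean_space)"
  shows "locally_integrable U f"
  unfolding locally_integrable_def
proof (intro allI impI)
  fix K assume K: "compact K \<and> K \<subseteq> U"
  have "integrable lborel (\<lambda>x. indicator K x *\<^sub>R f x)"
    using K continuous_on_subset[OF assms] by (intro borel_integrable_compact) auto
  then have "integrable lebesgue (\<lambda>x. indicator K x *\<^sub>R f x)"
    using integrable_completion[of "\<lambda>x. indicator K x *\<^sub>R f x" lborel] borel_measurable_integrable by blast
  then show "integrable (lebesgue_on K) f"
    using K by (subst integrable_restrict_space) (auto simp: compact_imp_closed)
qed

text \<open>
  Integration by parts is the vanishing of the integral of the derivative of the product
  \<open>\<phi> f\<close>, which has compact support.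
\<close>
lemma has_weak_deriv_smooth:
  fixes f :: "'a::euclidean_space \<Rightarrow> 'b::euclidean_space"
  assumes U: "open U" and f: "smooth f"
  shows "has_weak_deriv U e f (\<lambda>x. frechet_derivative f (at x) e)"
  unfolding has_weak_deriv_def
proof (intro conjI allI impI)
  have cont: "continuous_on UNIV f" "continuous_on UNIV (\<lambda>x. frechet_derivative f (at x) e)"
    using f smooth_derivative[OF f] smooth_continuous by blast+
  show li: "locally_integrable U f" "locally_integrable U (\<lambda>x. frechet_derivative f (at x) e)"
    by (rule locally_integrable_continuous[OF cont(1)] locally_integrable_continuous[OF cont(2)])+
  fix \<phi> :: "'a \<Rightarrow> real" assume \<phi>: "test_fun U \<phi>"
  obtain K where K: "compact K" "K \<subseteq> U" "\<And>x. x \<notin> K \<Longrightarrow> \<phi> x = 0"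
    "\<And>x e. x \<notin> K \<Longrightarrow> frechet_derivative \<phi> (at x) e = 0"
    by (rule test_fun_support[OF \<phi>]) blast
  let ?d = "\<lambda>x. frechet_derivative \<phi> (at x) e *\<^sub>R f x + \<phi> x *\<^sub>R frechet_derivative f (at x) e"
  have prod: "test_fun UNIV (\<lambda>x. \<phi> x *\<^sub>R f x)"
    using K test_fun_smooth[OF \<phi>] f
    by (intro test_funI[of _ K]) (auto simp: smooth_def intro!: C_diff_scaleR)
  have "frechet_derivative (\<lambda>x. \<phi> x *\<^sub>R f x) (at x) e = ?d x" for x
  proof -
    have "((\<lambda>x. \<phi> x *\<^sub>R f x) has_derivative (\<lambda>e. \<phi> x *\<^sub>R frechet_derivative f (at x) e
        + frechet_derivative \<phi> (at x) e *\<^sub>R f x)) (at x)"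
      by (intro has_derivative_scaleR smooth_has_derivative f test_fun_smooth[OF \<phi>])
    from fun_cong[OF frechet_derivative_at[OF this], of e] show ?thesis
      by (simp add: add.commute)
  qed
  then have "(\<integral>x. ?d x \<partial>lborel) = 0"
    using integral_derivative_test_fun[OF prod, of e] by simp
  moreover have "(\<integral>x. ?d x \<partial>lborel) = (\<integral>x. ?d x \<partial>lebesgue)"
  proof (rule integral_completion[symmetric])
    have "continuous_on UNIV ?d"
      using cont smooth_continuous[OF test_fun_smooth[OF \<phi>]]
        smooth_continuous[OF test_fun_smooth[OF test_fun_derivative[OF \<phi>]]]
      by (intro continuous_intros)
    then show "?d \<in> borel_measurable lborel"
      by (simp add: borel_measurable_continuous_onI)
  qed
  moreover have "(\<integral>x. ?d x \<partial>lebesgue) = (\<integral>x. ?d x \<partial>lebesgue_on U)"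
  proof -
    have "?d x = 0" if "x \<notin> U" for x
    proof -
      have "x \<notin> K" using K(2) that by blast
      then show ?thesis by (simp add: K(3,4))
    qed
    then have "?d = (\<lambda>x. if x \<in> U then ?d x else 0)"
      by (intro ext) simp
    then show ?thesis
      using Lebesgue_Measure.integral_restrict_UNIV[of U ?d] U by simp
  qed
  ultimately have "(\<integral>x. ?d x \<partial>lebesgue_on U) = 0" by simp
  moreover have "(\<integral>x. ?d x \<partial>lebesgue_on U) = (\<integral>x. frechet_derivative \<phi> (at x) e *\<^sub>R f x \<partial>lebesgue_on U)
      + (\<integral>x. \<phi> x *\<^sub>R frechet_derivative f (at x) e \<partial>lebesgue_on U)"
    by (intro Bochner_Integration.integral_add locally_integrable_mult_test[OF U] li \<phi> test_fun_derivative[OF \<phi>])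
  ultimately show "(\<integral>x. frechet_derivative \<phi> (at x) e *\<^sub>R f x \<partial>lebesgue_on U)
      = - (\<integral>x. \<phi> x *\<^sub>R frechet_derivative f (at x) e \<partial>lebesgue_on U)"
    by (simp add: eq_neg_iff_add_eq_0)
qed

lemma locally_integrable_lincomb:
  "locally_integrable U f \<Longrightarrow> locally_integrable U g \<Longrightarrow> locally_integrable U (\<lambda>x. a *\<^sub>R f x + b *\<^sub>R g x)"
  by (auto simp: locally_integrable_def)

lemma has_weak_deriv_lincomb:
  assumes U: "open U" and f: "has_weak_deriv U e f f'" and g: "has_weak_deriv U e g g'"
  shows "has_weak_deriv U e (\<lambda>x. a *\<^sub>R f x + b *\<^sub>R g x) (\<lambda>x. a *\<^sub>R f' x + b *\<^sub>R g' x)"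
  unfolding has_weak_deriv_def
proof (intro conjI allI impI locally_integrable_lincomb)
  show li: "locally_integrable U f" "locally_integrable U g" "locally_integrable U f'" "locally_integrable U g'"
    using f g by (auto simp: has_weak_deriv_def)
  fix \<phi> :: "'a \<Rightarrow> real" assume \<phi>: "test_fun U \<phi>"
  have lin: "(\<integral>x. \<psi> x *\<^sub>R (a *\<^sub>R u x + b *\<^sub>R w x) \<partial>lebesgue_on U)
      = a *\<^sub>R (\<integral>x. \<psi> x *\<^sub>R u x \<partial>lebesgue_on U) + b *\<^sub>R (\<integral>x. \<psi> x *\<^sub>R w x \<partial>lebesgue_on U)"
    if "test_fun U \<psi>" "locally_integrable U u" "locally_integrable U w" for \<psi> :: "'a \<Rightarrow> real" and u w :: "'a \<Rightarrow> 'b"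
  proof -
    have "\<psi> x *\<^sub>R (a *\<^sub>R u x + b *\<^sub>R w x) = a *\<^sub>R (\<psi> x *\<^sub>R u x) + b *\<^sub>R (\<psi> x *\<^sub>R w x)" for x
      by (simp add: scaleR_add_right mult.commute)
    then show ?thesis
      using Bochner_Integration.integral_add[OF
          integrable_scaleR_right[OF locally_integrable_mult_test[OF U that(2,1)], of a]
          integrable_scaleR_right[OF locally_integrable_mult_test[OF U that(3,1)], of b]]
      by (simp only: integral_scaleR_right)
  qed
  show "(\<integral>x. frechet_derivative \<phi> (at x) e *\<^sub>R (a *\<^sub>R f x + b *\<^sub>R g x) \<partial>lebesgue_on U)
      = - (\<integral>x. \<phi> x *\<^sub>R (a *\<^sub>R f' x + b *\<^sub>R g' x) \<partial>lebesgue_on U)"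
    using f g \<phi> by (simp add: lin li test_fun_derivative has_weak_deriv_def)
qed

lemma has_weak_deriv_unique:
  assumes U: "open U" and h: "has_weak_deriv U e f h" and h': "has_weak_deriv U e f h'"
  shows "AE x in lebesgue_on U. h x = h' x"
proof -
  have li: "locally_integrable U h" "locally_integrable U h'"
    using h h' by (auto simp: has_weak_deriv_def)
  have "AE x in lebesgue_on U. 1 *\<^sub>R h x + (-1) *\<^sub>R h' x = 0"
  proof (rule fundamental_lemma_variations[OF U locally_integrable_lincomb[OF li]])
    fix \<phi> :: "'a \<Rightarrow> real" assume \<phi>: "test_fun U \<phi>"
    have "(\<integral>x. \<phi> x *\<^sub>R h x \<partial>lebesgue_on U) = (\<integral>x. \<phi> x *\<^sub>R h' x \<partial>lebesgue_on U)"
      using h h' \<phi> by (simp add: has_weak_deriv_def)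
    then show "(\<integral>x. \<phi> x *\<^sub>R (1 *\<^sub>R h x + (-1) *\<^sub>R h' x) \<partial>lebesgue_on U) = 0"
      using locally_integrable_mult_test[OF U li(1) \<phi>] locally_integrable_mult_test[OF U li(2) \<phi>]
      by (simp add: scaleR_diff_right)
  qed
  then show ?thesis by (auto elim!: eventually_mono)
qed

lemma has_weak_deriv_cong_AE:
  assumes U: "open U" and f: "has_weak_deriv U e f h"
    and ae: "AE x in lebesgue_on U. f x = g x" and g: "locally_integrable U g"
  shows "has_weak_deriv U e g h"
  unfolding has_weak_deriv_def
proof (intro conjI allI impI g)
  show "locally_integrable U h"
    using f by (auto simp: has_weak_deriv_def)
  have lf: "locally_integrable U f"
    using f by (auto simp: has_weak_deriv_def)
  fix \<phi> :: "'a \<Rightarrow> real" assume \<phi>: "test_fun U \<phi>"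
  have "(\<integral>x. frechet_derivative \<phi> (at x) e *\<^sub>R g x \<partial>lebesgue_on U)
      = (\<integral>x. frechet_derivative \<phi> (at x) e *\<^sub>R f x \<partial>lebesgue_on U)"
    using locally_integrable_mult_test[OF U g test_fun_derivative[OF \<phi>, of e]]
      locally_integrable_mult_test[OF U lf test_fun_derivative[OF \<phi>, of e]] ae
    by (intro integral_cong_AE) (auto elim!: eventually_mono)
  then show "(\<integral>x. frechet_derivative \<phi> (at x) e *\<^sub>R g x \<partial>lebesgue_on U) = - (\<integral>x. \<phi> x *\<^sub>R h x \<partial>lebesgue_on U)"
    using f \<phi> by (simp add: has_weak_deriv_def)
qed

lemma test_integral_tendsto:
  fixes f :: "'a::euclidean_space \<Rightarrow> 'b::euclidean_space"
  assumes U: "open U" and \<phi>: "test_fun U (\<phi> :: 'a \<Rightarrow> real)"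
    and li: "\<And>k. locally_integrable U (F k)" "locally_integrable U f"
    and int: "\<And>k. integrable (lebesgue_on U) (\<lambda>x. norm (F k x - f x))"
    and lim: "(\<lambda>k. \<integral>x. norm (F k x - f x) \<partial>lebesgue_on U) \<longlonglongrightarrow> 0"
  shows "(\<lambda>k. \<integral>x. \<phi> x *\<^sub>R F k x \<partial>lebesgue_on U) \<longlonglongrightarrow> (\<integral>x. \<phi> x *\<^sub>R f x \<partial>lebesgue_on U)"
proof -
  obtain B where B: "B > 0" "\<And>x. norm (\<phi> x) \<le> B" by (rule test_fun_bounded[OF \<phi>]) blast
  note i = locally_integrable_mult_test[OF U li(1) \<phi>] locally_integrable_mult_test[OF U li(2) \<phi>]
  show ?thesis
  proof (rule LIM_zero_cancel, rule Lim_null_comparison)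
  show "\<forall>\<^sub>F k in sequentially. norm ((\<integral>x. \<phi> x *\<^sub>R F k x \<partial>lebesgue_on U) - (\<integral>x. \<phi> x *\<^sub>R f x \<partial>lebesgue_on U))
      \<le> B * (\<integral>x. norm (F k x - f x) \<partial>lebesgue_on U)"
  proof (intro always_eventually allI)
    fix k
    have "norm ((\<integral>x. \<phi> x *\<^sub>R F k x \<partial>lebesgue_on U) - (\<integral>x. \<phi> x *\<^sub>R f x \<partial>lebesgue_on U))
        = norm (\<integral>x. \<phi> x *\<^sub>R F k x - \<phi> x *\<^sub>R f x \<partial>lebesgue_on U)"
      using i by simp
    also have "\<dots> \<le> (\<integral>x. B * norm (F k x - f x) \<partial>lebesgue_on U)"
    proof (rule Bochner_Integration.integral_norm_bound_integral)
      show "norm (\<phi> x *\<^sub>R F k x - \<phi> x *\<^sub>R f x) \<le> B * norm (F k x - f x)" for x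
        using B(2)[of x] by (simp flip: scaleR_diff_right add: mult_right_mono)
    qed (use i int in auto)
    finally show "norm ((\<integral>x. \<phi> x *\<^sub>R F k x \<partial>lebesgue_on U) - (\<integral>x. \<phi> x *\<^sub>R f x \<partial>lebesgue_on U))
      \<le> B * (\<integral>x. norm (F k x - f x) \<partial>lebesgue_on U)" by simp
  qed
  show "(\<lambda>k. B * (\<integral>x. norm (F k x - f x) \<partial>lebesgue_on U)) \<longlonglongrightarrow> 0"
    using tendsto_mult_right_zero[OF lim] .
qed
qed

lemma has_weak_deriv_limit:
  assumes U: "open U" and F: "\<And>k. has_weak_deriv U e (F k) (H k)"
    and li: "locally_integrable U f" "locally_integrable U h"
    and "\<And>k. integrable (lebesgue_on U) (\<lambda>x. norm (F k x - f x))" "\<And>k. integrable (lebesgue_on U) (\<lambda>x. norm (H k x - h x))"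
    and "(\<lambda>k. \<integral>x. norm (F k x - f x) \<partial>lebesgue_on U) \<longlonglongrightarrow> 0"
      "(\<lambda>k. \<integral>x. norm (H k x - h x) \<partial>lebesgue_on U) \<longlonglongrightarrow> 0"
  shows "has_weak_deriv U e f h"
  unfolding has_weak_deriv_def
proof (intro conjI allI impI li)
  have lk: "locally_integrable U (F k)" "locally_integrable U (H k)" for k
    using F[of k] by (auto simp: has_weak_deriv_def)
  fix \<phi> :: "'a \<Rightarrow> real" assume \<phi>: "test_fun U \<phi>"
  have "(\<lambda>k. \<integral>x. frechet_derivative \<phi> (at x) e *\<^sub>R F k x \<partial>lebesgue_on U)
      \<longlonglongrightarrow> (\<integral>x. frechet_derivative \<phi> (at x) e *\<^sub>R f x \<partial>lebesgue_on U)"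
    by (intro test_integral_tendsto[OF U test_fun_derivative[OF \<phi>]] lk li assms)
  moreover have "(\<lambda>k. - (\<integral>x. \<phi> x *\<^sub>R H k x \<partial>lebesgue_on U)) \<longlonglongrightarrow> - (\<integral>x. \<phi> x *\<^sub>R h x \<partial>lebesgue_on U)"
    by (intro tendsto_minus test_integral_tendsto[OF U \<phi>] lk li assms)
  moreover have "(\<integral>x. frechet_derivative \<phi> (at x) e *\<^sub>R F k x \<partial>lebesgue_on U) = - (\<integral>x. \<phi> x *\<^sub>R H k x \<partial>lebesgue_on U)" for k
    using F[of k] \<phi> by (simp add: has_weak_deriv_def)
  ultimately show "(\<integral>x. frechet_derivative \<phi> (at x) e *\<^sub>R f x \<partial>lebesgue_on U) = - (\<integral>x. \<phi> x *\<^sub>R h x \<partial>lebesgue_on U)"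
    using LIMSEQ_unique by simp
qed

section \<open>Pointwise inequalities\<close>

lemma young_powr:
  fixes a b p :: real
  assumes "1 < p" "0 \<le> a" "0 \<le> b"
  shows "a powr (p - 1) * b \<le> (p - 1) / p * a powr p + b powr p / p"
proof -
  have "b * a powr (p - 1) \<le> b powr p / p + (a powr (p - 1)) powr (p / (p - 1)) / (p / (p - 1))"
    using assms by (intro Youngs_inequality) (auto simp: field_simps)
  then show ?thesis
    using assms by (simp add: powr_powr mult.commute)
qed

text \<open>
  Young's inequality for \<open>l a\<close> and \<open>l^(1-p) b\<close>. The free weight \<open>l\<close> is what later produces the sharp
  exponent \<open>1/(p-1)\<close> of the decay rate.
\<close>
lemma young_powr_weighted:
  fixes a b p l :: real
  assumes "1 < p" "0 \<le> a" "0 \<le> b" "0 < l"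
  shows "a powr (p - 1) * b \<le> (p - 1) / p * (l powr p * a powr p) + l powr (p * (1 - p)) * b powr p / p"
proof -
  have "a powr (p - 1) * b = (l * a) powr (p - 1) * (l powr (1 - p) * b)"
    using assms by (simp add: powr_mult powr_diff powr_add[symmetric] field_simps)
  also have "\<dots> \<le> (p - 1) / p * (l * a) powr p + (l powr (1 - p) * b) powr p / p"
    using assms by (intro young_powr) auto
  also have "\<dots> = (p - 1) / p * (l powr p * a powr p) + l powr (p * (1 - p)) * b powr p / p"
    using assms by (simp add: powr_mult powr_powr mult.commute)
  finally show ?thesis .
qed

lemma young_powr_eps:
  fixes p \<epsilon> :: real
  assumes p: "1 < p" and \<epsilon>: "0 < \<epsilon>"
  obtains C where "C > 0" "\<And>a b. 0 \<le> a \<Longrightarrow> 0 \<le> b \<Longrightarrow> a powr (p - 1) * b \<le> \<epsilon> * a powr p + C * b powr p"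
proof -
  define l where "l = \<epsilon> powr (1 / p)"
  have l: "l > 0" "l powr p = \<epsilon>" using p \<epsilon> by (auto simp: l_def powr_powr)
  show thesis
  proof
    show "l powr (p * (1 - p)) / p > 0" using p l by simp
    fix a b :: real assume ab: "0 \<le> a" "0 \<le> b"
    have "(p - 1) / p * (\<epsilon> * a powr p) \<le> 1 * (\<epsilon> * a powr p)"
      using p \<epsilon> by (intro mult_right_mono) auto
    then show "a powr (p - 1) * b \<le> \<epsilon> * a powr p + l powr (p * (1 - p)) / p * b powr p"
      using young_powr_weighted[OF p ab l(1)] l(2) by simp
  qed
qed

lemma norm_pflux: "norm (pflux p z) = norm z powr (p - 1)"
  by (cases "z = 0") (auto simp: pflux_def powr_mult_base' mult.commute powr_diff power2_eq_square field_simps)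

lemma pflux_inner_self: "pflux p z \<bullet> z = norm z powr p"
  by (cases "z = 0") (auto simp: pflux_def powr_diff power2_norm_eq_inner[symmetric] power2_eq_square)

lemma pflux_inner_le: "\<bar>pflux p z \<bullet> w\<bar> \<le> norm z powr (p - 1) * norm w"
  using Cauchy_Schwarz_ineq2[of "pflux p z" w] by (simp add: norm_pflux)

text \<open>
  The convex function \<open>|\<cdot>|^p\<close> has gradient \<open>p |a|^(p-2) a\<close> at \<open>a\<close>; for this particular function the
  tangent inequality is Cauchy-Schwarz followed by Young.
\<close>
lemma powr_norm_subgradient:
  fixes a b :: "'a::real_inner"
  assumes p: "1 < p"
  shows "norm a powr p + p * (pflux p a \<bullet> (b - a)) \<le> norm b powr p"
proof -
  have "pflux p a \<bullet> b \<le> norm a powr (p - 1) * norm b"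
    using pflux_inner_le[of p a b] by simp
  also have "\<dots> \<le> (p - 1) / p * norm a powr p + norm b powr p / p"
    using p by (intro young_powr) auto
  finally have "p * (pflux p a \<bullet> b) \<le> p * ((p - 1) / p * norm a powr p + norm b powr p / p)"
    using p by (intro mult_left_mono) auto
  also have "\<dots> = (p - 1) * norm a powr p + norm b powr p"
    using p by (simp add: field_simps)
  finally show ?thesis
    by (simp add: inner_diff_right pflux_inner_self algebra_simps)
qed

lemma powr_norm_midpoint:
  fixes a b :: "'a::real_inner"
  assumes p: "1 < p"
  shows "norm ((1/2) *\<^sub>R a + (1/2) *\<^sub>R b) powr p \<le> (norm a powr p + norm b powr p) / 2"
proof -
  define m where "m = (1/2) *\<^sub>R a + (1/2) *\<^sub>R b"
  have z: "(a - m) + (b - m) = 0"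
    unfolding m_def by (simp add: algebra_simps flip: scaleR_add_left)
  have "p * (pflux p m \<bullet> (a - m)) + p * (pflux p m \<bullet> (b - m)) = p * (pflux p m \<bullet> ((a - m) + (b - m)))"
    by (simp only: inner_add_right distrib_left)
  then show ?thesis
    using powr_norm_subgradient[OF p, of m a] powr_norm_subgradient[OF p, of m b] z
    by (simp add: m_def[symmetric])
qed

lemma powr_midpoint_strict:
  fixes a b p :: real
  assumes p: "1 < p" and ab: "0 \<le> a" "a < b"
  shows "((a + b) / 2) powr p < (a powr p + b powr p) / 2"
proof -
  define c where "c = (a + b) / 2"
  have c: "a < c" "c < b" using ab by (auto simp: c_def)
  have der: "((\<lambda>x. x powr p) has_real_derivative p * x powr (p - 1)) (at x)" if "x > 0" for x
    using that by (rule has_real_derivative_powr)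
  have cont: "continuous_on S (\<lambda>x::real. x powr p)" if "S \<subseteq> {0..}" for S
    using that p by (intro continuous_on_powr' continuous_intros) auto
  obtain y where y: "a < y" "y < c" "c powr p - a powr p = p * y powr (p - 1) * (c - a)"
  proof (rule mvt[where f = "\<lambda>x. x powr p" and f' = "\<lambda>x. (*) (p * x powr (p - 1))", OF c(1)])
    show "continuous_on {a..c} (\<lambda>x. x powr p)" using ab by (intro cont) auto
    show "((\<lambda>x. x powr p) has_derivative (*) (p * x powr (p - 1))) (at x)" if "a < x" for x
      using der[of x] that ab by (simp add: has_field_derivative_def)
  qed
  obtain z where z: "c < z" "z < b" "b powr p - c powr p = p * z powr (p - 1) * (b - c)"
  proof (rule mvt[where f = "\<lambda>x. x powr p" and f' = "\<lambda>x. (*) (p * x powr (p - 1))", OF c(2)])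
    show "continuous_on {c..b} (\<lambda>x. x powr p)" using ab c by (intro cont) auto
    show "((\<lambda>x. x powr p) has_derivative (*) (p * x powr (p - 1))) (at x)" if "c < x" for x
      using der[of x] that ab c by (simp add: has_field_derivative_def)
  qed
  have "y powr (p - 1) < z powr (p - 1)"
    using p y z ab by (intro powr_less_mono2) auto
  then have "p * y powr (p - 1) * (c - a) < p * z powr (p - 1) * (c - a)"
    using p c by simp
  moreover have eq: "c - a = b - c" by (simp add: c_def field_simps)
  ultimately have "c powr p - a powr p < b powr p - c powr p"
    unfolding y(3) z(3) eq by metis
  then show ?thesis
    unfolding c_def[symmetric] by simp
qed

lemma powr_norm_midpoint_strict:
  fixes a b :: "'a::real_inner"
  assumes p: "1 < p" and ab: "a \<noteq> b"
  shows "norm ((1/2) *\<^sub>R a + (1/2) *\<^sub>R b) powr p < (norm a powr p + norm b powr p) / 2"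
proof (cases "norm a = norm b")
  case True
  have "(norm ((1/2) *\<^sub>R a + (1/2) *\<^sub>R b))\<^sup>2 + (norm (a - b) / 2)\<^sup>2 = (norm a)\<^sup>2"
  proof -
    have "(norm ((1/2) *\<^sub>R a + (1/2) *\<^sub>R b))\<^sup>2 = (a \<bullet> a + 2 * (a \<bullet> b) + b \<bullet> b) / 4"
      unfolding power2_norm_eq_inner by (simp add: inner_add inner_commute field_simps)
    moreover have "(norm (a - b) / 2)\<^sup>2 = (a \<bullet> a - 2 * (a \<bullet> b) + b \<bullet> b) / 4"
      unfolding power_divide power2_norm_eq_inner by (simp add: inner_diff inner_commute)
    moreover have "a \<bullet> a = (norm a)\<^sup>2" "b \<bullet> b = (norm a)\<^sup>2"
      using True by (metis power2_norm_eq_inner)+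
    ultimately show ?thesis by (simp add: field_simps)
  qed
  moreover have "0 < (norm (a - b) / 2)\<^sup>2" using ab by simp
  ultimately have "(norm ((1/2) *\<^sub>R a + (1/2) *\<^sub>R b))\<^sup>2 < (norm a)\<^sup>2" by linarith
  then have "norm ((1/2) *\<^sub>R a + (1/2) *\<^sub>R b) < norm a"
    by (rule power2_less_imp_less) simp
  then have "norm ((1/2) *\<^sub>R a + (1/2) *\<^sub>R b) powr p < norm a powr p"
    using p by (intro powr_less_mono2) auto
  then show ?thesis using True by simp
next
  case False
  have "norm ((1/2) *\<^sub>R a + (1/2) *\<^sub>R b) powr p \<le> ((norm a + norm b) / 2) powr p"
    using p norm_triangle_ineq[of "(1/2) *\<^sub>R a" "(1/2) *\<^sub>R b"] by (intro powr_mono2) auto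
  also have "\<dots> < (norm a powr p + norm b powr p) / 2"
    using False powr_midpoint_strict[OF p, of "norm a" "norm b"] powr_midpoint_strict[OF p, of "norm b" "norm a"]
    by (cases "norm a < norm b") (auto simp: add.commute)
  finally show ?thesis .
qed

text \<open>
  This form of uniform convexity covers all \<open>p > 1\<close> at once, where Clarkson's inequalities distinguish
  \<open>p < 2\<close> from \<open>p \<ge> 2\<close>. Both sides are homogeneous, so the pair may be normalised. On the compact set of
  normalised pairs with \<open>\<epsilon> \<le> |a - b|^p\<close> the convexity gap is positive by strict convexity, hence
  bounded below by a positive constant.
\<close>
lemma powr_norm_uniformly_convex:
  fixes p \<epsilon> :: real
  assumes p: "1 < p" and \<epsilon>: "0 < \<epsilon>"
  obtains C where "C > 0" "\<And>a b :: 'a::euclidean_space. norm (a - b) powr p \<le> \<epsilon> * (norm a powr p + norm b powr p)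
      + C * ((norm a powr p + norm b powr p) / 2 - norm ((1/2) *\<^sub>R a + (1/2) *\<^sub>R b) powr p)"
proof -
  define N where "N = (\<lambda>(a::'a, b::'a). norm a powr p + norm (b::'a) powr p)"
  define G where "G = (\<lambda>(a::'a, b::'a). (norm a powr p + norm b powr p) / 2 - norm ((1/2) *\<^sub>R a + (1/2) *\<^sub>R b) powr p)"
  define S where "S = {x. N x = 1} \<inter> {x. \<epsilon> \<le> norm (fst x - snd x) powr p}"
  have cont: "continuous_on UNIV N" "continuous_on UNIV G" "continuous_on UNIV (\<lambda>x::'a\<times>'a. norm (fst x - snd x) powr p)"
    unfolding N_def G_def case_prod_beta using p
    by (intro continuous_intros continuous_on_powr'; simp)+
  have "closed S"
    unfolding S_def
    by (intro closed_Int closed_Collect_eq[OF cont(1) continuous_on_const] closed_Collect_le[OF continuous_on_const cont(3)])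
  moreover have "bounded S"
  proof -
    have "norm x \<le> 2" if "x \<in> S" for x
    proof -
      obtain a b where x: "x = (a, b)" by (cases x)
      have "norm a powr p + norm b powr p = 1" using that by (simp add: S_def N_def x)
      then have "norm a powr p \<le> 1 powr p" "norm b powr p \<le> 1 powr p"
        using powr_ge_zero[of "norm a" p] powr_ge_zero[of "norm b" p] by (simp_all del: powr_ge_zero)
      then have "norm a \<le> 1" "norm b \<le> 1"
        using p powr_less_mono2[of p 1 "norm a"] powr_less_mono2[of p 1 "norm b"] by fastforce+
      then show ?thesis using norm_Pair_le[of a b] x by auto
    qed
    then show ?thesis by (rule boundedI)
  qed
  ultimately have S: "compact S" by (simp add: compact_eq_bounded_closed)
  have pos: "G x > 0" if "x \<in> S" for x
  proof -
    obtain a b where x: "x = (a, b)" by (cases x)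
    have "a \<noteq> b" using that \<epsilon> by (auto simp: S_def x)
    then show ?thesis using powr_norm_midpoint_strict[OF p, of a b] by (simp add: G_def x)
  qed
  obtain d where d: "d > 0" "\<And>x. x \<in> S \<Longrightarrow> d \<le> G x"
  proof (cases "S = {}")
    case False
    then obtain x0 where "x0 \<in> S" "\<And>x. x \<in> S \<Longrightarrow> G x0 \<le> G x"
      using continuous_attains_inf[OF S False continuous_on_subset[OF cont(2)]] by auto
    then show thesis using that[of "G x0"] pos by auto
  qed (use that[of 1] in auto)
  define C where "C = 2 powr p / d"
  show thesis
  proof
    show "C > 0" using d by (simp add: C_def)
    fix a b :: 'a
    define n where "n = norm a powr p + norm b powr p"
    define g where "g = (norm a powr p + norm b powr p) / 2 - norm ((1/2) *\<^sub>R a + (1/2) *\<^sub>R b) powr p"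
    have n0: "n \<ge> 0" by (simp add: n_def)
    have g0: "g \<ge> 0" using powr_norm_midpoint[OF p, of a b] by (simp add: g_def)
    have Cg: "C * g \<ge> 0" using g0 d by (simp add: C_def)
    have tri: "norm (a - b) powr p \<le> 2 powr p * n"
    proof -
      have "norm (a - b) powr p \<le> (2 * max (norm a) (norm b)) powr p"
        using norm_triangle_ineq4[of a b] p by (intro powr_mono2) auto
      also have "\<dots> \<le> 2 powr p * n"
        by (auto simp: powr_mult n_def max_def)
      finally show ?thesis .
    qed
    show "norm (a - b) powr p \<le> \<epsilon> * (norm a powr p + norm b powr p)
      + C * ((norm a powr p + norm b powr p) / 2 - norm ((1/2) *\<^sub>R a + (1/2) *\<^sub>R b) powr p)"
    proof (cases "norm (a - b) powr p \<le> \<epsilon> * n")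
      case True
      then show ?thesis using Cg by (simp add: n_def g_def)
    next
      case False
      have "n > 0"
        using n0 False tri by (cases "n = 0") auto
      define r where "r = n powr (- 1 / p)"
      have r: "r > 0" "r powr p = 1 / n"
      proof -
        have "r powr p = n powr (- 1 / p * p)" unfolding r_def by (rule powr_powr)
        then show "r powr p = 1 / n" using \<open>n > 0\<close> p by (simp add: powr_minus_divide)
      qed (use \<open>n > 0\<close> in \<open>simp add: r_def\<close>)
      have sc: "norm (r *\<^sub>R w) powr p = norm w powr p / n" for w :: 'a
        using r by (simp add: powr_mult)
      have "N (r *\<^sub>R a, r *\<^sub>R b) = 1"
        using \<open>n > 0\<close> unfolding N_def by (simp only: prod.case sc) (simp add: n_def flip: add_divide_distrib)
      moreover have "\<epsilon> \<le> norm (r *\<^sub>R a - r *\<^sub>R b) powr p"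
        using \<open>n > 0\<close> False by (simp only: sc flip: scaleR_diff_right) (simp add: field_simps)
      ultimately have "d \<le> G (r *\<^sub>R a, r *\<^sub>R b)"
        by (intro d) (simp add: S_def)
      also have "\<dots> = g / n"
      proof -
        have "(1/2) *\<^sub>R (r *\<^sub>R a) + (1/2) *\<^sub>R (r *\<^sub>R b) = r *\<^sub>R ((1/2) *\<^sub>R a + (1/2) *\<^sub>R b)"
          by (simp add: scaleR_add_right)
        then show ?thesis
          unfolding G_def prod.case by (simp only: sc) (simp add: g_def add_divide_distrib diff_divide_distrib)
      qed
      finally have "d * n \<le> g" using \<open>n > 0\<close> by (simp add: field_simps)
      then have "2 powr p * n \<le> C * g"
        using d by (simp add: C_def field_simps)
      moreover have "\<epsilon> * n \<ge> 0" using n0 \<epsilon> by simp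
      ultimately show ?thesis using tri by (simp add: n_def g_def)
    qed
  qed
qed

lemma powr_norm_add_le:
  fixes a b :: "'a::real_normed_vector"
  assumes p: "0 < p"
  shows "norm (a + b) powr p \<le> 2 powr p * (norm a powr p + norm b powr p)"
proof -
  have "norm (a + b) powr p \<le> (2 * max (norm a) (norm b)) powr p"
    using norm_triangle_ineq[of a b] p by (intro powr_mono2) auto
  also have "\<dots> \<le> 2 powr p * (norm a powr p + norm b powr p)"
    by (auto simp: powr_mult max_def)
  finally show ?thesis .
qed

lemma norm_le_eps_powr:
  fixes a \<epsilon> p :: real
  assumes "1 < p" "0 < \<epsilon>" "0 \<le> a"
  shows "a \<le> \<epsilon> + \<epsilon> powr (1 - p) * a powr p"
proof (cases "a \<le> \<epsilon>")
  case False
  have "a = a powr (1 - p) * a powr p"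
    using False assms by (simp flip: powr_add)
  also have "\<dots> \<le> \<epsilon> powr (1 - p) * a powr p"
    using False assms by (intro mult_right_mono powr_mono2') auto
  finally show ?thesis using assms by simp
qed (use assms in \<open>simp add: add_increasing2\<close>)

section \<open>Integrals of p-th powers\<close>

lemma abs_integral_le:
  fixes f g :: "'a \<Rightarrow> real"
  assumes "integrable M f" "integrable M g" "\<And>x. \<bar>f x\<bar> \<le> g x"
  shows "\<bar>\<integral>x. f x \<partial>M\<bar> \<le> (\<integral>x. g x \<partial>M)"
  by (rule order_trans[OF integral_abs_bound integral_mono]) (use assms in auto)

lemma integrable_powr_norm_lincomb:
  fixes f g :: "'a \<Rightarrow> 'b::euclidean_space"
  assumes p: "1 < p" and [measurable]: "f \<in> borel_measurable M" "g \<in> borel_measurable M"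
    and f: "integrable M (\<lambda>x. norm (f x) powr p)" and g: "integrable M (\<lambda>x. norm (g x) powr p)"
  shows "integrable M (\<lambda>x. norm (a *\<^sub>R f x + b *\<^sub>R g x) powr p)"
proof (rule Bochner_Integration.integrable_bound)
  show "integrable M (\<lambda>x. 2 powr p * (\<bar>a\<bar> powr p * norm (f x) powr p + \<bar>b\<bar> powr p * norm (g x) powr p))"
    using f g by simp
  show "AE x in M. norm (norm (a *\<^sub>R f x + b *\<^sub>R g x) powr p)
      \<le> norm (2 powr p * (\<bar>a\<bar> powr p * norm (f x) powr p + \<bar>b\<bar> powr p * norm (g x) powr p))"
  proof (intro AE_I2)
    fix x
    show "norm (norm (a *\<^sub>R f x + b *\<^sub>R g x) powr p)
      \<le> norm (2 powr p * (\<bar>a\<bar> powr p * norm (f x) powr p + \<bar>b\<bar> powr p * norm (g x) powr p))"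
      using powr_norm_add_le[of p "a *\<^sub>R f x" "b *\<^sub>R g x"] p by (simp add: powr_mult)
  qed
qed simp

lemma integral_powr_norm_add_le:
  fixes f g :: "'a \<Rightarrow> 'b::euclidean_space"
  assumes p: "1 < p" and m: "f \<in> borel_measurable M" "g \<in> borel_measurable M"
    and f: "integrable M (\<lambda>x. norm (f x) powr p)" and g: "integrable M (\<lambda>x. norm (g x) powr p)"
  shows "(\<integral>x. norm (f x + g x) powr p \<partial>M) \<le> 2 powr p * ((\<integral>x. norm (f x) powr p \<partial>M) + (\<integral>x. norm (g x) powr p \<partial>M))"
proof -
  have "(\<integral>x. norm (f x + g x) powr p \<partial>M) \<le> (\<integral>x. 2 powr p * (norm (f x) powr p + norm (g x) powr p) \<partial>M)"
    using integrable_powr_norm_lincomb[OF p m f g, of 1 1] f g p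
    by (intro integral_mono) (auto intro!: powr_norm_add_le)
  then show ?thesis using f g by simp
qed

lemma pflux_measurable:
  assumes "f \<in> borel_measurable M"
  shows "(\<lambda>x. pflux p (f x) :: 'b::euclidean_space) \<in> borel_measurable M"
  using assms unfolding pflux_def by measurable

lemma integrable_pflux_inner:
  fixes f g :: "'a \<Rightarrow> 'b::euclidean_space"
  assumes p: "1 < p" and m: "f \<in> borel_measurable M" "g \<in> borel_measurable M"
    and f: "integrable M (\<lambda>x. norm (f x) powr p)" and g: "integrable M (\<lambda>x. norm (g x) powr p)"
  shows "integrable M (\<lambda>x. pflux p (f x) \<bullet> g x)" "integrable M (\<lambda>x. norm (f x) powr (p - 1) * norm (g x))"
proof -
  note [measurable] = m pflux_measurable[OF m(1), of p]
  have i: "integrable M (\<lambda>x. (p - 1) / p * norm (f x) powr p + norm (g x) powr p / p)"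
    using f g by simp
  have y: "norm (f x) powr (p - 1) * norm (g x) \<le> (p - 1) / p * norm (f x) powr p + norm (g x) powr p / p" for x
    using p by (intro young_powr) auto
  show i2: "integrable M (\<lambda>x. norm (f x) powr (p - 1) * norm (g x))"
  proof (rule Bochner_Integration.integrable_bound[OF i])
    show "AE x in M. norm (norm (f x) powr (p - 1) * norm (g x))
        \<le> norm ((p - 1) / p * norm (f x) powr p + norm (g x) powr p / p)"
      using order_trans[OF y abs_ge_self] by (intro AE_I2) (simp add: abs_mult)
  qed measurable
  show "integrable M (\<lambda>x. pflux p (f x) \<bullet> g x)"
    by (rule Bochner_Integration.integrable_bound[OF i2]) (auto intro!: AE_I2 pflux_inner_le simp: abs_mult)
qed

lemma integral_pflux_inner_tendsto:
  fixes f :: "'a \<Rightarrow> 'b::euclidean_space"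
  assumes p: "1 < p" and m: "f \<in> borel_measurable M" "\<And>k. h k \<in> borel_measurable M" "g \<in> borel_measurable M"
    and f: "integrable M (\<lambda>x. norm (f x) powr p)"
    and h: "\<And>k. integrable M (\<lambda>x. norm (h k x) powr p)" and g: "integrable M (\<lambda>x. norm (g x) powr p)"
    and lim: "((\<lambda>k. \<integral>x. norm (h k x - g x) powr p \<partial>M) \<longlongrightarrow> 0) F"
  shows "((\<lambda>k. \<integral>x. pflux p (f x) \<bullet> h k x \<partial>M) \<longlongrightarrow> (\<integral>x. pflux p (f x) \<bullet> g x \<partial>M)) F"
proof (rule tendstoI)
  fix e :: real assume e: "e > 0"
  define A where "A = (\<integral>x. norm (f x) powr p \<partial>M)"
  have A: "A \<ge> 0" by (simp add: A_def)
  define \<epsilon> where "\<epsilon> = e / (2 * (A + 1))"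
  have \<epsilon>: "\<epsilon> > 0" "\<epsilon> * A \<le> e / 2" using A e by (auto simp: \<epsilon>_def field_simps)
  obtain C where C: "C > 0" "\<And>a b. 0 \<le> a \<Longrightarrow> 0 \<le> b \<Longrightarrow> a powr (p - 1) * b \<le> \<epsilon> * a powr p + C * b powr p"
    using young_powr_eps[OF p \<epsilon>(1)] by blast
  have "\<forall>\<^sub>F k in F. dist (\<integral>x. norm (h k x - g x) powr p \<partial>M) 0 < e / (2 * C)"
    using e C by (intro tendstoD[OF lim]) auto
  then show "\<forall>\<^sub>F k in F. dist (\<integral>x. pflux p (f x) \<bullet> h k x \<partial>M) (\<integral>x. pflux p (f x) \<bullet> g x \<partial>M) < e"
  proof eventually_elim
    case (elim k)
    have d: "integrable M (\<lambda>x. norm (h k x - g x) powr p)"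
      using integrable_powr_norm_lincomb[OF p m(2)[of k] m(3) h[of k] g, of 1 "-1"] by simp
    have dm: "(\<lambda>x. h k x - g x) \<in> borel_measurable M" using m by simp
    have "dist (\<integral>x. pflux p (f x) \<bullet> h k x \<partial>M) (\<integral>x. pflux p (f x) \<bullet> g x \<partial>M)
        = \<bar>\<integral>x. pflux p (f x) \<bullet> (h k x - g x) \<partial>M\<bar>"
      using integrable_pflux_inner(1)[OF p m(1) m(2)[of k] f h[of k]] integrable_pflux_inner(1)[OF p m(1) m(3) f g]
      by (simp add: inner_diff_right dist_real_def)
    also have "\<dots> \<le> (\<integral>x. \<epsilon> * norm (f x) powr p + C * norm (h k x - g x) powr p \<partial>M)"
    proof (rule abs_integral_le)
      show "\<bar>pflux p (f x) \<bullet> (h k x - g x)\<bar> \<le> \<epsilon> * norm (f x) powr p + C * norm (h k x - g x) powr p" for x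
        by (rule order_trans[OF pflux_inner_le C(2)]) auto
    qed (use integrable_pflux_inner(1)[OF p m(1) dm f d] f d in auto)
    also have "\<dots> = \<epsilon> * A + C * (\<integral>x. norm (h k x - g x) powr p \<partial>M)"
      using f d by (simp add: A_def)
    also have "\<dots> < e / 2 + C * (e / (2 * C))"
      using elim \<epsilon>(2) C(1) by (intro add_le_less_mono mult_strict_left_mono) auto
    finally show ?case using C(1) by simp
  qed
qed

lemma Fatou_bound:
  fixes u :: "nat \<Rightarrow> 'a \<Rightarrow> real"
  assumes u: "\<And>k. integrable M (u k)" "\<And>k x. 0 \<le> u k x" "\<And>k. (\<integral>x. u k x \<partial>M) \<le> C"
    and w[measurable]: "w \<in> borel_measurable M" "\<And>x. 0 \<le> w x" and ae: "AE x in M. (\<lambda>k. u k x) \<longlonglongrightarrow> w x"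
  shows "integrable M w" "(\<integral>x. w x \<partial>M) \<le> C"
proof -
  have C: "0 \<le> C" using order_trans[OF integral_nonneg_AE u(3)[of 0]] u(2) by auto
  have "(\<integral>\<^sup>+x. ennreal (w x) \<partial>M) = (\<integral>\<^sup>+x. liminf (\<lambda>k. ennreal (u k x)) \<partial>M)"
    using ae by (intro nn_integral_cong_AE) (auto elim!: eventually_mono intro!: lim_imp_Liminf[symmetric] tendsto_ennrealI)
  also have "\<dots> \<le> liminf (\<lambda>k. \<integral>\<^sup>+x. ennreal (u k x) \<partial>M)"
    using borel_measurable_integrable[OF u(1)] by (intro nn_integral_liminf) auto
  also have "\<dots> \<le> ennreal C"
  proof (rule order_trans[OF Liminf_mono[OF always_eventually]])
    show "\<forall>k. (\<integral>\<^sup>+x. ennreal (u k x) \<partial>M) \<le> ennreal C"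
      using u by (auto simp: nn_integral_eq_integral intro!: ennreal_leI)
  qed (simp add: Liminf_const)
  finally have le: "(\<integral>\<^sup>+x. ennreal (w x) \<partial>M) \<le> ennreal C" .
  show i: "integrable M w"
    using le w(2) by (intro integrableI_bounded) (auto simp: le_less_trans[OF le])
  show "(\<integral>x. w x \<partial>M) \<le> C"
    using le C w(2) by (simp add: nn_integral_eq_integral[OF i])
qed

text \<open>
  Below the level \<open>\<epsilon>\<close> the integral is at most \<open>\<epsilon>\<close> times the total measure, and above it the
  norm is bounded by a multiple of its \<open>p\<close>-th power.
\<close>
lemma L1_tendsto_of_Lp_tendsto:
  fixes f :: "nat \<Rightarrow> 'a \<Rightarrow> 'b::euclidean_space"
  assumes p: "1 < p" and fin: "finite_measure M" and m: "\<And>k. f k \<in> borel_measurable M"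
    and f: "\<And>k. integrable M (\<lambda>x. norm (f k x) powr p)"
    and lim: "(\<lambda>k. \<integral>x. norm (f k x) powr p \<partial>M) \<longlonglongrightarrow> 0"
  shows "integrable M (f k)" "(\<lambda>k. \<integral>x. norm (f k x) \<partial>M) \<longlonglongrightarrow> 0"
proof -
  interpret finite_measure M by (rule fin)
  have bd: "integrable M (\<lambda>x. \<epsilon> + \<epsilon> powr (1 - p) * norm (f k x) powr p)" for k \<epsilon>
    using f by simp
  show i: "integrable M (f k)" for k
  proof (rule Bochner_Integration.integrable_bound[OF bd[of 1]])
    show "AE x in M. norm (f k x) \<le> norm (1 + 1 powr (1 - p) * norm (f k x) powr p)"
      using norm_le_eps_powr[OF p, of 1] by (intro AE_I2) simp
  qed (rule m)
  show "(\<lambda>k. \<integral>x. norm (f k x) \<partial>M) \<longlonglongrightarrow> 0"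
  proof (rule tendstoI)
    fix e :: real assume e: "e > 0"
    define A where "A = measure M (space M)"
    define \<epsilon> where "\<epsilon> = e / (2 * (A + 1))"
    have A: "A \<ge> 0" by (simp add: A_def)
    have \<epsilon>: "\<epsilon> > 0" "\<epsilon> * A \<le> e / 2" using A e by (auto simp: \<epsilon>_def field_simps)
    define C where "C = \<epsilon> powr (1 - p)"
    have C: "C > 0" using \<epsilon> by (simp add: C_def)
    have "\<forall>\<^sub>F k in sequentially. dist (\<integral>x. norm (f k x) powr p \<partial>M) 0 < e / (2 * C)"
      using e C by (intro tendstoD[OF lim]) auto
    then show "\<forall>\<^sub>F k in sequentially. dist (\<integral>x. norm (f k x) \<partial>M) 0 < e"
    proof eventually_elim
      case (elim k)
      have "(\<integral>x. norm (f k x) \<partial>M) \<le> (\<integral>x. \<epsilon> + C * norm (f k x) powr p \<partial>M)"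
        unfolding C_def using norm_le_eps_powr[OF p \<epsilon>(1)] i[of k] bd[of \<epsilon> k] by (intro integral_mono) auto
      also have "\<dots> = \<epsilon> * A + C * (\<integral>x. norm (f k x) powr p \<partial>M)"
        using f[of k] by (simp add: A_def mult.commute)
      also have "\<dots> < e / 2 + C * (e / (2 * C))"
        using elim \<epsilon>(2) C by (intro add_le_less_mono mult_strict_left_mono) auto
      finally show ?case using C by simp
    qed
  qed
qed

text \<open>
  The Riesz-Fischer theorem. Along a subsequence with rapidly decreasing distances, Borel-Cantelli
  shows that almost everywhere the increments exceed \<open>2^-n\<close> only finitely often, so the subsequence
  converges pointwise. Fatou's lemma turns the Cauchy condition into convergence in \<open>L^p\<close>.
\<close>
lemma Lp_complete:
  fixes f :: "nat \<Rightarrow> 'a \<Rightarrow> 'b::euclidean_space"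
  assumes p: "1 < p" and m[measurable]: "\<And>k. f k \<in> borel_measurable M"
    and f: "\<And>k. integrable M (\<lambda>x. norm (f k x) powr p)"
    and cauchy: "\<And>e. e > 0 \<Longrightarrow> \<exists>N. \<forall>k\<ge>N. \<forall>l\<ge>N. (\<integral>x. norm (f k x - f l x) powr p \<partial>M) < e"
  obtains g r where "g \<in> borel_measurable M" "integrable M (\<lambda>x. norm (g x) powr p)"
    "(\<lambda>k. \<integral>x. norm (f k x - g x) powr p \<partial>M) \<longlonglongrightarrow> 0"
    "strict_mono (r :: nat \<Rightarrow> nat)" "AE x in M. (\<lambda>k. f (r k) x) \<longlonglongrightarrow> g x"
proof -
  have d: "integrable M (\<lambda>x. norm (f k x - f l x) powr p)" for k l
    using integrable_powr_norm_lincomb[OF p m m f f, of 1 k "-1" l] by simp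
  \<comment> \<open>\<open>c ^ n\<close> compensates for the threshold \<open>(1/2) ^ n\<close> raised to the power \<open>p\<close>.\<close>
  define c where "c = 2 powr p"
  have c: "c > 0" by (simp add: c_def)
  have cn: "((1/2) ^ n) powr p = 1 / c ^ n" for n
    by (induction n) (simp_all add: c_def powr_mult powr_divide)
  have "\<exists>r. strict_mono r \<and> (\<forall>n. \<forall>k\<ge>r n. \<forall>l\<ge>r n. (\<integral>x. norm (f k x - f l x) powr p \<partial>M) < 1 / (2 * c) ^ n)"
  proof -
    define Q where "Q n N \<longleftrightarrow> (\<forall>k\<ge>N. \<forall>l\<ge>N. (\<integral>x. norm (f k x - f l x) powr p \<partial>M) < 1 / (2 * c) ^ n)" for n N
    have "\<exists>N>m. Q n N" for n and m :: nat
    proof -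
      obtain N where "\<forall>k\<ge>N. \<forall>l\<ge>N. (\<integral>x. norm (f k x - f l x) powr p \<partial>M) < 1 / (2 * c) ^ n"
        using cauchy[of "1 / (2 * c) ^ n"] c by auto
      then show ?thesis by (intro exI[of _ "max N (Suc m)"]) (auto simp: Q_def)
    qed
    then have "\<forall>n m. \<exists>N. m < N \<and> Q n N" by blast
    then obtain R where R': "\<forall>n m. m < R n m \<and> Q n (R n m)" by metis
    then have R: "\<And>n m. R n m > m" "\<And>n m. Q n (R n m)" by blast+
    define r where "r = rec_nat (R 0 0) (\<lambda>n rn. R (Suc n) rn)"
    have rS: "r (Suc n) = R (Suc n) (r n)" for n by (simp add: r_def)
    have "strict_mono r" by (rule strict_monoI_Suc) (simp add: rS R(1))
    moreover have "Q n (r n)" for n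
      by (cases n) (simp_all add: rS R(2), simp add: r_def R(2))
    ultimately show ?thesis unfolding Q_def by blast
  qed
  then obtain r where r: "strict_mono r"
    and rc: "\<And>n k l. k \<ge> r n \<Longrightarrow> l \<ge> r n \<Longrightarrow> (\<integral>x. norm (f k x - f l x) powr p \<partial>M) < 1 / (2 * c) ^ n"
    by blast
  define A where "A n = {x \<in> space M. 1 / c ^ n \<le> norm (f (r (Suc n)) x - f (r n) x) powr p}" for n
  have A[measurable]: "A n \<in> sets M" for n unfolding A_def by measurable
  have emA: "emeasure M (A n) \<le> ennreal ((1/2) ^ n)" for n
  proof -
    have "emeasure M (A n) \<le> (1 / (1 / c ^ n)) * (\<integral>x. norm (f (r (Suc n)) x - f (r n) x) powr p \<partial>M)"
      unfolding A_def using c by (intro integral_Markov_inequality[OF d]) auto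
    also have "\<dots> \<le> ennreal ((1/2) ^ n)"
    proof (rule ennreal_leI)
      have "(\<integral>x. norm (f (r (Suc n)) x - f (r n) x) powr p \<partial>M) \<le> 1 / (2 * c) ^ n"
        using rc[of n "r (Suc n)" "r n"] strict_mono_leD[OF r, of n "Suc n"] by auto
      then have "c ^ n * (\<integral>x. norm (f (r (Suc n)) x - f (r n) x) powr p \<partial>M) \<le> c ^ n * (1 / (2 * c) ^ n)"
        using c by (intro mult_left_mono) auto
      then show "1 / (1 / c ^ n) * (\<integral>x. norm (f (r (Suc n)) x - f (r n) x) powr p \<partial>M) \<le> (1/2) ^ n"
        using c by (simp add: power_mult_distrib power_one_over)
    qed
    finally show ?thesis .
  qed
  have "AE x in M. \<forall>\<^sub>F n in sequentially. x \<in> space M - A n"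
  proof (rule borel_cantelli_AE1)
    show "emeasure M (A n) < \<infinity>" for n using emA[of n] by (rule le_less_trans) simp
    show "summable (\<lambda>n. measure M (A n))"
    proof (rule summable_comparison_test')
      show "summable (\<lambda>n. (1/2::real) ^ n)" by (simp add: summable_geometric)
      show "norm (measure M (A n)) \<le> (1/2) ^ n" for n
        using emA[of n] by (simp add: measure_def enn2real_leI)
    qed
  qed (rule A)
  then have ae: "AE x in M. convergent (\<lambda>n. f (r n) x)"
  proof (rule AE_mp, intro AE_I2 impI)
    fix x assume "x \<in> space M" and ev: "\<forall>\<^sub>F n in sequentially. x \<in> space M - A n"
    from ev have "\<forall>\<^sub>F n in sequentially. norm (f (r (Suc n)) x - f (r n) x) \<le> (1/2) ^ n"
    proof eventually_elim
      case (elim n)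
      then have "norm (f (r (Suc n)) x - f (r n) x) powr p < ((1/2) ^ n) powr p"
        by (auto simp: A_def cn)
      then show ?case
        using powr_mono2[of p "(1/2) ^ n" "norm (f (r (Suc n)) x - f (r n) x)"] p
        by (cases "norm (f (r (Suc n)) x - f (r n) x) \<le> (1/2) ^ n") auto
    qed
    then have "summable (\<lambda>n. f (r (Suc n)) x - f (r n) x)"
      by (rule summable_comparison_test_ev) (simp add: summable_geometric)
    then have "convergent (\<lambda>n. \<Sum>i<n. f (r (Suc i)) x - f (r i) x)"
      by (simp add: summable_iff_convergent)
    then have "convergent (\<lambda>n. f (r n) x - f (r 0) x)"
      by (simp add: sum_lessThan_telescope[of "\<lambda>i. f (r i) x"])
    then have "convergent (\<lambda>n. (f (r n) x - f (r 0) x) + f (r 0) x)"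
      by (intro convergent_add convergent_const)
    then show "convergent (\<lambda>n. f (r n) x)" by simp
  qed
  define g where "g x = lim (\<lambda>n. f (r n) x)" for x
  have gm[measurable]: "g \<in> borel_measurable M"
    unfolding g_def by (rule borel_measurable_lim_metric[OF m])
  have ag: "AE x in M. (\<lambda>n. f (r n) x) \<longlonglongrightarrow> g x"
    using ae by eventually_elim (simp add: g_def convergent_LIMSEQ_iff)
  have bound: "integrable M (\<lambda>x. norm (f k x - g x) powr p) \<and> (\<integral>x. norm (f k x - g x) powr p \<partial>M) \<le> e"
    if N: "\<And>k l. k \<ge> N \<Longrightarrow> l \<ge> N \<Longrightarrow> (\<integral>x. norm (f k x - f l x) powr p \<partial>M) < e" and k: "k \<ge> N" for k N e
  proof -
    have A: "AE x in M. (\<lambda>n. norm (f k x - f (r (n + N)) x) powr p) \<longlonglongrightarrow> norm (f k x - g x) powr p"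
      using ag by eventually_elim
        (use p in \<open>auto intro!: tendsto_intros tendsto_powr' LIMSEQ_ignore_initial_segment\<close>)
    have B: "(\<integral>x. norm (f k x - f (r (n + N)) x) powr p \<partial>M) \<le> e" for n
      using N[OF k, of "r (n + N)"] strict_mono_imp_increasing[OF r, of "n + N"] by simp
    show ?thesis
      by (intro conjI Fatou_bound[OF d _ B _ _ A]) auto
  qed
  have dg: "integrable M (\<lambda>x. norm (f k x - g x) powr p)" if "k \<ge> N"
    "\<And>k l. k \<ge> N \<Longrightarrow> l \<ge> N \<Longrightarrow> (\<integral>x. norm (f k x - f l x) powr p \<partial>M) < 1" for k N
    using bound that by blast
  obtain N1 where N1: "\<And>k l. k \<ge> N1 \<Longrightarrow> l \<ge> N1 \<Longrightarrow> (\<integral>x. norm (f k x - f l x) powr p \<partial>M) < 1"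
    using cauchy[of 1] by auto
  have "integrable M (\<lambda>x. norm (1 *\<^sub>R f N1 x + (-1) *\<^sub>R (f N1 x - g x)) powr p)"
    by (rule integrable_powr_norm_lincomb[OF p]) (use f dg[OF order_refl N1] in auto)
  then have gi: "integrable M (\<lambda>x. norm (g x) powr p)" by simp
  have "(\<lambda>k. \<integral>x. norm (f k x - g x) powr p \<partial>M) \<longlonglongrightarrow> 0"
  proof (rule LIMSEQ_I)
    fix e :: real assume "0 < e"
    then obtain N where N: "\<And>k l. k \<ge> N \<Longrightarrow> l \<ge> N \<Longrightarrow> (\<integral>x. norm (f k x - f l x) powr p \<partial>M) < e / 2"
      using cauchy[of "e / 2"] by auto
    have "norm ((\<integral>x. norm (f k x - g x) powr p \<partial>M) - 0) < e" if "k \<ge> N" for k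
      using bound[OF N that] \<open>0 < e\<close> by (simp add: abs_of_nonneg)
    then show "\<exists>N. \<forall>k\<ge>N. norm ((\<integral>x. norm (f k x - g x) powr p \<partial>M) - 0) < e" by blast
  qed
  then show thesis using that gm gi r ag by blast
qed

section \<open>Lebesgue spaces\<close>

lemma LpD:
  assumes "f \<in> Lp p S"
  shows "f \<in> borel_measurable (lebesgue_on S)" "integrable (lebesgue_on S) (\<lambda>x. norm (f x) powr p)"
  using assms by (auto simp: Lp_def)

lemma Lp_lincomb:
  assumes "1 < p" "f \<in> Lp p S" "g \<in> Lp p S"
  shows "(\<lambda>x. a *\<^sub>R f x + b *\<^sub>R g x) \<in> Lp p S"
  using integrable_powr_norm_lincomb[OF assms(1) LpD(1)[OF assms(2)] LpD(1)[OF assms(3)] LpD(2)[OF assms(2)] LpD(2)[OF assms(3)]]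
    LpD(1)[OF assms(2)] LpD(1)[OF assms(3)] by (simp add: Lp_def)

lemma Lp_diff:
  assumes "1 < p" "f \<in> Lp p S" "g \<in> Lp p S"
  shows "(\<lambda>x. f x - g x) \<in> Lp p S"
  using Lp_lincomb[OF assms, of 1 "-1"] by simp

lemma borel_measurable_lebesgue_on_AE:
  fixes f g :: "'a::euclidean_space \<Rightarrow> 'b::euclidean_space"
  assumes S: "S \<in> sets lebesgue" and f: "f \<in> borel_measurable (lebesgue_on S)" and ae: "AE x in lebesgue_on S. f x = g x"
  shows "g \<in> borel_measurable (lebesgue_on S)"
proof -
  have "AE x in lebesgue. x \<in> S \<longrightarrow> f x = g x"
    using ae S by (simp add: AE_restrict_space_iff)
  then have "AE x in lebesgue. (if x \<in> S then f x else 0) = (if x \<in> S then g x else 0)"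
    by (auto elim!: eventually_mono)
  then have "(\<lambda>x. if x \<in> S then g x else 0) \<in> borel_measurable lebesgue"
    by (rule borel_measurable_AE[OF borel_measurable_if_I[OF f S]])
  then show ?thesis by (rule borel_measurable_if_D)
qed

lemma Lp_cong_AE:
  assumes S: "S \<in> sets lebesgue" and f: "f \<in> Lp p S" and ae: "AE x in lebesgue_on S. f x = g x"
  shows "g \<in> Lp p S"
proof -
  have g: "g \<in> borel_measurable (lebesgue_on S)"
    by (rule borel_measurable_lebesgue_on_AE[OF S LpD(1)[OF f] ae])
  have "integrable (lebesgue_on S) (\<lambda>x. norm (f x) powr p) \<longleftrightarrow> integrable (lebesgue_on S) (\<lambda>x. norm (g x) powr p)"
    using ae g LpD(1)[OF f] by (intro integrable_cong_AE) (auto elim!: eventually_mono)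
  then show ?thesis using LpD(2)[OF f] g by (simp add: Lp_def)
qed

lemma integrable_lebesgue_on_subset:
  fixes f :: "'a::euclidean_space \<Rightarrow> 'b::euclidean_space"
  assumes "integrable (lebesgue_on U) f" "K \<in> sets lebesgue" "U \<in> sets lebesgue" "K \<subseteq> U"
  shows "integrable (lebesgue_on K) f"
proof -
  have "integrable lebesgue (\<lambda>x. indicat_real U x *\<^sub>R f x)"
    using assms by (simp add: integrable_restrict_space)
  from integrable_mult_indicator[OF assms(2) this]
  have "integrable lebesgue (\<lambda>x. indicat_real K x *\<^sub>R indicat_real U x *\<^sub>R f x)" .
  also have "(\<lambda>x. indicat_real K x *\<^sub>R indicat_real U x *\<^sub>R f x) = (\<lambda>x. indicat_real K x *\<^sub>R f x)"
    using assms(4) by (intro ext) (auto split: split_indicator)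
  finally show ?thesis using assms(2) by (simp add: integrable_restrict_space)
qed

lemma Lp_locally_integrable:
  fixes f :: "'a::euclidean_space \<Rightarrow> 'b::euclidean_space"
  assumes p: "1 < p" and U: "open U" and f: "f \<in> Lp p U"
  shows "locally_integrable U f"
  unfolding locally_integrable_def
proof (intro allI impI)
  fix K assume K: "compact K \<and> K \<subseteq> U"
  then have KL: "K \<in> lmeasurable" "K \<in> sets lebesgue" "U \<in> sets lebesgue"
    using U by (auto simp: lmeasurable_compact fmeasurableD)
  interpret finite_measure "lebesgue_on K" by (rule finite_measure_lebesgue_on[OF KL(1)])
  have i: "integrable (lebesgue_on K) (\<lambda>x. norm (f x) powr p)"
    using integrable_lebesgue_on_subset[OF LpD(2)[OF f] KL(2,3)] K by blast
  show "integrable (lebesgue_on K) f"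
  proof (rule Bochner_Integration.integrable_bound)
    show "integrable (lebesgue_on K) (\<lambda>x. 1 + 1 powr (1 - p) * norm (f x) powr p)"
      using i by simp
    show "f \<in> borel_measurable (lebesgue_on K)"
      using measurable_restrict_mono[OF LpD(1)[OF f]] K by blast
    show "AE x in lebesgue_on K. norm (f x) \<le> norm (1 + 1 powr (1 - p) * norm (f x) powr p)"
      using norm_le_eps_powr[OF p, of 1] by (intro AE_I2) simp
  qed
qed

section \<open>Weak gradients\<close>

lemma column_lincomb: "column j (a *\<^sub>R A + b *\<^sub>R B) = a *\<^sub>R column j A + b *\<^sub>R column j (B :: real^'n^'m)"
  by (simp add: column_def vec_eq_iff)

lemma norm_column_diff_le: "norm (column j A - column j B) \<le> norm (A - B :: real^'n^'m)"
proof -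
  have "column j A - column j B = column j (A - B)"
    by (simp add: column_def vec_eq_iff)
  moreover have "norm (column j C) \<le> norm C" for C :: "real^'n^'m"
    unfolding norm_vec_def[of C] norm_vec_def[of "column j C"]
    by (intro L2_set_mono) (auto simp: column_def intro: component_le_norm_cart[of _ j, simplified])
  ultimately show ?thesis by simp
qed

lemma has_weak_grad_unique:
  fixes u :: "real^'n \<Rightarrow> real^'m"
  assumes U: "open \<Omega>" and "has_weak_grad \<Omega> u G" "has_weak_grad \<Omega> u H"
  shows "AE x in lebesgue_on \<Omega>. G x = H x"
proof -
  have "AE x in lebesgue_on \<Omega>. \<forall>j\<in>UNIV. column j (G x) = column j (H x)"
    using has_weak_deriv_unique[OF U assms(2)[unfolded has_weak_grad_def, rule_format]
        assms(3)[unfolded has_weak_grad_def, rule_format]]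
    by (intro AE_finite_allI) auto
  then show ?thesis
    by eventually_elim (simp add: column_def vec_eq_iff)
qed

lemma has_weak_grad_lincomb:
  assumes "open \<Omega>" "has_weak_grad \<Omega> u G" "has_weak_grad \<Omega> w H"
  shows "has_weak_grad \<Omega> (\<lambda>x. a *\<^sub>R u x + b *\<^sub>R w x) (\<lambda>x. a *\<^sub>R G x + b *\<^sub>R H x)"
  using assms unfolding has_weak_grad_def column_lincomb by (intro allI has_weak_deriv_lincomb) auto

lemma W1pD:
  fixes u :: "real^'n \<Rightarrow> real^'m"
  assumes U: "open \<Omega>" and u: "u \<in> W1p p \<Omega>"
  shows "u \<in> Lp p \<Omega>" "has_weak_grad \<Omega> u (weak_grad \<Omega> u)" "weak_grad \<Omega> u \<in> Lp p \<Omega>"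
proof -
  from u obtain G where G: "has_weak_grad \<Omega> u G" "G \<in> Lp p \<Omega>" by (auto simp: W1p_def)
  show "u \<in> Lp p \<Omega>" using u by (auto simp: W1p_def)
  show wg: "has_weak_grad \<Omega> u (weak_grad \<Omega> u)"
    unfolding weak_grad_def by (rule someI[of "has_weak_grad \<Omega> u", OF G(1)])
  show "weak_grad \<Omega> u \<in> Lp p \<Omega>"
    using Lp_cong_AE[OF _ G(2) has_weak_grad_unique[OF U G(1) wg]] U by simp
qed

text \<open>
  The gradient picked by the choice operator may differ from \<open>G\<close>, but only on a null set.
\<close>
lemma weak_grad_AE:
  assumes U: "open \<Omega>" and G: "has_weak_grad \<Omega> u G"
  shows "AE x in lebesgue_on \<Omega>. weak_grad \<Omega> u x = G x"
  using has_weak_grad_unique[OF U _ G] someI[of "has_weak_grad \<Omega> u", OF G]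
  by (simp add: weak_grad_def)

lemma W1p_lincomb:
  assumes U: "open \<Omega>" and p: "1 < p" and u: "u \<in> W1p p \<Omega>" and w: "w \<in> W1p p \<Omega>"
  shows "(\<lambda>x. a *\<^sub>R u x + b *\<^sub>R w x) \<in> W1p p \<Omega>"
    "AE x in lebesgue_on \<Omega>. weak_grad \<Omega> (\<lambda>x. a *\<^sub>R u x + b *\<^sub>R w x) x = a *\<^sub>R weak_grad \<Omega> u x + b *\<^sub>R weak_grad \<Omega> w x"
proof -
  note u' = W1pD[OF U u] and w' = W1pD[OF U w]
  note g = has_weak_grad_lincomb[OF U u'(2) w'(2), of a b]
  show "(\<lambda>x. a *\<^sub>R u x + b *\<^sub>R w x) \<in> W1p p \<Omega>"
    unfolding W1p_def using Lp_lincomb[OF p u'(1) w'(1)] Lp_lincomb[OF p u'(3) w'(3)] g by blast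
  show "AE x in lebesgue_on \<Omega>. weak_grad \<Omega> (\<lambda>x. a *\<^sub>R u x + b *\<^sub>R w x) x = a *\<^sub>R weak_grad \<Omega> u x + b *\<^sub>R weak_grad \<Omega> w x"
    by (rule weak_grad_AE[OF U g])
qed

definition energy :: "real \<Rightarrow> (real^'n) set \<Rightarrow> (real^'n \<Rightarrow> real^'m) \<Rightarrow> real" where
  "energy p \<Omega> u = (\<integral>x. norm (weak_grad \<Omega> u x) powr p \<partial>lebesgue_on \<Omega>)"

text \<open>
  The \<open>p\<close>-th power of the \<open>L^p\<close> norm. For the power, the elementary inequality
  \<open>powr_norm_add_le\<close> does the work of Minkowski's inequality.
\<close>
definition Lp_mass :: "real \<Rightarrow> 'a::euclidean_space set \<Rightarrow> ('a \<Rightarrow> 'b::euclidean_space) \<Rightarrow> real" where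
  "Lp_mass p S u = (\<integral>x. norm (u x) powr p \<partial>lebesgue_on S)"

lemma energy_nonneg [simp]: "0 \<le> energy p \<Omega> u" and Lp_mass_nonneg [simp]: "0 \<le> Lp_mass p S f"
  by (simp_all add: energy_def Lp_mass_def)

lemma Lp_mass_cong_AE:
  assumes "AE x in lebesgue_on S. f x = g x"
    "f \<in> borel_measurable (lebesgue_on S)" "g \<in> borel_measurable (lebesgue_on S)"
  shows "Lp_mass p S f = Lp_mass p S g"
  unfolding Lp_mass_def using assms by (intro integral_cong_AE) (auto elim!: eventually_mono)

lemma Lp_mass_lincomb_le:
  assumes p: "1 < p" and f: "f \<in> Lp p S" and g: "g \<in> Lp p S"
  shows "Lp_mass p S (\<lambda>x. a *\<^sub>R f x + b *\<^sub>R g x) \<le> 2 powr p * (\<bar>a\<bar> powr p * Lp_mass p S f + \<bar>b\<bar> powr p * Lp_mass p S g)"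
proof -
  note f' = LpD[OF f] and g' = LpD[OF g]
  have "Lp_mass p S (\<lambda>x. a *\<^sub>R f x + b *\<^sub>R g x)
      \<le> 2 powr p * ((\<integral>x. norm (a *\<^sub>R f x) powr p \<partial>lebesgue_on S) + (\<integral>x. norm (b *\<^sub>R g x) powr p \<partial>lebesgue_on S))"
    unfolding Lp_mass_def using f' g'
    by (intro integral_powr_norm_add_le[OF p]) (auto simp: powr_mult)
  then show ?thesis by (simp add: Lp_mass_def powr_mult)
qed

lemma energy_lincomb:
  assumes U: "open \<Omega>" and p: "1 < p" and u: "u \<in> W1p p \<Omega>" and w: "w \<in> W1p p \<Omega>"
  shows "energy p \<Omega> (\<lambda>x. a *\<^sub>R u x + b *\<^sub>R w x) = Lp_mass p \<Omega> (\<lambda>x. a *\<^sub>R weak_grad \<Omega> u x + b *\<^sub>R weak_grad \<Omega> w x)"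
  unfolding energy_def Lp_mass_def[symmetric]
  by (rule Lp_mass_cong_AE[OF W1p_lincomb(2)[OF U p u w] LpD(1)[OF W1pD(3)[OF U W1p_lincomb(1)[OF U p u w]]]
      LpD(1)[OF Lp_lincomb[OF p W1pD(3)[OF U u] W1pD(3)[OF U w]]]])

lemma energy_lincomb_le:
  assumes U: "open \<Omega>" and p: "1 < p" and u: "u \<in> W1p p \<Omega>" and w: "w \<in> W1p p \<Omega>"
  shows "energy p \<Omega> (\<lambda>x. a *\<^sub>R u x + b *\<^sub>R w x) \<le> 2 powr p * (\<bar>a\<bar> powr p * energy p \<Omega> u + \<bar>b\<bar> powr p * energy p \<Omega> w)"
  unfolding energy_lincomb[OF assms]
  using Lp_mass_lincomb_le[OF p W1pD(3)[OF U u] W1pD(3)[OF U w], of a b]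
  by (simp add: energy_def Lp_mass_def)

lemma W1p_norm_tendsto_0_iff:
  assumes p: "1 < p"
  shows "(\<lambda>k. W1p_norm p \<Omega> (w k)) \<longlonglongrightarrow> 0 \<longleftrightarrow>
    (\<lambda>k. Lp_mass p \<Omega> (w k)) \<longlonglongrightarrow> 0 \<and> (\<lambda>k. energy p \<Omega> (w k)) \<longlonglongrightarrow> 0"
proof -
  define s where "s k = Lp_mass p \<Omega> (w k) + energy p \<Omega> (w k)" for k
  have s0: "s k \<ge> 0" for k by (simp add: s_def)
  have n: "W1p_norm p \<Omega> (w k) = s k powr (1 / p)" for k
    by (simp add: W1p_norm_def s_def energy_def Lp_mass_def)
  have "(\<lambda>k. s k powr (1 / p)) \<longlonglongrightarrow> 0 \<longleftrightarrow> s \<longlonglongrightarrow> 0"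
  proof
    assume "(\<lambda>k. s k powr (1 / p)) \<longlonglongrightarrow> 0"
    then have "(\<lambda>k. (s k powr (1 / p)) powr p) \<longlonglongrightarrow> 0 powr p"
      using p by (intro tendsto_powr') auto
    then show "s \<longlonglongrightarrow> 0" using p s0 by (simp add: powr_powr)
  next
    assume "s \<longlonglongrightarrow> 0"
    then have "(\<lambda>k. s k powr (1 / p)) \<longlonglongrightarrow> 0 powr (1 / p)"
      using p s0 by (intro tendsto_powr') auto
    then show "(\<lambda>k. s k powr (1 / p)) \<longlonglongrightarrow> 0" by simp
  qed
  also have "s \<longlonglongrightarrow> 0 \<longleftrightarrow> (\<lambda>k. Lp_mass p \<Omega> (w k)) \<longlonglongrightarrow> 0 \<and> (\<lambda>k. energy p \<Omega> (w k)) \<longlonglongrightarrow> 0"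
  proof (intro iffI conjI)
    assume s: "s \<longlonglongrightarrow> 0"
    show "(\<lambda>k. Lp_mass p \<Omega> (w k)) \<longlonglongrightarrow> 0"
      by (rule tendsto_sandwich[OF _ _ tendsto_const s]) (auto simp: s_def)
    show "(\<lambda>k. energy p \<Omega> (w k)) \<longlonglongrightarrow> 0"
      by (rule tendsto_sandwich[OF _ _ tendsto_const s]) (auto simp: s_def)
  qed (auto simp: s_def[abs_def] intro!: tendsto_add_zero)
  finally show ?thesis unfolding n .
qed

lemma has_weak_grad_smooth:
  fixes f :: "real^'n \<Rightarrow> real^'m"
  assumes "open \<Omega>" "smooth f"
  shows "has_weak_grad \<Omega> f (\<lambda>x. \<chi> i j. frechet_derivative f (at x) (axis j 1) $ i)"
proof -
  have "column j (\<chi> i j. frechet_derivative f (at x) (axis j 1) $ i) = frechet_derivative f (at x) (axis j 1)" for x j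
    by (simp add: column_def vec_eq_iff)
  then show ?thesis
    using has_weak_deriv_smooth[OF assms] by (simp add: has_weak_grad_def)
qed

lemma Lp_bounded:
  assumes S: "S \<in> lmeasurable" and f: "f \<in> borel_measurable (lebesgue_on S)" and B: "\<And>x. norm (f x) \<le> B" and p: "1 < p"
  shows "f \<in> Lp p S"
proof -
  interpret finite_measure "lebesgue_on S" by (rule finite_measure_lebesgue_on[OF S])
  have "integrable (lebesgue_on S) (\<lambda>x. norm (f x) powr p)"
    using f p B by (intro integrable_const_bound[where B = "B powr p"]) (auto intro!: AE_I2 powr_mono2)
  then show ?thesis using f by (simp add: Lp_def)
qed

lemma test_fun_W1p:
  fixes \<phi> :: "real^'n \<Rightarrow> real^'m"
  assumes U: "open \<Omega>" and S: "\<Omega> \<in> lmeasurable" and p: "1 < p" and \<phi>: "test_fun \<Omega> \<phi>"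
  shows "\<phi> \<in> W1p p \<Omega>"
proof -
  obtain B where "\<And>x. norm (\<phi> x) \<le> B" using test_fun_bounded[OF \<phi>] by blast
  then have 1: "\<phi> \<in> Lp p \<Omega>"
    by (intro Lp_bounded[OF S test_fun_measurable[OF \<phi>] _ p])
  define G :: "real^'n \<Rightarrow> real^'n^'m" where "G = (\<lambda>x. \<chi> i j. frechet_derivative \<phi> (at x) (axis j 1) $ i)"
  have sm: "test_fun \<Omega> (\<lambda>x. frechet_derivative \<phi> (at x) e)" for e by (rule test_fun_derivative[OF \<phi>])
  have Gm: "G \<in> borel_measurable (lebesgue_on \<Omega>)"
  proof -
    have "continuous_on UNIV G"
      unfolding G_def using smooth_continuous[OF test_fun_smooth[OF sm]]
      by (intro continuous_on_vec_lambda continuous_on_component)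
    then show ?thesis
      by (intro measurable_restrict_space1 measurable_completion) (simp add: borel_measurable_continuous_onI)
  qed
  have "\<exists>B. \<forall>x. norm (frechet_derivative \<phi> (at x) (axis j 1)) \<le> B" for j :: 'n
    using test_fun_bounded[OF sm[of "axis j 1"]] by metis
  then obtain B where B: "\<And>j x. norm (frechet_derivative \<phi> (at x) (axis j 1)) \<le> B j" by metis
  have "norm (G x) \<le> (\<Sum>i\<in>(UNIV :: 'm set). \<Sum>j\<in>UNIV. B j)" for x
  proof -
    have "norm (G x) \<le> (\<Sum>i\<in>UNIV. norm (G x $ i))"
      by (simp add: norm_vec_def L2_set_le_sum)
    also have "\<dots> \<le> (\<Sum>i\<in>(UNIV :: 'm set). \<Sum>j\<in>UNIV. B j)"
    proof (rule sum_mono)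
      fix i
      have "norm (G x $ i) \<le> (\<Sum>j\<in>UNIV. norm (G x $ i $ j))"
        by (simp add: norm_vec_def L2_set_le_sum)
      also have "\<dots> \<le> (\<Sum>j\<in>UNIV. B j)"
        by (rule sum_mono) (auto simp: G_def intro: order_trans[OF component_le_norm_cart B])
      finally show "norm (G x $ i) \<le> (\<Sum>j\<in>UNIV. B j)" .
    qed
    finally show ?thesis .
  qed
  then have "G \<in> Lp p \<Omega>" by (intro Lp_bounded[OF S Gm _ p])
  then show ?thesis
    unfolding W1p_def using 1 has_weak_grad_smooth[OF U test_fun_smooth[OF \<phi>]] G_def by blast
qed

lemma test_fun_lincomb:
  assumes \<phi>: "test_fun U \<phi>" and \<psi>: "test_fun U \<psi>"
  shows "test_fun U (\<lambda>x. a *\<^sub>R \<phi> x + b *\<^sub>R \<psi> x)"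
proof -
  obtain K where K: "compact K" "K \<subseteq> U" "\<And>x. x \<notin> K \<Longrightarrow> \<phi> x = 0" by (rule test_fun_support[OF \<phi>]) blast
  obtain L where L: "compact L" "L \<subseteq> U" "\<And>x. x \<notin> L \<Longrightarrow> \<psi> x = 0" by (rule test_fun_support[OF \<psi>]) blast
  show ?thesis
  proof (rule test_funI)
    show "smooth (\<lambda>x. a *\<^sub>R \<phi> x + b *\<^sub>R \<psi> x)"
      using test_fun_smooth[OF \<phi>] test_fun_smooth[OF \<psi>]
      unfolding smooth_def by (intro allI C_diff_add C_diff_scaleR C_diff_const) auto
    show "compact (K \<union> L)" "K \<union> L \<subseteq> U" using K L by auto
    show "a *\<^sub>R \<phi> x + b *\<^sub>R \<psi> x = 0" if "x \<notin> K \<union> L" for x using K L that by simp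
  qed
qed

lemma W01pD:
  assumes "u \<in> W01p p \<Omega>"
  shows "u \<in> W1p p \<Omega>"
  using assms by (simp add: W01p_def)

lemma W01p_iff:
  fixes u :: "real^'n \<Rightarrow> real^'m"
  assumes p: "1 < p"
  shows "u \<in> W01p p \<Omega> \<longleftrightarrow> u \<in> W1p p \<Omega> \<and> (\<exists>\<phi>. (\<forall>k::nat. test_fun \<Omega> (\<phi> k)) \<and>
    (\<lambda>k. Lp_mass p \<Omega> (\<lambda>x. \<phi> k x - u x)) \<longlonglongrightarrow> 0 \<and> (\<lambda>k. energy p \<Omega> (\<lambda>x. \<phi> k x - u x)) \<longlonglongrightarrow> 0)"
  unfolding W01p_def by (auto simp: W1p_norm_tendsto_0_iff[OF p])

lemma W01p_lincomb:
  fixes u w :: "real^'n \<Rightarrow> real^'m"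
  assumes U: "open \<Omega>" and S: "\<Omega> \<in> lmeasurable" and p: "1 < p" and u: "u \<in> W01p p \<Omega>" and w: "w \<in> W01p p \<Omega>"
  shows "(\<lambda>x. a *\<^sub>R u x + b *\<^sub>R w x) \<in> W01p p \<Omega>"
proof -
  note u1 = W01pD[OF u] and w1 = W01pD[OF w]
  from u obtain \<phi> where \<phi>: "\<And>k::nat. test_fun \<Omega> (\<phi> k)" "(\<lambda>k. Lp_mass p \<Omega> (\<lambda>x. \<phi> k x - u x)) \<longlonglongrightarrow> 0"
    "(\<lambda>k. energy p \<Omega> (\<lambda>x. \<phi> k x - u x)) \<longlonglongrightarrow> 0"
    unfolding W01p_iff[OF p] by auto
  from w obtain \<psi> where \<psi>: "\<And>k::nat. test_fun \<Omega> (\<psi> k)" "(\<lambda>k. Lp_mass p \<Omega> (\<lambda>x. \<psi> k x - w x)) \<longlonglongrightarrow> 0"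
    "(\<lambda>k. energy p \<Omega> (\<lambda>x. \<psi> k x - w x)) \<longlonglongrightarrow> 0"
    unfolding W01p_iff[OF p] by auto
  have d: "(\<lambda>x. \<phi> k x - u x) \<in> W1p p \<Omega>" "(\<lambda>x. \<psi> k x - w x) \<in> W1p p \<Omega>" for k
    using W1p_lincomb(1)[OF U p test_fun_W1p[OF U S p \<phi>(1)] u1, where a = 1 and b = "-1"]
      W1p_lincomb(1)[OF U p test_fun_W1p[OF U S p \<psi>(1)] w1, where a = 1 and b = "-1"] by simp_all
  define z where "z k x = a *\<^sub>R (\<phi> k x - u x) + b *\<^sub>R (\<psi> k x - w x)" for k x
  have zeq: "z k = (\<lambda>x. a *\<^sub>R \<phi> k x + b *\<^sub>R \<psi> k x - (a *\<^sub>R u x + b *\<^sub>R w x))" for k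
    by (simp add: z_def fun_eq_iff algebra_simps)
  have lim: "(\<lambda>k. 2 powr p * (\<bar>a\<bar> powr p * A k + \<bar>b\<bar> powr p * B k)) \<longlonglongrightarrow> 0"
    if "A \<longlonglongrightarrow> 0" "B \<longlonglongrightarrow> 0" for A B :: "nat \<Rightarrow> real"
    using tendsto_mult[OF tendsto_const[of "2 powr p"] tendsto_add[OF tendsto_mult[OF tendsto_const[of "\<bar>a\<bar> powr p"] that(1)]
        tendsto_mult[OF tendsto_const[of "\<bar>b\<bar> powr p"] that(2)]]] by simp
  have "(\<lambda>k. Lp_mass p \<Omega> (z k)) \<longlonglongrightarrow> 0"
    by (rule tendsto_sandwich[OF _ _ tendsto_const lim[OF \<phi>(2) \<psi>(2)]])
      (auto simp: z_def[abs_def] intro!: always_eventually Lp_mass_lincomb_le[OF p] W1pD(1)[OF U] d)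
  moreover have "(\<lambda>k. energy p \<Omega> (z k)) \<longlonglongrightarrow> 0"
    by (rule tendsto_sandwich[OF _ _ tendsto_const lim[OF \<phi>(3) \<psi>(3)]])
      (auto simp: z_def[abs_def] intro!: always_eventually energy_lincomb_le[OF U p] d)
  ultimately show ?thesis
    unfolding W01p_iff[OF p] zeq
    using W1p_lincomb(1)[OF U p u1 w1] test_fun_lincomb[OF \<phi>(1) \<psi>(1)]
    by (intro conjI exI[of _ "\<lambda>k x. a *\<^sub>R \<phi> k x + b *\<^sub>R \<psi> k x"]) auto
qed

text \<open>
  A diagonal choice of test functions approximating the members of the sequence.
\<close>
lemma W01p_closed:
  fixes u :: "real^'n \<Rightarrow> real^'m"
  assumes U: "open \<Omega>" and S: "\<Omega> \<in> lmeasurable" and p: "1 < p"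
    and w: "\<And>k::nat. w k \<in> W01p p \<Omega>" and u: "u \<in> W1p p \<Omega>"
    and lim: "(\<lambda>k. Lp_mass p \<Omega> (\<lambda>x. w k x - u x)) \<longlonglongrightarrow> 0" "(\<lambda>k. energy p \<Omega> (\<lambda>x. w k x - u x)) \<longlonglongrightarrow> 0"
  shows "u \<in> W01p p \<Omega>"
proof -
  have "\<exists>\<phi>. test_fun \<Omega> \<phi> \<and> Lp_mass p \<Omega> (\<lambda>x. \<phi> x - w k x) < inverse (real (Suc k)) \<and> energy p \<Omega> (\<lambda>x. \<phi> x - w k x) < inverse (real (Suc k))" for k
  proof -
    from w[of k] obtain \<phi> where \<phi>: "\<And>l::nat. test_fun \<Omega> (\<phi> l)" "(\<lambda>l. Lp_mass p \<Omega> (\<lambda>x. \<phi> l x - w k x)) \<longlonglongrightarrow> 0"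
      "(\<lambda>l. energy p \<Omega> (\<lambda>x. \<phi> l x - w k x)) \<longlonglongrightarrow> 0"
      unfolding W01p_iff[OF p] by auto
    have "\<forall>\<^sub>F l in sequentially. Lp_mass p \<Omega> (\<lambda>x. \<phi> l x - w k x) < inverse (real (Suc k)) \<and> energy p \<Omega> (\<lambda>x. \<phi> l x - w k x) < inverse (real (Suc k))"
      by (intro eventually_conj order_tendstoD(2)[OF \<phi>(2)] order_tendstoD(2)[OF \<phi>(3)]) auto
    then obtain l where "Lp_mass p \<Omega> (\<lambda>x. \<phi> l x - w k x) < inverse (real (Suc k)) \<and> energy p \<Omega> (\<lambda>x. \<phi> l x - w k x) < inverse (real (Suc k))"
      using eventually_happens' sequentially_bot by blast
    then show ?thesis using \<phi>(1) by blast
  qed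
  then have "\<exists>\<phi>. \<forall>k. test_fun \<Omega> (\<phi> k) \<and> Lp_mass p \<Omega> (\<lambda>x. \<phi> k x - w k x) < inverse (real (Suc k))
      \<and> energy p \<Omega> (\<lambda>x. \<phi> k x - w k x) < inverse (real (Suc k))"
    by (intro choice allI)
  then obtain \<phi> where \<phi>: "\<And>k. test_fun \<Omega> (\<phi> k)" "\<And>k. Lp_mass p \<Omega> (\<lambda>x. \<phi> k x - w k x) < inverse (real (Suc k))"
    "\<And>k. energy p \<Omega> (\<lambda>x. \<phi> k x - w k x) < inverse (real (Suc k))" by blast
  have sm: "(\<lambda>k. Lp_mass p \<Omega> (\<lambda>x. \<phi> k x - w k x)) \<longlonglongrightarrow> 0" "(\<lambda>k. energy p \<Omega> (\<lambda>x. \<phi> k x - w k x)) \<longlonglongrightarrow> 0"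
    by (rule tendsto_sandwich[OF _ _ tendsto_const LIMSEQ_inverse_real_of_nat];
        use \<phi>(2,3) in \<open>auto intro!: always_eventually less_imp_le\<close>)+
  have d: "(\<lambda>x. \<phi> k x - w k x) \<in> W1p p \<Omega>" "(\<lambda>x. w k x - u x) \<in> W1p p \<Omega>" for k
    using W1p_lincomb(1)[OF U p test_fun_W1p[OF U S p \<phi>(1)] W01pD[OF w], where a = 1 and b = "-1"]
      W1p_lincomb(1)[OF U p W01pD[OF w] u, where a = 1 and b = "-1"] by simp_all
  define z where "z k x = 1 *\<^sub>R (\<phi> k x - w k x) + 1 *\<^sub>R (w k x - u x)" for k x
  have zeq: "z k = (\<lambda>x. \<phi> k x - u x)" for k
    by (simp add: z_def fun_eq_iff)
  have l0: "(\<lambda>k. 2 powr p * (\<bar>1\<bar> powr p * A k + \<bar>1\<bar> powr p * B k)) \<longlonglongrightarrow> 0"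
    if "A \<longlonglongrightarrow> 0" "B \<longlonglongrightarrow> 0" for A B :: "nat \<Rightarrow> real"
    using tendsto_mult[OF tendsto_const[of "2 powr p"] tendsto_add[OF that]] by simp
  have le: "Lp_mass p \<Omega> (z k) \<le> 2 powr p * (\<bar>1\<bar> powr p * Lp_mass p \<Omega> (\<lambda>x. \<phi> k x - w k x) + \<bar>1\<bar> powr p * Lp_mass p \<Omega> (\<lambda>x. w k x - u x))"
    "energy p \<Omega> (z k) \<le> 2 powr p * (\<bar>1\<bar> powr p * energy p \<Omega> (\<lambda>x. \<phi> k x - w k x) + \<bar>1\<bar> powr p * energy p \<Omega> (\<lambda>x. w k x - u x))" for k
    unfolding z_def[abs_def]
    by (rule Lp_mass_lincomb_le[OF p W1pD(1)[OF U d(1)] W1pD(1)[OF U d(2)]] energy_lincomb_le[OF U p d(1) d(2)])+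
  have "(\<lambda>k. Lp_mass p \<Omega> (z k)) \<longlonglongrightarrow> 0"
    by (rule tendsto_sandwich[OF always_eventually always_eventually tendsto_const l0[OF sm(1) lim(1)]]) (use le(1) in auto)
  moreover have "(\<lambda>k. energy p \<Omega> (z k)) \<longlonglongrightarrow> 0"
    by (rule tendsto_sandwich[OF always_eventually always_eventually tendsto_const l0[OF sm(2) lim(2)]]) (use le(2) in auto)
  ultimately show ?thesis
    unfolding W01p_iff[OF p] zeq using u \<phi>(1) by blast
qed

section \<open>Weak closedness of the Sobolev space\<close>

lemma Lp_mass_convex:
  assumes p: "1 < p" and f: "f \<in> Lp p S" and g: "g \<in> Lp p S"
  shows "Lp_mass p S (\<lambda>x. (1/2) *\<^sub>R f x + (1/2) *\<^sub>R g x) \<le> (Lp_mass p S f + Lp_mass p S g) / 2"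
proof -
  have "Lp_mass p S (\<lambda>x. (1/2) *\<^sub>R f x + (1/2) *\<^sub>R g x)
      \<le> (\<integral>x. (norm (f x) powr p + norm (g x) powr p) / 2 \<partial>lebesgue_on S)"
    unfolding Lp_mass_def using LpD(2)[OF Lp_lincomb[OF p f g]] LpD(2)[OF f] LpD(2)[OF g]
    by (intro integral_mono powr_norm_midpoint[OF p]) auto
  then show ?thesis using LpD(2)[OF f] LpD(2)[OF g] by (simp add: Lp_mass_def)
qed

lemma Lp_mass_uniformly_convex:
  assumes p: "1 < p" and \<epsilon>: "0 < (\<epsilon>::real)"
  obtains C where "C > 0" "\<And>S (f :: 'c::euclidean_space \<Rightarrow> 'a::euclidean_space) g. f \<in> Lp p S \<Longrightarrow> g \<in> Lp p S \<Longrightarrow>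
    Lp_mass p S (\<lambda>x. f x - g x) \<le> \<epsilon> * (Lp_mass p S f + Lp_mass p S g)
      + C * ((Lp_mass p S f + Lp_mass p S g) / 2 - Lp_mass p S (\<lambda>x. (1/2) *\<^sub>R f x + (1/2) *\<^sub>R g x))"
proof -
  obtain C where C: "C > 0" "\<And>a b :: 'a. norm (a - b) powr p \<le> \<epsilon> * (norm a powr p + norm b powr p)
      + C * ((norm a powr p + norm b powr p) / 2 - norm ((1/2) *\<^sub>R a + (1/2) *\<^sub>R b) powr p)"
    by (rule powr_norm_uniformly_convex[OF p \<epsilon>]) blast
  show thesis
  proof
    fix S and f g :: "'c \<Rightarrow> 'a"
    assume f: "f \<in> Lp p S" and g: "g \<in> Lp p S"
    note i = LpD(2)[OF f] LpD(2)[OF g] LpD(2)[OF Lp_lincomb[OF p f g, of "1/2" "1/2"]] LpD(2)[OF Lp_diff[OF p f g]]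
    have "Lp_mass p S (\<lambda>x. f x - g x) \<le> (\<integral>x. \<epsilon> * (norm (f x) powr p + norm (g x) powr p)
        + C * ((norm (f x) powr p + norm (g x) powr p) / 2 - norm ((1/2) *\<^sub>R f x + (1/2) *\<^sub>R g x) powr p) \<partial>lebesgue_on S)"
      unfolding Lp_mass_def using i by (intro integral_mono C(2)) auto
    also have "\<dots> = \<epsilon> * (Lp_mass p S f + Lp_mass p S g)
      + C * ((Lp_mass p S f + Lp_mass p S g) / 2 - Lp_mass p S (\<lambda>x. (1/2) *\<^sub>R f x + (1/2) *\<^sub>R g x))"
      using i by (simp add: Lp_mass_def)
    finally show "Lp_mass p S (\<lambda>x. f x - g x) \<le> \<epsilon> * (Lp_mass p S f + Lp_mass p S g)
      + C * ((Lp_mass p S f + Lp_mass p S g) / 2 - Lp_mass p S (\<lambda>x. (1/2) *\<^sub>R f x + (1/2) *\<^sub>R g x))" .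
  qed (fact C(1))
qed

lemma energy_eq_Lp_mass: "energy p \<Omega> u = Lp_mass p \<Omega> (weak_grad \<Omega> u)"
  by (simp add: energy_def Lp_mass_def)

text \<open>
  Let \<open>A n\<close> be the set of all \<open>w\<close> in \<open>W_0^{1,p}\<close> whose \<open>L^p\<close> distance to \<open>u\<close>, raised to the power \<open>p\<close>, is at most
  \<open>1/(n+1)\<close>. These convex sets decrease, each contains some \<open>u' k\<close>, and so the infima \<open>d n\<close> of the
  energy over them increase to a limit \<open>L \<le> C\<close>. Near-minimisers \<open>w n\<close> have midpoints in the same sets,
  whose energy is at least \<open>d n\<close>; thus the convexity gap of their gradients tends to zero, and by
  uniform convexity the gradients form a Cauchy sequence in \<open>L^p\<close>. Their limit is the weak gradient
  of \<open>u\<close>, and \<open>w n\<close> converges to \<open>u\<close> strongly.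
\<close>
lemma W01p_weakly_closed:
  fixes u :: "real^'n \<Rightarrow> real^'m"
  assumes U: "open \<Omega>" and S: "\<Omega> \<in> lmeasurable" and p: "1 < p"
    and uk: "\<And>k::nat. u' k \<in> W01p p \<Omega>" and C: "\<And>k. energy p \<Omega> (u' k) \<le> C"
    and u: "u \<in> Lp p \<Omega>" and lim: "(\<lambda>k. Lp_mass p \<Omega> (\<lambda>x. u' k x - u x)) \<longlonglongrightarrow> 0"
  shows "u \<in> W01p p \<Omega>" "energy p \<Omega> u \<le> C"
proof -
  have fin: "finite_measure (lebesgue_on \<Omega>)" by (rule finite_measure_lebesgue_on[OF S])
  define A where "A n = {w \<in> W01p p \<Omega>. Lp_mass p \<Omega> (\<lambda>x. w x - u x) \<le> inverse (real (Suc n))}" for n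
  define d where "d n = Inf (energy p \<Omega> ` A n)" for n
  have C0: "C \<ge> 0" using order_trans[OF energy_nonneg C[of 0]] .
  have bdd: "bdd_below (energy p \<Omega> ` A n)" for n
    by (rule bdd_belowI[of _ 0]) auto
  have ex: "\<exists>w\<in>A n. energy p \<Omega> w \<le> C" for n
  proof -
    have "\<forall>\<^sub>F k in sequentially. Lp_mass p \<Omega> (\<lambda>x. u' k x - u x) < inverse (real (Suc n))"
      by (rule order_tendstoD(2)[OF lim]) simp
    then obtain k where "Lp_mass p \<Omega> (\<lambda>x. u' k x - u x) < inverse (real (Suc n))"
      using eventually_happens' sequentially_bot by blast
    then show ?thesis using uk[of k] C[of k] by (intro bexI[of _ "u' k"]) (auto simp: A_def)
  qed
  have ne: "energy p \<Omega> ` A n \<noteq> {}" for n using ex[of n] by auto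
  have dC: "d n \<le> C" for n
    using ex[of n] cINF_lower2[OF bdd] unfolding d_def by blast
  have Amono: "A l \<subseteq> A k" if "k \<le> l" for k l
  proof -
    have "inverse (real (Suc l)) \<le> inverse (real (Suc k))" using that by simp
    then show ?thesis unfolding A_def using order_trans by blast
  qed
  have dmono: "d k \<le> d l" if "k \<le> l" for k l
    unfolding d_def using Amono[OF that] ne[of l] bdd by (intro cInf_superset_mono image_mono) auto
  define L where "L = (SUP n. d n)"
  have bddd: "bdd_above (range d)" using dC by (intro bdd_aboveI[of _ C]) auto
  have dL: "d n \<le> L" for n unfolding L_def by (rule cSUP_upper[OF UNIV_I bddd])
  have LC: "L \<le> C" unfolding L_def by (rule cSUP_least) (use dC in auto)
  have dlim: "d \<longlonglongrightarrow> L"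
    unfolding L_def by (rule LIMSEQ_incseq_SUP[OF bddd]) (simp add: incseq_def dmono)
  have "\<exists>w\<in>A n. energy p \<Omega> w < d n + inverse (real (Suc n))" for n
    using cInf_lessD[OF ne, of n "d n + inverse (real (Suc n))"] by (auto simp: d_def)
  then have "\<exists>w. \<forall>n. w n \<in> A n \<and> energy p \<Omega> (w n) < d n + inverse (real (Suc n))"
    by (intro choice allI) blast
  then obtain w where wA: "\<And>n. w n \<in> A n" and wE: "\<And>n. energy p \<Omega> (w n) < d n + inverse (real (Suc n))"
    by blast
  have w0: "w n \<in> W01p p \<Omega>" and wu: "Lp_mass p \<Omega> (\<lambda>x. w n x - u x) \<le> inverse (real (Suc n))" for n
    using wA[of n] by (auto simp: A_def)
  note w1 = W01pD[OF w0]
  note wg = W1pD(3)[OF U w1] and wL = W1pD(1)[OF U w1]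
  have wEL: "energy p \<Omega> (w k) \<le> L + inverse (real (Suc N))" if "N \<le> k" for k N
  proof -
    have "inverse (real (Suc k)) \<le> inverse (real (Suc N))" using that by simp
    then show ?thesis using wE[of k] dL[of k] by linarith
  qed
  have mid: "d N \<le> Lp_mass p \<Omega> (\<lambda>x. (1/2) *\<^sub>R weak_grad \<Omega> (w k) x + (1/2) *\<^sub>R weak_grad \<Omega> (w l) x)"
    if "N \<le> k" "N \<le> l" for N k l
  proof -
    define z where "z = (\<lambda>x. (1/2) *\<^sub>R w k x + (1/2) *\<^sub>R w l x)"
    have zu: "(\<lambda>x. z x - u x) = (\<lambda>x. (1/2) *\<^sub>R (w k x - u x) + (1/2) *\<^sub>R (w l x - u x))"
      by (simp add: z_def fun_eq_iff algebra_simps flip: scaleR_add_left)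
    have "w k \<in> A N" "w l \<in> A N" using wA Amono that by blast+
    then have "(Lp_mass p \<Omega> (\<lambda>x. w k x - u x) + Lp_mass p \<Omega> (\<lambda>x. w l x - u x)) / 2 \<le> inverse (real (Suc N))"
      unfolding A_def by simp
    moreover have "Lp_mass p \<Omega> (\<lambda>x. z x - u x) \<le> (Lp_mass p \<Omega> (\<lambda>x. w k x - u x) + Lp_mass p \<Omega> (\<lambda>x. w l x - u x)) / 2"
      unfolding zu by (rule Lp_mass_convex[OF p Lp_diff[OF p wL u] Lp_diff[OF p wL u]])
    ultimately have "z \<in> A N"
      unfolding A_def z_def using W01p_lincomb[OF U S p w0 w0] by auto
    then have "d N \<le> energy p \<Omega> z"
      unfolding d_def by (intro cINF_lower bdd)
    then show ?thesis
      unfolding z_def energy_lincomb[OF U p w1 w1] .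
  qed
  have gap: "(\<lambda>N. L + inverse (real (Suc N)) - d N) \<longlonglongrightarrow> 0"
    using tendsto_diff[OF tendsto_add[OF tendsto_const[of L] LIMSEQ_inverse_real_of_nat] dlim] by simp
  have cauchy: "\<exists>N. \<forall>k\<ge>N. \<forall>l\<ge>N. (\<integral>x. norm (weak_grad \<Omega> (w k) x - weak_grad \<Omega> (w l) x) powr p \<partial>lebesgue_on \<Omega>) < e"
    if e: "e > 0" for e
  proof -
    define \<epsilon> where "\<epsilon> = e / (4 * (C + 1))"
    have \<epsilon>: "\<epsilon> > 0" "\<epsilon> * (2 * (C + 1)) = e / 2" using e C0 by (auto simp: \<epsilon>_def field_simps)
    obtain K where K: "K > 0" "\<And>S (f :: real^'n \<Rightarrow> real^'n^'m) g. f \<in> Lp p S \<Longrightarrow> g \<in> Lp p S \<Longrightarrow>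
      Lp_mass p S (\<lambda>x. f x - g x) \<le> \<epsilon> * (Lp_mass p S f + Lp_mass p S g)
      + K * ((Lp_mass p S f + Lp_mass p S g) / 2 - Lp_mass p S (\<lambda>x. (1/2) *\<^sub>R f x + (1/2) *\<^sub>R g x))"
      by (rule Lp_mass_uniformly_convex[OF p \<epsilon>(1)]) blast
    have "\<forall>\<^sub>F N in sequentially. L + inverse (real (Suc N)) - d N < e / (2 * K)"
      using e K(1) by (intro order_tendstoD(2)[OF gap]) auto
    then obtain N where N: "L + inverse (real (Suc N)) - d N < e / (2 * K)"
      using eventually_happens' sequentially_bot by blast
    have "Lp_mass p \<Omega> (\<lambda>x. weak_grad \<Omega> (w k) x - weak_grad \<Omega> (w l) x) < e" if kl: "N \<le> k" "N \<le> l" for k l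
    proof -
      have E: "Lp_mass p \<Omega> (weak_grad \<Omega> (w k)) \<le> L + inverse (real (Suc N))" "Lp_mass p \<Omega> (weak_grad \<Omega> (w l)) \<le> L + inverse (real (Suc N))"
        using wEL kl unfolding energy_eq_Lp_mass by blast+
      have ar1: "a + b \<le> 2 * (C + 1)"
        if "a \<le> L + i" "b \<le> L + i" "i \<le> 1" for a b i :: real
        using that LC by simp
      have ar2: "(a + b) / 2 - c \<le> L + i - d N"
        if "a \<le> L + i" "b \<le> L + i" "d N \<le> c" for a b c i :: real
      proof (rule diff_mono[OF _ that(3)])
        show "(a + b) / 2 \<le> L + i" using add_mono[OF that(1,2)] by simp
      qed
      have "inverse (real (Suc N)) \<le> 1" by (simp add: field_simps)
      note ar = ar1[OF E this] ar2[OF E mid[OF kl]]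
      have E2: "Lp_mass p \<Omega> (weak_grad \<Omega> (w k)) + Lp_mass p \<Omega> (weak_grad \<Omega> (w l)) \<le> 2 * (C + 1)"
        by (rule ar(1))
      have avg: "(Lp_mass p \<Omega> (weak_grad \<Omega> (w k)) + Lp_mass p \<Omega> (weak_grad \<Omega> (w l))) / 2
           - Lp_mass p \<Omega> (\<lambda>x. (1/2) *\<^sub>R weak_grad \<Omega> (w k) x + (1/2) *\<^sub>R weak_grad \<Omega> (w l) x)
          \<le> L + inverse (real (Suc N)) - d N"
        by (rule ar(2))
      have "Lp_mass p \<Omega> (\<lambda>x. weak_grad \<Omega> (w k) x - weak_grad \<Omega> (w l) x)
        \<le> \<epsilon> * (Lp_mass p \<Omega> (weak_grad \<Omega> (w k)) + Lp_mass p \<Omega> (weak_grad \<Omega> (w l)))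
        + K * ((Lp_mass p \<Omega> (weak_grad \<Omega> (w k)) + Lp_mass p \<Omega> (weak_grad \<Omega> (w l))) / 2
           - Lp_mass p \<Omega> (\<lambda>x. (1/2) *\<^sub>R weak_grad \<Omega> (w k) x + (1/2) *\<^sub>R weak_grad \<Omega> (w l) x))"
        by (rule K(2)[OF wg wg])
      also have "\<dots> \<le> \<epsilon> * (2 * (C + 1)) + K * (L + inverse (real (Suc N)) - d N)"
        using \<epsilon>(1) K(1) by (intro add_mono mult_left_mono E2 avg) auto
      also have "\<dots> < e / 2 + K * (e / (2 * K))"
        using N K(1) \<epsilon>(2) by (intro add_le_less_mono mult_strict_left_mono) auto
      finally show ?thesis using K(1) by simp
    qed
    then show ?thesis unfolding Lp_mass_def by blast
  qed
  obtain G r where G: "G \<in> borel_measurable (lebesgue_on \<Omega>)" "integrable (lebesgue_on \<Omega>) (\<lambda>x. norm (G x) powr p)"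
    and Glim: "(\<lambda>k. \<integral>x. norm (weak_grad \<Omega> (w k) x - G x) powr p \<partial>lebesgue_on \<Omega>) \<longlonglongrightarrow> 0"
    and r: "strict_mono r" and Gae: "AE x in lebesgue_on \<Omega>. (\<lambda>k. weak_grad \<Omega> (w (r k)) x) \<longlonglongrightarrow> G x"
    by (rule Lp_complete[OF p LpD(1)[OF wg] LpD(2)[OF wg] cauchy]) (assumption | blast)+
  have GL: "G \<in> Lp p \<Omega>" using G by (simp add: Lp_def)
  have EG: "Lp_mass p \<Omega> G \<le> C"
  proof (rule LIMSEQ_le_const)
    show "(\<lambda>N. C + inverse (real (Suc N))) \<longlonglongrightarrow> C"
      using tendsto_add[OF tendsto_const[of C] LIMSEQ_inverse_real_of_nat] by simp
    have "Lp_mass p \<Omega> G \<le> C + inverse (real (Suc N))" for N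
      unfolding Lp_mass_def
    proof (rule Fatou_bound(2)[where u = "\<lambda>n x. norm (weak_grad \<Omega> (w (r (n + N))) x) powr p"])
      show "(\<integral>x. norm (weak_grad \<Omega> (w (r (n + N))) x) powr p \<partial>lebesgue_on \<Omega>) \<le> C + inverse (real (Suc N))" for n
        using wEL[of N "r (n + N)"] strict_mono_imp_increasing[OF r, of "n + N"] LC
        unfolding energy_def by fastforce
      show "AE x in lebesgue_on \<Omega>. (\<lambda>n. norm (weak_grad \<Omega> (w (r (n + N))) x) powr p) \<longlonglongrightarrow> norm (G x) powr p"
        using Gae
      proof eventually_elim
        case (elim x)
        show ?case
          using p by (intro tendsto_powr' tendsto_norm tendsto_const LIMSEQ_ignore_initial_segment[OF elim]) auto
      qed
    qed (use LpD(2)[OF wg] G in auto)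
    then show "\<exists>N. \<forall>n\<ge>N. Lp_mass p \<Omega> G \<le> C + inverse (real (Suc n))" by blast
  qed
  have wulim: "(\<lambda>n. Lp_mass p \<Omega> (\<lambda>x. w n x - u x)) \<longlonglongrightarrow> 0"
    by (rule tendsto_sandwich[OF always_eventually always_eventually tendsto_const LIMSEQ_inverse_real_of_nat])
      (use wu in auto)
  have hg: "has_weak_grad \<Omega> u G"
    unfolding has_weak_grad_def
  proof
    fix j :: 'n
    have colm: "(\<lambda>x. column j (H x)) \<in> borel_measurable M" if "H \<in> borel_measurable M" for H :: "real^'n \<Rightarrow> real^'n^'m" and M
    proof -
      have "continuous_on UNIV (column j :: real^'n^'m \<Rightarrow> real^'m)"
        unfolding column_def by (intro continuous_on_vec_lambda continuous_on_component continuous_on_id)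
      then show ?thesis using measurable_compose[OF that] borel_measurable_continuous_onI by blast
    qed
    have colL: "(\<lambda>x. column j (H x)) \<in> Lp p \<Omega>" if H: "H \<in> Lp p \<Omega>" for H :: "real^'n \<Rightarrow> real^'n^'m"
    proof -
      have "norm (column j (H x)) \<le> norm (H x)" for x
      proof -
        have "column j (0 :: real^'n^'m) = 0" by (simp add: column_def vec_eq_iff)
        then show ?thesis using norm_column_diff_le[of j "H x" 0] by simp
      qed
      then have "integrable (lebesgue_on \<Omega>) (\<lambda>x. norm (column j (H x)) powr p)"
        using p colm[OF LpD(1)[OF H]]
        by (intro Bochner_Integration.integrable_bound[OF LpD(2)[OF H]]) (auto intro!: AE_I2 powr_mono2)
      then show ?thesis using colm[OF LpD(1)[OF H]] by (simp add: Lp_def)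
    qed
    have gm: "(\<lambda>x. weak_grad \<Omega> (w k) x - G x) \<in> borel_measurable (lebesgue_on \<Omega>)"
      "integrable (lebesgue_on \<Omega>) (\<lambda>x. norm (weak_grad \<Omega> (w k) x - G x) powr p)" for k
      using LpD[OF Lp_diff[OF p wg[of k] GL]] by auto
    have wm: "(\<lambda>x. w k x - u x) \<in> borel_measurable (lebesgue_on \<Omega>)"
      "integrable (lebesgue_on \<Omega>) (\<lambda>x. norm (w k x - u x) powr p)" for k
      using LpD[OF Lp_diff[OF p wL[of k] u]] by auto
    note g1 = L1_tendsto_of_Lp_tendsto[OF p fin gm Glim]
    note u1 = L1_tendsto_of_Lp_tendsto[OF p fin wm wulim[unfolded Lp_mass_def]]
    have ci: "integrable (lebesgue_on \<Omega>) (\<lambda>x. norm (column j (weak_grad \<Omega> (w k) x) - column j (G x)))" for k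
      using colm[OF LpD(1)[OF wg]] colm[OF G(1)]
      by (intro Bochner_Integration.integrable_bound[OF g1(1)[of k]]) (auto intro!: AE_I2 norm_column_diff_le)
    have cle: "(\<integral>x. norm (column j (weak_grad \<Omega> (w k) x) - column j (G x)) \<partial>lebesgue_on \<Omega>)
        \<le> (\<integral>x. norm (weak_grad \<Omega> (w k) x - G x) \<partial>lebesgue_on \<Omega>)" for k
      using ci g1(1)[of k] by (intro integral_mono norm_column_diff_le) auto
    show "has_weak_deriv \<Omega> (axis j 1) u (\<lambda>x. column j (G x))"
    proof (rule has_weak_deriv_limit[OF U])
      show "has_weak_deriv \<Omega> (axis j 1) (w k) (\<lambda>x. column j (weak_grad \<Omega> (w k) x))" for k
        using W1pD(2)[OF U w1[of k]] by (simp add: has_weak_grad_def)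
      show "(\<lambda>k. \<integral>x. norm (column j (weak_grad \<Omega> (w k) x) - column j (G x)) \<partial>lebesgue_on \<Omega>) \<longlonglongrightarrow> 0"
        by (rule tendsto_sandwich[OF always_eventually always_eventually tendsto_const g1(2)]) (use cle in auto)
    qed (use Lp_locally_integrable[OF p U u] Lp_locally_integrable[OF p U colL[OF GL]] u1 ci in auto)
  qed
  have u1: "u \<in> W1p p \<Omega>" using u GL hg by (auto simp: W1p_def)
  have gae: "AE x in lebesgue_on \<Omega>. weak_grad \<Omega> u x = G x" by (rule weak_grad_AE[OF U hg])
  have "energy p \<Omega> u = Lp_mass p \<Omega> G"
    unfolding energy_eq_Lp_mass by (rule Lp_mass_cong_AE[OF gae LpD(1)[OF W1pD(3)[OF U u1]] G(1)])
  then show "energy p \<Omega> u \<le> C" using EG by simp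
  show "u \<in> W01p p \<Omega>"
  proof (rule W01p_closed[OF U S p w0 u1 wulim])
    have "energy p \<Omega> (\<lambda>x. w k x - u x) = Lp_mass p \<Omega> (\<lambda>x. weak_grad \<Omega> (w k) x - G x)" for k
    proof -
      have "energy p \<Omega> (\<lambda>x. 1 *\<^sub>R w k x + (-1) *\<^sub>R u x) = Lp_mass p \<Omega> (\<lambda>x. 1 *\<^sub>R weak_grad \<Omega> (w k) x + (-1) *\<^sub>R weak_grad \<Omega> u x)"
        by (rule energy_lincomb[OF U p w1 u1])
      also have "\<dots> = Lp_mass p \<Omega> (\<lambda>x. weak_grad \<Omega> (w k) x - G x)"
        using gae LpD(1)[OF Lp_diff[OF p wg[of k] W1pD(3)[OF U u1]]] LpD(1)[OF Lp_diff[OF p wg[of k] GL]]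
        by (intro Lp_mass_cong_AE) (auto elim!: eventually_mono)
      finally show ?thesis by simp
    qed
    then show "(\<lambda>k. energy p \<Omega> (\<lambda>x. w k x - u x)) \<longlonglongrightarrow> 0"
      using Glim by (simp add: Lp_mass_def)
  qed
qed

section \<open>Borel representatives and Fubini for Lebesgue integrals\<close>

lemma lebesgue_ex_borel_measurable:
  fixes f :: "'a::euclidean_space \<Rightarrow> 'b::euclidean_space"
  assumes f: "f \<in> borel_measurable lebesgue"
  obtains g where "g \<in> borel_measurable borel" "AE x in lborel. f x = g x"
proof -
  have "\<exists>g. g \<in> borel_measurable lborel \<and> (AE x in lborel. f x \<bullet> b = g x)" for b
    using completion_ex_borel_measurable_real[of "\<lambda>x. f x \<bullet> b" lborel] f by auto
  then obtain g where g: "\<And>b. g b \<in> borel_measurable lborel" "\<And>b. AE x in lborel. f x \<bullet> b = g b x"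
    by metis
  have "AE x in lborel. \<forall>b\<in>Basis. f x \<bullet> b = g b x"
    using g(2) by (intro AE_finite_allI) auto
  then have "AE x in lborel. f x = (\<Sum>b\<in>Basis. g b x *\<^sub>R b)"
  proof eventually_elim
    case (elim x)
    then have "(\<Sum>b\<in>Basis. g b x *\<^sub>R b) = (\<Sum>b\<in>Basis. (f x \<bullet> b) *\<^sub>R b)" by simp
    then show ?case by (simp add: euclidean_representation)
  qed
  moreover have "(\<lambda>x. \<Sum>b\<in>Basis. g b x *\<^sub>R b) \<in> borel_measurable borel"
    using g(1) by (intro borel_measurable_sum borel_measurable_scaleR) auto
  ultimately show thesis using that by blast
qed

lemma AE_lborel_Pair:
  assumes "AE z in lborel. P z"
  shows "AE x in lborel. AE y in lborel. P (x :: 'a::euclidean_space, y :: 'b::euclidean_space)"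
proof -
  have "AE z in lborel \<Otimes>\<^sub>M lborel. P z" using assms by (simp only: lborel_prod)
  then show ?thesis by (rule lborel_pair.AE_pair)
qed

lemma lborel_Fubini:
  fixes f :: "'a::euclidean_space \<times> 'b::euclidean_space \<Rightarrow> 'c::euclidean_space"
  assumes "integrable lborel f"
  shows "AE x in lborel. integrable lborel (\<lambda>y. f (x, y))"
    "integrable lborel (\<lambda>x. \<integral>y. f (x, y) \<partial>lborel)"
    "(\<integral>x. (\<integral>y. f (x, y) \<partial>lborel) \<partial>lborel) = (\<integral>z. f z \<partial>lborel)"
  using lborel_pair.AE_integrable_fst'[of f] lborel_pair.integrable_fst'[of f] lborel_pair.integral_fst'[of f] assms
  by (simp_all add: lborel_prod)

lemma lborel_Fubini_swap:
  fixes f :: "'a::euclidean_space \<times> 'b::euclidean_space \<Rightarrow> 'c::euclidean_space"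
  assumes "integrable lborel f"
  shows "AE y in lborel. integrable lborel (\<lambda>x. f (x, y))"
    "integrable lborel (\<lambda>y. \<integral>x. f (x, y) \<partial>lborel)"
    "(\<integral>y. (\<integral>x. f (x, y) \<partial>lborel) \<partial>lborel) = (\<integral>z. f z \<partial>lborel)"
proof -
  have f: "integrable (lborel \<Otimes>\<^sub>M lborel) f" using assms by (simp add: lborel_prod)
  have sw: "integrable (lborel \<Otimes>\<^sub>M lborel) (\<lambda>(y, x). f (x, y))"
    by (rule lborel_pair.integrable_product_swap[OF f])
  show "AE y in lborel. integrable lborel (\<lambda>x. f (x, y))" "integrable lborel (\<lambda>y. \<integral>x. f (x, y) \<partial>lborel)"
    using lborel_pair.AE_integrable_fst'[OF sw] lborel_pair.integrable_fst'[OF sw] by simp_all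
  show "(\<integral>y. (\<integral>x. f (x, y) \<partial>lborel) \<partial>lborel) = (\<integral>z. f z \<partial>lborel)"
    using lborel_pair.integral_fst'[OF sw] lborel_pair.integral_product_swap[OF borel_measurable_integrable[OF f]]
    by (simp add: lborel_prod)
qed

text \<open>
  Lebesgue measure on the product is only the completion of the product measure, so the sections of
  a measurable function may fail to be measurable on a null set of first coordinates. A Borel representative reduces the claim to the
  product theorem for Borel functions.
\<close>
lemma lebesgue_Fubini:
  fixes f :: "'a::euclidean_space \<times> 'b::euclidean_space \<Rightarrow> 'c::euclidean_space"
  assumes f: "integrable lebesgue f"
  shows "integrable lebesgue (\<lambda>x. \<integral>y. f (x, y) \<partial>lebesgue)"
    "(\<integral>x. (\<integral>y. f (x, y) \<partial>lebesgue) \<partial>lebesgue) = (\<integral>z. f z \<partial>lebesgue)"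
proof -
  obtain g where g: "g \<in> borel_measurable borel" "AE z in lborel. f z = g z"
    using lebesgue_ex_borel_measurable[OF borel_measurable_integrable[OF f]] by blast
  have fg: "AE z in lebesgue. f z = g z" by (rule AE_completion[OF g(2)])
  have gl: "g \<in> borel_measurable lborel" using g by simp
  have "integrable lebesgue g"
    using integrable_cong_AE[OF borel_measurable_integrable[OF f] measurable_completion[OF gl] fg] f by simp
  then have gi: "integrable lborel g" using integrable_completion[OF gl] by simp
  have sec: "AE x in lborel. (\<integral>y. f (x, y) \<partial>lebesgue) = (\<integral>y. g (x, y) \<partial>lborel)"
    using AE_lborel_Pair[OF g(2)]
  proof eventually_elim
    case (elim x)
    have m: "(\<lambda>y. g (x, y)) \<in> borel_measurable lborel"
      using g(1) by simp
    have ae: "AE y in lebesgue. g (x, y) = f (x, y)"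
      using AE_completion[OF elim] by (auto elim!: eventually_mono)
    then have "(\<lambda>y. f (x, y)) \<in> borel_measurable lebesgue"
      by (rule borel_measurable_AE[OF measurable_completion[OF m]])
    then have "(\<integral>y. f (x, y) \<partial>lebesgue) = (\<integral>y. g (x, y) \<partial>lebesgue)"
      using ae measurable_completion[OF m] by (intro integral_cong_AE) (auto elim!: eventually_mono)
    also have "\<dots> = (\<integral>y. g (x, y) \<partial>lborel)" by (rule integral_completion[OF m])
    finally show ?case .
  qed
  note G = lborel_Fubini[OF gi]
  have Gm: "(\<lambda>x. \<integral>y. g (x, y) \<partial>lborel) \<in> borel_measurable lborel"
    by (rule borel_measurable_integrable[OF G(2)])
  have ae: "AE x in lebesgue. (\<integral>y. g (x, y) \<partial>lborel) = (\<integral>y. f (x, y) \<partial>lebesgue)"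
    using AE_completion[OF sec] by (auto elim!: eventually_mono)
  have fm: "(\<lambda>x. \<integral>y. f (x, y) \<partial>lebesgue) \<in> borel_measurable lebesgue"
    by (rule borel_measurable_AE[OF measurable_completion[OF Gm] ae])
  show "integrable lebesgue (\<lambda>x. \<integral>y. f (x, y) \<partial>lebesgue)"
    using integrable_cong_AE[OF measurable_completion[OF Gm] fm ae] integrable_completion[OF Gm] G(2) by simp
  have "(\<integral>x. (\<integral>y. f (x, y) \<partial>lebesgue) \<partial>lebesgue) = (\<integral>x. (\<integral>y. g (x, y) \<partial>lborel) \<partial>lebesgue)"
    by (rule integral_cong_AE[OF fm measurable_completion[OF Gm]]) (use ae in \<open>auto elim!: eventually_mono\<close>)
  also have "\<dots> = (\<integral>z. g z \<partial>lborel)" unfolding integral_completion[OF Gm] by (rule G(3))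
  also have "\<dots> = (\<integral>z. g z \<partial>lebesgue)" by (rule integral_completion[OF gl, symmetric])
  also have "\<dots> = (\<integral>z. f z \<partial>lebesgue)"
    using fg measurable_completion[OF gl] borel_measurable_integrable[OF f]
    by (intro integral_cong_AE) (auto elim!: eventually_mono)
  finally show "(\<integral>x. (\<integral>y. f (x, y) \<partial>lebesgue) \<partial>lebesgue) = (\<integral>z. f z \<partial>lebesgue)" .
qed

lemma smooth_product:
  assumes \<eta>: "smooth (\<eta> :: 'a::euclidean_space \<Rightarrow> real)" and \<psi>: "smooth (\<psi> :: 'b::euclidean_space \<Rightarrow> real)"
  shows "smooth (\<lambda>z. \<eta> (fst z) * \<psi> (snd z))"
    "frechet_derivative (\<lambda>z. \<eta> (fst z) * \<psi> (snd z)) (at (t, x)) (e, 0) = frechet_derivative \<eta> (at t) e * \<psi> x"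
proof -
  show "smooth (\<lambda>z. \<eta> (fst z) * \<psi> (snd z))"
    using \<eta> \<psi> unfolding smooth_def
    by (auto intro!: C_diff_mult C_diff_compose_linear[OF bounded_linear_fst] C_diff_compose_linear[OF bounded_linear_snd])
  have "((\<lambda>z. \<eta> (fst z) * \<psi> (snd z)) has_derivative
      (\<lambda>d. \<eta> (fst (t, x)) * frechet_derivative \<psi> (at (snd (t, x))) (snd d)
        + frechet_derivative \<eta> (at (fst (t, x))) (fst d) * \<psi> (snd (t, x)))) (at (t, x))"
    by (intro has_derivative_mult has_derivative_compose[OF bounded_linear_imp_has_derivative[OF bounded_linear_fst]]
        has_derivative_compose[OF bounded_linear_imp_has_derivative[OF bounded_linear_snd]] smooth_has_derivative \<eta> \<psi>)
  from fun_cong[OF frechet_derivative_at[OF this], of "(e, 0)"]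
  show "frechet_derivative (\<lambda>z. \<eta> (fst z) * \<psi> (snd z)) (at (t, x)) (e, 0) = frechet_derivative \<eta> (at t) e * \<psi> x"
    using linear_0[OF has_derivative_linear[OF smooth_has_derivative[OF \<psi>]]] by simp
qed

lemma test_fun_product:
  assumes \<eta>: "test_fun I (\<eta> :: 'a::euclidean_space \<Rightarrow> real)" and \<psi>: "test_fun U (\<psi> :: 'b::euclidean_space \<Rightarrow> real)"
  shows "test_fun (I \<times> U) (\<lambda>z. \<eta> (fst z) * \<psi> (snd z))"
proof -
  obtain K where K: "compact K" "K \<subseteq> I" "\<And>x. x \<notin> K \<Longrightarrow> \<eta> x = 0" by (rule test_fun_support[OF \<eta>]) blast
  obtain L where L: "compact L" "L \<subseteq> U" "\<And>x. x \<notin> L \<Longrightarrow> \<psi> x = 0" by (rule test_fun_support[OF \<psi>]) blast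
  have "\<eta> a \<noteq> 0 \<Longrightarrow> a \<in> K" "\<psi> b \<noteq> 0 \<Longrightarrow> b \<in> L" for a b using K(3) L(3) by blast+
  then show ?thesis
    using K(2) L(2) compact_Times[OF K(1) L(1)]
    by (intro test_funI[OF smooth_product(1)[OF test_fun_smooth[OF \<eta>] test_fun_smooth[OF \<psi>]], of "K \<times> L"]) auto
qed

lemma Fubini_test:
  fixes F :: "'a::euclidean_space \<Rightarrow> 'b::euclidean_space \<Rightarrow> 'c::euclidean_space"
  assumes I: "open I" and U: "open U" and F: "locally_integrable (I \<times> U) (\<lambda>(t, x). F t x)"
    and \<eta>: "test_fun I (\<eta> :: 'a \<Rightarrow> real)" and \<psi>: "test_fun U (\<psi> :: 'b \<Rightarrow> real)"
  shows "(\<integral>z. (\<eta> (fst z) * \<psi> (snd z)) *\<^sub>R (case z of (t, x) \<Rightarrow> F t x) \<partial>lebesgue_on (I \<times> U))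
    = (\<integral>t. \<eta> t *\<^sub>R (\<integral>x. \<psi> x *\<^sub>R F t x \<partial>lebesgue_on U) \<partial>lebesgue_on I)"
proof -
  have op: "open (I \<times> U)" using I U by (rule open_Times)
  define G where "G = (\<lambda>z. if z \<in> I \<times> U then (\<eta> (fst z) * \<psi> (snd z)) *\<^sub>R (case z of (t, x) \<Rightarrow> F t x) else 0)"
  have "integrable (lebesgue_on (I \<times> U)) (\<lambda>z. (\<eta> (fst z) * \<psi> (snd z)) *\<^sub>R (case z of (t, x) \<Rightarrow> F t x))"
    by (rule locally_integrable_mult_test[OF op F test_fun_product[OF \<eta> \<psi>]])
  then have G: "integrable lebesgue G"
    unfolding G_def using op by (intro iffD2[OF Lebesgue_Measure.integrable_restrict_UNIV]) auto
  have sec: "(\<integral>x. G (t, x) \<partial>lebesgue) = (if t \<in> I then \<eta> t *\<^sub>R (\<integral>x. \<psi> x *\<^sub>R F t x \<partial>lebesgue_on U) else 0)" for t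
  proof (cases "t \<in> I")
    case True
    then have "(\<integral>x. G (t, x) \<partial>lebesgue) = (\<integral>x. (if x \<in> U then \<eta> t *\<^sub>R (\<psi> x *\<^sub>R F t x) else 0) \<partial>lebesgue)"
      by (intro Bochner_Integration.integral_cong) (auto simp: G_def)
    also have "\<dots> = (\<integral>x. \<eta> t *\<^sub>R (\<psi> x *\<^sub>R F t x) \<partial>lebesgue_on U)"
      using U by (intro Lebesgue_Measure.integral_restrict_UNIV) auto
    finally show ?thesis by (simp only: True if_True integral_scaleR_right)
  qed (simp add: G_def)
  have "(\<integral>z. (\<eta> (fst z) * \<psi> (snd z)) *\<^sub>R (case z of (t, x) \<Rightarrow> F t x) \<partial>lebesgue_on (I \<times> U)) = (\<integral>z. G z \<partial>lebesgue)"
    unfolding G_def using op by (intro Lebesgue_Measure.integral_restrict_UNIV[symmetric]) auto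
  also have "\<dots> = (\<integral>t. (\<integral>x. G (t, x) \<partial>lebesgue) \<partial>lebesgue)"
    by (rule lebesgue_Fubini(2)[OF G, symmetric])
  also have "\<dots> = (\<integral>t. \<eta> t *\<^sub>R (\<integral>x. \<psi> x *\<^sub>R F t x \<partial>lebesgue_on U) \<partial>lebesgue_on I)"
    unfolding sec using I by (intro Lebesgue_Measure.integral_restrict_UNIV) auto
  finally show ?thesis .
qed

section \<open>Recovering a function from its weak time derivative\<close>

text \<open>
  The substitution \<open>\<tau> = s + y/(k+1)\<close> turns the concentrating weight into the fixed weight \<open>\<beta> y\<close>.
\<close>
lemma bump_average_tendsto:
  fixes A :: "real \<Rightarrow> 'b::euclidean_space"
  assumes A: "continuous_on UNIV A" and \<beta>: "continuous_on UNIV \<beta>" "\<And>y. y \<notin> {0<..<1} \<Longrightarrow> \<beta> y = 0" "\<And>y. 0 \<le> \<beta> y"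
  shows "(\<lambda>k. \<integral>\<tau>. (real (Suc k) * \<beta> (real (Suc k) * (\<tau> - s))) *\<^sub>R A \<tau> \<partial>lborel) \<longlonglongrightarrow> (\<integral>y. \<beta> y \<partial>lborel) *\<^sub>R A s"
proof -
  have Am: "A \<in> borel_measurable borel" and \<beta>m: "\<beta> \<in> borel_measurable borel"
    using A \<beta>(1) by (auto intro: borel_measurable_continuous_onI)
  have sub: "(\<integral>\<tau>. (real (Suc k) * \<beta> (real (Suc k) * (\<tau> - s))) *\<^sub>R A \<tau> \<partial>lborel)
      = (\<integral>y. \<beta> y *\<^sub>R A (s + inverse (real (Suc k)) * y) \<partial>lborel)" for k
  proof -
    let ?c = "inverse (real (Suc k))"
    have "(\<integral>\<tau>. (real (Suc k) * \<beta> (real (Suc k) * (\<tau> - s))) *\<^sub>R A \<tau> \<partial>lborel)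
        = \<bar>?c\<bar> *\<^sub>R (\<integral>y. (real (Suc k) * \<beta> (real (Suc k) * ((s + ?c * y) - s))) *\<^sub>R A (s + ?c * y) \<partial>lborel)"
      by (rule lborel_integral_real_affine) simp
    also have "\<dots> = (\<integral>y. ?c *\<^sub>R (real (Suc k) * \<beta> (real (Suc k) * ((s + ?c * y) - s))) *\<^sub>R A (s + ?c * y) \<partial>lborel)"
      by (subst integral_scaleR_right) simp
    also have "\<dots> = (\<integral>y. \<beta> y *\<^sub>R A (s + ?c * y) \<partial>lborel)"
      by (intro Bochner_Integration.integral_cong refl) (simp add: field_simps del: of_nat_Suc)
    finally show ?thesis .
  qed
  have "compact {s..s+1}" by simp
  from compact_imp_bounded[OF compact_continuous_image[OF continuous_on_subset[OF A subset_UNIV] this]]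
  obtain M where "\<forall>x\<in>A ` {s..s+1}. norm x \<le> M" unfolding bounded_iff by blast
  then have M: "\<And>y. y \<in> {s..s+1} \<Longrightarrow> norm (A y) \<le> M" by blast
  have \<beta>ind: "\<beta> y = indicator {0..1} y *\<^sub>R \<beta> y" for y using \<beta>(2)[of y] by (auto split: split_indicator)
  have \<beta>i: "integrable lborel \<beta>"
    by (subst \<beta>ind[abs_def]) (intro borel_integrable_compact continuous_on_subset[OF \<beta>(1)], auto)
  have "(\<lambda>k. \<integral>y. \<beta> y *\<^sub>R A (s + inverse (real (Suc k)) * y) \<partial>lborel) \<longlonglongrightarrow> (\<integral>y. \<beta> y *\<^sub>R A s \<partial>lborel)"
  proof (rule integral_dominated_convergence[where w = "\<lambda>y. \<beta> y * M"])
    show "AE y in lborel. (\<lambda>k. \<beta> y *\<^sub>R A (s + inverse (real (Suc k)) * y)) \<longlonglongrightarrow> \<beta> y *\<^sub>R A s"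
    proof (intro AE_I2 tendsto_scaleR tendsto_const)
      fix y
      have "(\<lambda>k. s + inverse (real (Suc k)) * y) \<longlonglongrightarrow> s + 0 * y"
        by (intro tendsto_intros LIMSEQ_inverse_real_of_nat)
      then show "(\<lambda>k. A (s + inverse (real (Suc k)) * y)) \<longlonglongrightarrow> A s"
        using A continuous_on_tendsto_compose[OF A, of _ s sequentially] by simp
    qed
    show "AE y in lborel. norm (\<beta> y *\<^sub>R A (s + inverse (real (Suc k)) * y)) \<le> \<beta> y * M" for k
    proof (intro AE_I2)
      fix y
      show "norm (\<beta> y *\<^sub>R A (s + inverse (real (Suc k)) * y)) \<le> \<beta> y * M"
      proof (cases "y \<in> {0<..<1}")
        case True
        have "0 < inverse (real (Suc k)) * y" using True by simp
        moreover have "inverse (real (Suc k)) * y \<le> 1 * 1"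
          using True by (intro mult_mono) (auto simp: field_simps)
        ultimately have "s + inverse (real (Suc k)) * y \<in> {s..s+1}" by simp
        then show ?thesis using \<beta>(3)[of y] M by (simp add: mult_left_mono)
      qed (simp add: \<beta>(2))
    qed
    show "(\<lambda>y. \<beta> y *\<^sub>R A s) \<in> borel_measurable lborel" using \<beta>m by simp
    show "(\<lambda>y. \<beta> y *\<^sub>R A (s + inverse (real (Suc k)) * y)) \<in> borel_measurable lborel" for k
      using \<beta>m Am by simp
  qed (use \<beta>i in simp)
  then show ?thesis unfolding sub using \<beta>i by simp
qed

text \<open>
  The test function \<open>\<eta> k\<close> climbs from \<open>0\<close> to \<open>c\<close> just after \<open>s\<close> and descends again just after \<open>t\<close>. Its
  derivative concentrates at \<open>s\<close> and \<open>t\<close> and recovers \<open>A s - A t\<close>, while \<open>\<eta> k\<close> itself converges to \<open>c\<close>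
  times the indicator of \<open>(s, t]\<close>.
\<close>
lemma weak_derivative_FTC_pos:
  fixes A B :: "real \<Rightarrow> 'b::euclidean_space"
  assumes A: "continuous_on {0..} A"
    and B: "\<And>T. T > 0 \<Longrightarrow> integrable (lebesgue_on {0<..<T}) B"
    and weak: "\<And>\<eta>. test_fun {0<..} \<eta> \<Longrightarrow>
      (\<integral>t. frechet_derivative \<eta> (at t) 1 *\<^sub>R A t \<partial>lebesgue_on {0<..}) = - (\<integral>t. \<eta> t *\<^sub>R B t \<partial>lebesgue_on {0<..})"
    and st: "0 < s" "s < t"
  shows "A t - A s = (\<integral>\<tau>. B \<tau> \<partial>lebesgue_on {s<..t})"
proof -
  obtain P \<beta> c where P: "smooth P" "\<And>y. (P has_real_derivative \<beta> y) (at y)" "\<And>y. y \<le> 0 \<Longrightarrow> P y = 0"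
    "\<And>y. y \<ge> 1 \<Longrightarrow> P y = c" "c > 0" "\<And>y. 0 \<le> P y" "\<And>y. P y \<le> c"
    and \<beta>: "\<And>y. 0 \<le> \<beta> y" "\<And>y. y \<notin> {0<..<1} \<Longrightarrow> \<beta> y = 0" "continuous_on UNIV \<beta>"
    by (rule smooth_step_exists) blast
  have int\<beta>: "(\<integral>y. \<beta> y \<partial>lborel) = c"
  proof -
    have "\<beta> = (\<lambda>y. indicator {0..1} y *\<^sub>R \<beta> y)" using \<beta>(2) by (auto simp: fun_eq_iff split: split_indicator)
    then have "(\<integral>y. \<beta> y \<partial>lborel) = (\<integral>y. indicator {0..1} y *\<^sub>R \<beta> y \<partial>lborel)" by metis
    also have "\<dots> = P 1 - P 0"
      using P(2) continuous_on_subset[OF \<beta>(3) subset_UNIV]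
      by (intro integral_FTC_Icc) (auto simp: has_real_derivative_iff_has_vector_derivative[symmetric] intro: has_field_derivative_at_within)
    finally show ?thesis using P(3)[of 0] P(4)[of 1] by simp
  qed
  define A0 where "A0 \<tau> = A (max 0 \<tau>)" for \<tau>
  have A0: "continuous_on UNIV A0"
    unfolding A0_def by (intro continuous_on_compose2[OF A] continuous_intros) auto
  define \<eta> where "\<eta> k \<tau> = P (real (Suc k) * (\<tau> - s)) - P (real (Suc k) * (\<tau> - t))" for k \<tau>
  define d where "d k r \<tau> = real (Suc k) * \<beta> (real (Suc k) * (\<tau> - r))" for k r \<tau>
  have der: "(\<eta> k has_real_derivative d k s \<tau> - d k t \<tau>) (at \<tau>)" for k \<tau>
    unfolding \<eta>_def d_def
    by (rule DERIV_cong[OF DERIV_diff[OF DERIV_chain2[OF P(2)] DERIV_chain2[OF P(2)]]])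
      (auto intro!: derivative_eq_intros)
  have fder: "frechet_derivative (\<eta> k) (at \<tau>) 1 = d k s \<tau> - d k t \<tau>" for k \<tau>
    using fun_cong[OF frechet_derivative_at[OF der[unfolded has_field_derivative_def]], of k \<tau> 1] by simp
  have big: "1 \<le> real (Suc k) * (\<tau> - r)" if "\<tau> > r + 1" for k r \<tau>
    using mult_mono[of 1 "real (Suc k)" 1 "\<tau> - r"] that by simp
  have neg: "real (Suc k) * (\<tau> - r) \<le> 0" if "\<tau> \<le> r" for k r \<tau>
    using that by (intro mult_nonneg_nonpos) auto
  have \<eta>0: "\<eta> k \<tau> = 0" if "\<tau> \<notin> {s..t+1}" for k \<tau>
    using that neg[of \<tau> s k] neg[of \<tau> t k] big[of s \<tau> k] big[of t \<tau> k] st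
    by (cases "\<tau> < s") (simp_all add: \<eta>_def P(3,4) del: of_nat_Suc)
  have test: "test_fun {0<..} (\<eta> k)" for k
  proof (rule test_funI[where K = "{s..t+1}"])
    have aff: "C_diff l (\<lambda>\<tau>. real (Suc k) * (\<tau> - r))" for l r
    proof -
      have "C_diff l (\<lambda>\<tau>. real (Suc k) * \<tau> + - (real (Suc k) * r))"
        by (intro C_diff_add C_diff_const C_diff_linear bounded_linear_mult_right)
      moreover have "(\<lambda>\<tau>. real (Suc k) * (\<tau> - r)) = (\<lambda>\<tau>. real (Suc k) * \<tau> + - (real (Suc k) * r))"
        by (simp add: fun_eq_iff algebra_simps)
      ultimately show ?thesis by simp
    qed
    have "C_diff l (\<lambda>\<tau>. P (real (Suc k) * (\<tau> - s)) + (- 1) * P (real (Suc k) * (\<tau> - t)))" for l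
      by (intro C_diff_add C_diff_mult C_diff_const C_diff_compose_real[OF P(1)[unfolded smooth_def, rule_format]] aff)
    then show "smooth (\<eta> k)" by (simp add: smooth_def \<eta>_def[abs_def])
  qed (use st \<eta>0 in auto)
  have LHS: "(\<integral>\<tau>. frechet_derivative (\<eta> k) (at \<tau>) 1 *\<^sub>R A \<tau> \<partial>lebesgue_on {0<..})
      = (\<integral>\<tau>. d k s \<tau> *\<^sub>R A0 \<tau> \<partial>lborel) - (\<integral>\<tau>. d k t \<tau> *\<^sub>R A0 \<tau> \<partial>lborel)" for k
  proof -
    have dc: "continuous_on UNIV (d k r)" for r
      unfolding d_def by (intro continuous_intros continuous_on_compose2[OF \<beta>(3)]) auto
    have d0: "d k r \<tau> = 0" if "\<tau> \<notin> {r..r+1}" for r \<tau>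
      using that neg[of \<tau> r k] big[of r \<tau> k] \<beta>(2)[of "real (Suc k) * (\<tau> - r)"] unfolding d_def by force
    have di: "integrable lborel (\<lambda>\<tau>. d k r \<tau> *\<^sub>R A0 \<tau>)" for r
    proof -
      have "integrable lborel (\<lambda>\<tau>. indicator {r..r+1} \<tau> *\<^sub>R (d k r \<tau> *\<^sub>R A0 \<tau>))"
        by (intro borel_integrable_compact continuous_on_scaleR continuous_on_subset[OF dc] continuous_on_subset[OF A0]) auto
      moreover have "(\<lambda>\<tau>. indicator {r..r+1} \<tau> *\<^sub>R (d k r \<tau> *\<^sub>R A0 \<tau>)) = (\<lambda>\<tau>. d k r \<tau> *\<^sub>R A0 \<tau>)"
        using d0 by (intro ext) (auto split: split_indicator)
      ultimately show ?thesis by simp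
    qed
    have "(\<integral>\<tau>. frechet_derivative (\<eta> k) (at \<tau>) 1 *\<^sub>R A \<tau> \<partial>lebesgue_on {0<..})
        = (\<integral>\<tau>. (if \<tau> \<in> {0<..} then frechet_derivative (\<eta> k) (at \<tau>) 1 *\<^sub>R A \<tau> else 0) \<partial>lebesgue)"
      by (rule Lebesgue_Measure.integral_restrict_UNIV[symmetric]) simp
    also have "\<dots> = (\<integral>\<tau>. d k s \<tau> *\<^sub>R A0 \<tau> - d k t \<tau> *\<^sub>R A0 \<tau> \<partial>lebesgue)"
    proof (intro Bochner_Integration.integral_cong refl)
      fix \<tau>
      show "(if \<tau> \<in> {0<..} then frechet_derivative (\<eta> k) (at \<tau>) 1 *\<^sub>R A \<tau> else 0) = d k s \<tau> *\<^sub>R A0 \<tau> - d k t \<tau> *\<^sub>R A0 \<tau>"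
        using d0[of \<tau> s] d0[of \<tau> t] st by (auto simp: fder A0_def max_def scaleR_diff_left)
    qed
    also have "\<dots> = (\<integral>\<tau>. d k s \<tau> *\<^sub>R A0 \<tau> - d k t \<tau> *\<^sub>R A0 \<tau> \<partial>lborel)"
      using borel_measurable_integrable[OF di] by (intro integral_completion) simp
    finally show ?thesis using di by simp
  qed
  have RHSi: "integrable lebesgue (\<lambda>\<tau>. if \<tau> \<in> {0<..<t+2} then B \<tau> else 0)"
    using B[of "t+2"] st by (intro iffD2[OF Lebesgue_Measure.integrable_restrict_UNIV]) auto
  have RHS: "(\<lambda>k. \<integral>\<tau>. \<eta> k \<tau> *\<^sub>R B \<tau> \<partial>lebesgue_on {0<..}) \<longlonglongrightarrow> c *\<^sub>R (\<integral>\<tau>. B \<tau> \<partial>lebesgue_on {s<..t})"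
  proof -
    define B0 where "B0 = (\<lambda>\<tau>. if \<tau> \<in> {0<..<t+2} then B \<tau> else 0)"
    have eq: "(\<integral>\<tau>. \<eta> k \<tau> *\<^sub>R B \<tau> \<partial>lebesgue_on {0<..}) = (\<integral>\<tau>. \<eta> k \<tau> *\<^sub>R B0 \<tau> \<partial>lebesgue)" for k
    proof -
      have "(\<integral>\<tau>. \<eta> k \<tau> *\<^sub>R B \<tau> \<partial>lebesgue_on {0<..}) = (\<integral>\<tau>. (if \<tau> \<in> {0<..} then \<eta> k \<tau> *\<^sub>R B \<tau> else 0) \<partial>lebesgue)"
        by (rule Lebesgue_Measure.integral_restrict_UNIV[symmetric]) simp
      also have "\<dots> = (\<integral>\<tau>. \<eta> k \<tau> *\<^sub>R B0 \<tau> \<partial>lebesgue)"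
        using \<eta>0 st by (intro Bochner_Integration.integral_cong refl) (auto simp: B0_def)
      finally show ?thesis .
    qed
    have "(\<lambda>k. \<integral>\<tau>. \<eta> k \<tau> *\<^sub>R B0 \<tau> \<partial>lebesgue) \<longlonglongrightarrow> (\<integral>\<tau>. (c * indicator {s<..t} \<tau>) *\<^sub>R B0 \<tau> \<partial>lebesgue)"
    proof (rule integral_dominated_convergence[where w = "\<lambda>\<tau>. c * norm (B0 \<tau>)"])
      have B0m: "B0 \<in> borel_measurable lebesgue" unfolding B0_def by (rule borel_measurable_integrable[OF RHSi])
      then show "(\<lambda>\<tau>. (c * indicator {s<..t} \<tau>) *\<^sub>R B0 \<tau>) \<in> borel_measurable lebesgue"
        by (intro borel_measurable_scaleR borel_measurable_times borel_measurable_const borel_measurable_indicator) auto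
      have "\<eta> k \<in> borel_measurable lborel" for k
        using smooth_continuous[OF test_fun_smooth[OF test[of k]]] by (simp add: borel_measurable_continuous_onI)
      then show "(\<lambda>\<tau>. \<eta> k \<tau> *\<^sub>R B0 \<tau>) \<in> borel_measurable lebesgue" for k
        by (intro borel_measurable_scaleR[OF measurable_completion B0m])
      show "integrable lebesgue (\<lambda>\<tau>. c * norm (B0 \<tau>))"
        using RHSi unfolding B0_def by (intro integrable_mult_right integrable_norm)
      have "\<bar>\<eta> k \<tau>\<bar> \<le> c" for k \<tau>
        using P(6)[of "real (Suc k) * (\<tau> - s)"] P(7)[of "real (Suc k) * (\<tau> - s)"]
          P(6)[of "real (Suc k) * (\<tau> - t)"] P(7)[of "real (Suc k) * (\<tau> - t)"] unfolding \<eta>_def by linarith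
      then show "AE \<tau> in lebesgue. norm (\<eta> k \<tau> *\<^sub>R B0 \<tau>) \<le> c * norm (B0 \<tau>)" for k
        by (intro AE_I2) (simp add: mult_right_mono)
      have Plim: "(\<lambda>k. P (real (Suc k) * (\<tau> - r))) \<longlonglongrightarrow> c * indicator {r<..} \<tau>" for \<tau> r
      proof (cases "r < \<tau>")
        case True
        obtain N :: nat where N: "1 / (\<tau> - r) < real N" using reals_Archimedean2 by blast
        have "P (real (Suc k) * (\<tau> - r)) = c" if "k \<ge> N" for k
        proof -
          have "1 / (\<tau> - r) \<le> real (Suc k)" using N that by simp
          then have "1 \<le> real (Suc k) * (\<tau> - r)" using True by (simp add: field_simps)
          then show ?thesis by (rule P(4))
        qed
        then show ?thesis using True by (intro tendsto_eventually eventually_sequentiallyI[of N]) simp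
      next
        case False
        then show ?thesis using neg[of \<tau> r] by (simp add: P(3) del: of_nat_Suc)
      qed
      show "AE \<tau> in lebesgue. (\<lambda>k. \<eta> k \<tau> *\<^sub>R B0 \<tau>) \<longlonglongrightarrow> (c * indicator {s<..t} \<tau>) *\<^sub>R B0 \<tau>"
      proof (intro AE_I2 tendsto_scaleR tendsto_const)
        fix \<tau>
        have "(\<lambda>k. \<eta> k \<tau>) \<longlonglongrightarrow> c * indicator {s<..} \<tau> - c * indicator {t<..} \<tau>"
          unfolding \<eta>_def by (intro tendsto_diff Plim)
        also have "c * indicator {s<..} \<tau> - c * indicator {t<..} \<tau> = c * indicator {s<..t} \<tau>"
          using st by (auto split: split_indicator)
        finally show "(\<lambda>k. \<eta> k \<tau>) \<longlonglongrightarrow> c * indicator {s<..t} \<tau>" .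
      qed
    qed
    also have "(\<integral>\<tau>. (c * indicator {s<..t} \<tau>) *\<^sub>R B0 \<tau> \<partial>lebesgue) = (\<integral>\<tau>. c *\<^sub>R (if \<tau> \<in> {s<..t} then B \<tau> else 0) \<partial>lebesgue)"
      using st by (intro Bochner_Integration.integral_cong refl) (auto simp: B0_def)
    also have "\<dots> = c *\<^sub>R (\<integral>\<tau>. B \<tau> \<partial>lebesgue_on {s<..t})"
      by (simp only: integral_scaleR_right, subst Lebesgue_Measure.integral_restrict_UNIV) auto
    finally show ?thesis unfolding eq .
  qed
  have "(\<lambda>k. \<integral>\<tau>. frechet_derivative (\<eta> k) (at \<tau>) 1 *\<^sub>R A \<tau> \<partial>lebesgue_on {0<..}) \<longlonglongrightarrow> c *\<^sub>R A0 s - c *\<^sub>R A0 t"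
    unfolding LHS d_def int\<beta>[symmetric] by (intro tendsto_diff bump_average_tendsto A0 \<beta>)
  moreover have "(\<lambda>k. \<integral>\<tau>. frechet_derivative (\<eta> k) (at \<tau>) 1 *\<^sub>R A \<tau> \<partial>lebesgue_on {0<..}) \<longlonglongrightarrow> - (c *\<^sub>R (\<integral>\<tau>. B \<tau> \<partial>lebesgue_on {s<..t}))"
    unfolding weak[OF test] by (intro tendsto_minus RHS)
  ultimately have "c *\<^sub>R A0 s - c *\<^sub>R A0 t = - (c *\<^sub>R (\<integral>\<tau>. B \<tau> \<partial>lebesgue_on {s<..t}))"
    by (rule LIMSEQ_unique)
  then have "c *\<^sub>R (A0 t - A0 s) = c *\<^sub>R (\<integral>\<tau>. B \<tau> \<partial>lebesgue_on {s<..t})"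
    by (simp add: algebra_simps)
  then show ?thesis using P(5) st by (simp add: A0_def max_def)
qed

text \<open>
  Test functions vanish near time \<open>0\<close>, so the case \<open>s = 0\<close> is reached as a limit of positive times, by
  continuity of \<open>A\<close>.
\<close>
lemma weak_derivative_FTC:
  fixes A B :: "real \<Rightarrow> 'b::euclidean_space"
  assumes A: "continuous_on {0..} A"
    and B: "\<And>T. T > 0 \<Longrightarrow> integrable (lebesgue_on {0<..<T}) B"
    and weak: "\<And>\<eta>. test_fun {0<..} \<eta> \<Longrightarrow>
      (\<integral>t. frechet_derivative \<eta> (at t) 1 *\<^sub>R A t \<partial>lebesgue_on {0<..}) = - (\<integral>t. \<eta> t *\<^sub>R B t \<partial>lebesgue_on {0<..})"
    and st: "0 \<le> s" "s < t"
  shows "A t - A s = (\<integral>\<tau>. B \<tau> \<partial>lebesgue_on {s<..t})"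
proof (cases "s = 0")
  case True
  have t: "t > 0" using st by simp
  \<comment> \<open>The shift by two keeps every \<open>r k\<close> strictly below \<open>t\<close>.\<close>
  define r where "r k = t * inverse (real (Suc (Suc k)))" for k
  have r: "0 < r k" "r k < t" for k
  proof -
    show "0 < r k" using t by (simp add: r_def)
    have "inverse (real (Suc (Suc k))) < 1" by (simp add: field_simps)
    from mult_strict_left_mono[OF this t] show "r k < t" by (simp add: r_def)
  qed
  have r0: "r \<longlonglongrightarrow> 0"
    unfolding r_def using tendsto_mult[OF tendsto_const[of t] LIMSEQ_Suc[OF LIMSEQ_inverse_real_of_nat]] by simp
  have eq: "A t - A (r k) = (\<integral>\<tau>. B \<tau> \<partial>lebesgue_on {r k<..t})" for k
    by (rule weak_derivative_FTC_pos[OF A B weak r])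
  have "(\<lambda>k. A (r k)) \<longlonglongrightarrow> A 0"
    by (rule continuous_on_tendsto_compose[OF A r0]) (use r in \<open>auto intro!: always_eventually less_imp_le\<close>)
  then have "(\<lambda>k. A t - A (r k)) \<longlonglongrightarrow> A t - A 0" by (intro tendsto_intros)
  moreover have "(\<lambda>k. \<integral>\<tau>. B \<tau> \<partial>lebesgue_on {r k<..t}) \<longlonglongrightarrow> (\<integral>\<tau>. B \<tau> \<partial>lebesgue_on {0<..t})"
  proof -
    define B0 where "B0 = (\<lambda>\<tau>. if \<tau> \<in> {0<..<t+1} then B \<tau> else 0)"
    have B0: "integrable lebesgue B0"
      unfolding B0_def using B[of "t+1"] t by (intro iffD2[OF Lebesgue_Measure.integrable_restrict_UNIV]) auto
    have e: "(\<integral>\<tau>. B \<tau> \<partial>lebesgue_on {q<..t}) = (\<integral>\<tau>. indicator {q<..t} \<tau> *\<^sub>R B0 \<tau> \<partial>lebesgue)" if "q \<ge> 0" for q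
    proof -
      have "(\<integral>\<tau>. B \<tau> \<partial>lebesgue_on {q<..t}) = (\<integral>\<tau>. (if \<tau> \<in> {q<..t} then B \<tau> else 0) \<partial>lebesgue)"
        by (rule Lebesgue_Measure.integral_restrict_UNIV[symmetric]) simp
      also have "\<dots> = (\<integral>\<tau>. indicator {q<..t} \<tau> *\<^sub>R B0 \<tau> \<partial>lebesgue)"
        using that by (intro Bochner_Integration.integral_cong refl) (auto simp: B0_def)
      finally show ?thesis .
    qed
    have "(\<lambda>k. \<integral>\<tau>. indicator {r k<..t} \<tau> *\<^sub>R B0 \<tau> \<partial>lebesgue) \<longlonglongrightarrow> (\<integral>\<tau>. indicator {0<..t} \<tau> *\<^sub>R B0 \<tau> \<partial>lebesgue)"
    proof (rule integral_dominated_convergence[where w = "\<lambda>\<tau>. norm (B0 \<tau>)"])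
      have m: "(\<lambda>\<tau>. indicat_real {q<..t} \<tau> *\<^sub>R B0 \<tau>) \<in> borel_measurable lebesgue" for q
        by (intro borel_measurable_scaleR borel_measurable_indicator borel_measurable_integrable[OF B0]) auto
      show "(\<lambda>\<tau>. indicat_real {0<..t} \<tau> *\<^sub>R B0 \<tau>) \<in> borel_measurable lebesgue"
        "(\<lambda>\<tau>. indicat_real {r k<..t} \<tau> *\<^sub>R B0 \<tau>) \<in> borel_measurable lebesgue" for k
        by (rule m)+
      show "AE \<tau> in lebesgue. (\<lambda>k. indicat_real {r k<..t} \<tau> *\<^sub>R B0 \<tau>) \<longlonglongrightarrow> indicat_real {0<..t} \<tau> *\<^sub>R B0 \<tau>"
      proof (intro AE_I2 tendsto_scaleR tendsto_const)
        fix \<tau>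
        show "(\<lambda>k. indicat_real {r k<..t} \<tau>) \<longlonglongrightarrow> indicat_real {0<..t} \<tau>"
        proof (cases "0 < \<tau>")
          case True
          have "\<forall>\<^sub>F k in sequentially. r k < \<tau>" by (rule order_tendstoD(2)[OF r0 True])
          then have "\<forall>\<^sub>F k in sequentially. indicat_real {r k<..t} \<tau> = indicat_real {0<..t} \<tau>"
            using True by (auto elim!: eventually_mono split: split_indicator)
          then show ?thesis by (rule tendsto_eventually)
        next
          case False
          then have "indicat_real {r k<..t} \<tau> = indicat_real {0<..t} \<tau>" for k
            using r(1)[of k] by (auto split: split_indicator)
          then show ?thesis by simp
        qed
      qed
    qed (use B0 in \<open>auto split: split_indicator\<close>)
    then show ?thesis using e[OF less_imp_le[OF r(1)]] e[of 0] by simp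
  qed
  ultimately show ?thesis
    unfolding eq True by (rule LIMSEQ_unique)
qed (use weak_derivative_FTC_pos[OF A B weak] st in auto)

section \<open>Continuity of translation\<close>

text \<open>
  Squeeze \<open>A\<close> between a compact set \<open>F\<close> and an open set \<open>V\<close> whose difference \<open>W\<close> has small measure. If \<open>y\<close>
  is so short that \<open>F\<close> shifted by \<open>y\<close> or \<open>-y\<close> stays inside \<open>V\<close>, then every point that belongs to exactly
  one of \<open>A\<close> and \<open>A + y\<close> lies in \<open>W\<close> or in \<open>W + y\<close>.
\<close>
lemma translation_indicator_bound:
  fixes A :: "'a::euclidean_space set"
  assumes A: "A \<in> sets borel" "bounded A" and e: "e > 0"
  obtains d where "d > 0" "\<And>y. norm y < d \<Longrightarrow> (\<integral>z. \<bar>indicator A (z - y) - indicat_real A z\<bar> \<partial>lborel) \<le> e"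
proof -
  have AL: "A \<in> sets lebesgue" using A by simp
  obtain V where V: "open V" "A \<subseteq> V" "V - A \<in> lmeasurable" "emeasure lebesgue (V - A) < ennreal (e / 4)"
    using sets_lebesgue_outer_open[OF AL, of "e / 4"] e by auto
  obtain F where F: "closed F" "F \<subseteq> A" "A - F \<in> lmeasurable" "emeasure lebesgue (A - F) < ennreal (e / 4)"
    using sets_lebesgue_inner_closed[OF AL, of "e / 4"] e by auto
  have "compact F" using F A bounded_subset by (auto simp: compact_eq_bounded_closed)
  then obtain d where d: "d > 0" "(\<Union>x\<in>F. ball x d) \<subseteq> V"
    using compact_subset_open_imp_ball_epsilon_subset[of F V] V F by blast
  define W where "W = V - F"
  have Wb: "W \<in> sets borel" using V F by (auto simp: W_def)
  have Wm: "emeasure lborel W < ennreal (e / 2)"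
  proof -
    have "W = (V - A) \<union> (A - F)" using V F by (auto simp: W_def)
    then have "emeasure lborel W \<le> emeasure lebesgue (V - A) + emeasure lebesgue (A - F)"
      using emeasure_subadditive[of "V - A" lebesgue "A - F"] V F Wb by (simp add: fmeasurableD)
    also have "\<dots> < ennreal (e / 4) + ennreal (e / 4)"
      using V(4) F(4) by (rule add_strict_mono)
    also have "\<dots> = ennreal (e / 2)" using e by (simp flip: ennreal_plus)
    finally show ?thesis .
  qed
  have Wi: "integrable lborel (indicat_real W)"
    using Wb Wm by (intro integrable_real_indicator) (auto intro: less_trans)
  have Wint: "(\<integral>z. indicat_real W z \<partial>lborel) \<le> e / 2"
  proof -
    have "measure lborel W \<le> e / 2"
      unfolding measure_def by (rule enn2real_leI) (use Wm e in auto)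
    then show ?thesis using Wb by simp
  qed
  note sh = lborel_translate[OF Wi]
  show thesis
  proof
    show "d > 0" by fact
    fix y :: 'a assume y: "norm y < d"
    have pw: "\<bar>indicator A (z - y) - indicat_real A z\<bar> \<le> indicat_real W z + indicat_real W (z - y)" for z
    proof -
      have 1: "z \<in> V" if "z - y \<in> F"
      proof -
        have "z \<in> ball (z - y) d" using y by (simp add: dist_norm norm_minus_commute)
        then show ?thesis using d(2) that by blast
      qed
      have 2: "z - y \<in> V" if "z \<in> F"
      proof -
        have "z - y \<in> ball z d" using y by (simp add: dist_norm)
        then show ?thesis using d(2) that by blast
      qed
      show ?thesis
        using 1 2 V(2) F(2) by (auto simp: W_def split: split_indicator)
    qed
    have "(\<integral>z. \<bar>indicator A (z - y) - indicat_real A z\<bar> \<partial>lborel) \<le> (\<integral>z. indicat_real W z + indicat_real W (z - y) \<partial>lborel)"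
      by (rule integral_mono_AE') (use Wi sh pw in \<open>auto intro!: AE_I2\<close>)
    also have "\<dots> \<le> e" using Wi sh Wint by simp
    finally show "(\<integral>z. \<bar>indicator A (z - y) - indicat_real A z\<bar> \<partial>lborel) \<le> e" .
  qed
qed

text \<open>
  Wherever \<open>s\<close> and its translate differ, so do the indicators of some nonzero level set and its translate. There
  are finitely many such level sets, all of them bounded.
\<close>
lemma translation_simple_bound:
  fixes s :: "'a::euclidean_space \<Rightarrow> 'b::euclidean_space"
  assumes s: "simple_function lborel s" and bd: "bounded {z. s z \<noteq> 0}" and e: "e > 0" and p: "1 < p"
  obtains d where "d > 0" "\<And>y. norm y < d \<Longrightarrow> (\<integral>z. norm (s (z - y) - s z) powr p \<partial>lborel) \<le> e"
proof -
  define C where "C = range s - {0}"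
  have finC: "finite C" using simple_functionD(1)[OF s] by (simp add: C_def)
  obtain M where M: "\<And>z. norm (s z) \<le> M" "M \<ge> 0"
  proof -
    have "finite (norm ` range s)" using simple_functionD(1)[OF s] by simp
    then have "norm (s z) \<le> Max (norm ` range s)" for z by (intro Max_ge) auto
    then show thesis using that[of "Max (norm ` range s)"] order_trans[OF norm_ge_zero] by blast
  qed
  define A where "A c = s -` {c}" for c
  have A: "A c \<in> sets borel" "c \<in> C \<Longrightarrow> bounded (A c)" for c
  proof -
    show "A c \<in> sets borel" using simple_functionD(2)[OF s, of "{c}"] by (simp add: A_def)
    show "bounded (A c)" if "c \<in> C"
      by (rule bounded_subset[OF bd]) (use that in \<open>auto simp: A_def C_def\<close>)
  qed
  \<comment> \<open>The summand \<open>1\<close> keeps \<open>K\<close> positive when \<open>C\<close> is empty or \<open>M = 0\<close>.\<close>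
  define K where "K = (2 * M) powr p * real (card C) + 1"
  have K: "K > 0" by (simp add: K_def add_nonneg_pos)
  have "\<exists>d>0. \<forall>y. norm y < d \<longrightarrow> (\<integral>z. \<bar>indicator (A c) (z - y) - indicat_real (A c) z\<bar> \<partial>lborel) \<le> e / K" if "c \<in> C" for c
    using translation_indicator_bound[OF A(1) A(2)[OF that], of "e / K"] e K by (metis divide_pos_pos)
  then have "\<exists>d. \<forall>c\<in>C. d c > 0 \<and> (\<forall>y. norm y < d c \<longrightarrow> (\<integral>z. \<bar>indicator (A c) (z - y) - indicat_real (A c) z\<bar> \<partial>lborel) \<le> e / K)"
    by (intro bchoice ballI) blast
  then obtain d where d: "\<And>c. c \<in> C \<Longrightarrow> d c > 0"
    "\<And>c y. c \<in> C \<Longrightarrow> norm y < d c \<Longrightarrow> (\<integral>z. \<bar>indicator (A c) (z - y) - indicat_real (A c) z\<bar> \<partial>lborel) \<le> e / K"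
    by blast
  \<comment> \<open>The \<open>1\<close> covers the case that \<open>s\<close> vanishes identically and \<open>C\<close> is empty.\<close>
  define \<delta> where "\<delta> = Min (insert 1 (d ` C))"
  have \<delta>: "\<delta> > 0" "\<And>c. c \<in> C \<Longrightarrow> \<delta> \<le> d c" using finC d(1) by (auto simp: \<delta>_def)
  show thesis
  proof
    show "\<delta> > 0" by fact
    fix y :: 'a assume y: "norm y < \<delta>"
    have Ai: "integrable lborel (indicat_real (A c))" if "c \<in> C" for c
      using A(1)[of c] emeasure_bounded_finite[OF A(2)[OF that]] by (intro integrable_real_indicator) auto
    have ii: "integrable lborel (\<lambda>z. \<bar>indicat_real (A c) (z - y) - indicat_real (A c) z\<bar>)" if "c \<in> C" for c
      using Ai[OF that] lborel_translate(1)[OF Ai[OF that], of y] by simp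
    have pw: "norm (s (z - y) - s z) powr p \<le> (2 * M) powr p * (\<Sum>c\<in>C. \<bar>indicat_real (A c) (z - y) - indicat_real (A c) z\<bar>)" for z
    proof (cases "s (z - y) = s z")
      case True
      then show ?thesis using p by (auto intro!: mult_nonneg_nonneg sum_nonneg)
    next
      case False
      obtain c where c: "c \<in> C" "\<bar>indicat_real (A c) (z - y) - indicat_real (A c) z\<bar> = 1"
      proof (cases "s z = 0")
        case True
        then show thesis using that[of "s (z - y)"] False by (auto simp: C_def A_def indicator_def)
      next
        case nz: False
        then show thesis using that[of "s z"] False by (auto simp: C_def A_def indicator_def)
      qed
      have "1 \<le> (\<Sum>c\<in>C. \<bar>indicat_real (A c) (z - y) - indicat_real (A c) z\<bar>)"
        using member_le_sum[OF c(1), of "\<lambda>c. \<bar>indicat_real (A c) (z - y) - indicat_real (A c) z\<bar>"] finC c(2) by auto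
      moreover have "norm (s (z - y) - s z) powr p \<le> (2 * M) powr p"
        using norm_triangle_ineq4[of "s (z - y)" "s z"] M(1)[of z] M(1)[of "z - y"] p by (intro powr_mono2) auto
      ultimately show ?thesis
        using mult_mono[of "norm (s (z - y) - s z) powr p" "(2 * M) powr p" 1] by auto
    qed
    have "(\<integral>z. norm (s (z - y) - s z) powr p \<partial>lborel)
        \<le> (\<integral>z. (2 * M) powr p * (\<Sum>c\<in>C. \<bar>indicat_real (A c) (z - y) - indicat_real (A c) z\<bar>) \<partial>lborel)"
      by (rule integral_mono_AE') (use ii pw in \<open>auto intro!: AE_I2 integrable_mult_right\<close>)
    also have "\<dots> = (2 * M) powr p * (\<Sum>c\<in>C. \<integral>z. \<bar>indicat_real (A c) (z - y) - indicat_real (A c) z\<bar> \<partial>lborel)"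
      using ii by simp
    also have "\<dots> \<le> (2 * M) powr p * (\<Sum>c\<in>C. e / K)"
      using y \<delta>(2) by (intro mult_left_mono sum_mono d(2)) (auto intro: less_le_trans)
    also have "\<dots> = ((2 * M) powr p * real (card C)) * (e / K)" by simp
    also have "\<dots> \<le> K * (e / K)" using e K by (intro mult_right_mono) (auto simp: K_def)
    also have "\<dots> = e" using K by simp
    finally show "(\<integral>z. norm (s (z - y) - s z) powr p \<partial>lborel) \<le> e" .
  qed
qed

lemma Lp_translation_continuous:
  fixes f :: "'a::euclidean_space \<Rightarrow> 'b::euclidean_space"
  assumes p: "1 < p" and fm[measurable]: "f \<in> borel_measurable borel" and fi: "integrable lborel (\<lambda>z. norm (f z) powr p)"
    and bd: "bounded {z. f z \<noteq> 0}"
  shows "((\<lambda>y. \<integral>z. norm (f (z - y) - f z) powr p \<partial>lborel) \<longlongrightarrow> 0) (at 0)"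
proof (rule tendstoI)
  fix e :: real assume e: "e > 0"
  obtain F where F: "\<And>i. simple_function lborel (F i)" "\<And>z. (\<lambda>i. F i z) \<longlonglongrightarrow> f z"
    "\<And>i z. dist (F i z) 0 \<le> 2 * dist (f z) 0"
    using borel_measurable_implies_sequence_metric[of f lborel 0] fm by auto
  have F0: "norm (F i z) \<le> 2 * norm (f z)" for i z using F(3)[of i z] by (simp add: dist_norm)
  have Fm[measurable]: "F i \<in> borel_measurable borel" for i
    using borel_measurable_simple_function[OF F(1)] by simp
  have dom: "norm (F i z - f z) powr p \<le> 3 powr p * norm (f z) powr p" for i z
  proof -
    have "norm (F i z - f z) \<le> 3 * norm (f z)" using norm_triangle_ineq4[of "F i z" "f z"] F0[of i z] by simp
    then have "norm (F i z - f z) powr p \<le> (3 * norm (f z)) powr p" using p by (intro powr_mono2) auto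
    then show ?thesis by (simp add: powr_mult)
  qed
  have "(\<lambda>i. \<integral>z. norm (F i z - f z) powr p \<partial>lborel) \<longlonglongrightarrow> (\<integral>z. 0 \<partial>(lborel :: 'a measure))"
  proof (rule integral_dominated_convergence[where w = "\<lambda>z. 3 powr p * norm (f z) powr p"])
    show "AE z in lborel. (\<lambda>i. norm (F i z - f z) powr p) \<longlonglongrightarrow> 0"
    proof (intro AE_I2)
      fix z
      have "(\<lambda>i. norm (F i z - f z)) \<longlonglongrightarrow> 0" using F(2)[of z] by (simp add: LIM_zero tendsto_norm_zero)
      then have "(\<lambda>i. norm (F i z - f z) powr p) \<longlonglongrightarrow> 0 powr p" using p by (intro tendsto_powr') auto
      then show "(\<lambda>i. norm (F i z - f z) powr p) \<longlonglongrightarrow> 0" by simp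
    qed
  qed (use dom fi in auto)
  then have "(\<lambda>i. \<integral>z. norm (F i z - f z) powr p \<partial>lborel) \<longlonglongrightarrow> 0" by simp
  define c where "c = 2 powr p"
  have c: "c \<ge> 1" using p ge_one_powr_ge_zero[of 2 p] by (simp add: c_def)
  \<comment> \<open>Three approximation errors, multiplied by the constants from two uses of
      \<open>integral_powr_norm_add_le\<close>, must stay below \<open>e\<close>.\<close>
  define e' where "e' = e / (2 * (c * c + c * c + c + 1))"
  have e': "e' > 0" "c * (c * e' + c * e' + e') < e"
  proof -
    have pos: "c * c + c * c + c + 1 > 0" using c by (simp add: add_pos_pos)
    then show e0: "e' > 0" using e by (simp add: e'_def)
    have "c * (c * e' + c * e' + e') = (c * c + c * c + c) * e'" by (simp add: algebra_simps)
    also have "\<dots> < (2 * (c * c + c * c + c + 1)) * e'" using pos c e0 by (intro mult_strict_right_mono) auto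
    also have "\<dots> = e" using pos by (simp add: e'_def)
    finally show "c * (c * e' + c * e' + e') < e" .
  qed
  obtain i where i: "(\<integral>z. norm (F i z - f z) powr p \<partial>lborel) < e'"
    using eventually_happens'[OF sequentially_bot order_tendstoD(2)[OF \<open>(\<lambda>i. \<integral>z. norm (F i z - f z) powr p \<partial>lborel) \<longlonglongrightarrow> 0\<close> e'(1)]] by blast
  have Fbd: "bounded {z. F i z \<noteq> 0}"
  proof (rule bounded_subset[OF bd])
    show "{z. F i z \<noteq> 0} \<subseteq> {z. f z \<noteq> 0}" using F0[of i] by (metis (mono_tags, lifting) Collect_mono mult_zero_right norm_le_zero_iff norm_zero)
  qed
  obtain d where d: "d > 0" "\<And>y. norm y < d \<Longrightarrow> (\<integral>z. norm (F i (z - y) - F i z) powr p \<partial>lborel) \<le> e'"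
    using translation_simple_bound[OF F(1) Fbd e'(1) p] by blast
  have Gi: "integrable lborel (\<lambda>z. norm (F i z - f z) powr p)"
    by (rule Bochner_Integration.integrable_bound[where f = "\<lambda>z. 3 powr p * norm (f z) powr p"]) (use fi dom in auto)
  have Fi: "integrable lborel (\<lambda>z. norm (F i z) powr p)"
  proof (rule Bochner_Integration.integrable_bound[where f = "\<lambda>z. 2 powr p * norm (f z) powr p"])
    have "norm (F i z) powr p \<le> 2 powr p * norm (f z) powr p" for z
      using powr_mono2[of p "norm (F i z)" "2 * norm (f z)"] F0[of i z] p by (simp add: powr_mult)
    then show "AE z in lborel. norm (norm (F i z) powr p) \<le> norm (2 powr p * norm (f z) powr p)" by simp
  qed (use fi in auto)
  have bound: "(\<integral>z. norm (f (z - y) - f z) powr p \<partial>lborel) < e" if y: "norm y < d" for y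
  proof -
    let ?a = "\<lambda>z. f (z - y) - F i (z - y)" and ?b = "\<lambda>z. F i (z - y) - F i z" and ?c = "\<lambda>z. F i z - f z"
    note tr = lborel_translate[OF Gi, of y]
    have ai: "integrable lborel (\<lambda>z. norm (?a z) powr p)" "(\<integral>z. norm (?a z) powr p \<partial>lborel) < e'"
      using tr i by (simp_all add: norm_minus_commute)
    have bi: "integrable lborel (\<lambda>z. norm (?b z) powr p)"
      using integrable_powr_norm_lincomb[OF p _ _ lborel_translate(1)[OF Fi, of y] Fi, of 1 "-1"] by simp
    have abm: "(\<lambda>z. ?a z) \<in> borel_measurable lborel" "(\<lambda>z. ?b z) \<in> borel_measurable lborel" "(\<lambda>z. ?c z) \<in> borel_measurable lborel"
      by simp_all
    have abi: "integrable lborel (\<lambda>z. norm (?a z + ?b z) powr p)"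
      using integrable_powr_norm_lincomb[OF p abm(1,2) ai(1) bi, of 1 1] by simp
    have "(\<integral>z. norm (f (z - y) - f z) powr p \<partial>lborel) = (\<integral>z. norm ((?a z + ?b z) + ?c z) powr p \<partial>lborel)"
      by simp
    also have "\<dots> \<le> c * ((\<integral>z. norm (?a z + ?b z) powr p \<partial>lborel) + (\<integral>z. norm (?c z) powr p \<partial>lborel))"
      unfolding c_def by (rule integral_powr_norm_add_le[OF p _ abm(3) abi Gi]) simp
    also have "\<dots> \<le> c * (c * ((\<integral>z. norm (?a z) powr p \<partial>lborel) + (\<integral>z. norm (?b z) powr p \<partial>lborel)) + e')"
      using integral_powr_norm_add_le[OF p abm(1,2) ai(1) bi] c i
      by (intro mult_left_mono add_mono) (auto simp: c_def)
    also have "\<dots> \<le> c * (c * (e' + e') + e')"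
      using c ai(2) d(2)[OF y] by (intro mult_left_mono add_mono) auto
    also have "\<dots> = c * (c * e' + c * e' + e')" by (simp add: distrib_left)
    also have "\<dots> < e" by (rule e'(2))
    finally show ?thesis .
  qed
  show "\<forall>\<^sub>F y in at 0. dist (\<integral>z. norm (f (z - y) - f z) powr p \<partial>lborel) 0 < e"
    unfolding eventually_at using bound d(1)
    by (intro exI[of _ d]) (auto simp: dist_norm)
qed

section \<open>Steklov averages\<close>

lemma average_tendsto:
  fixes K :: "real \<Rightarrow> real"
  assumes K: "(K \<longlongrightarrow> L) (at 0)" and i: "\<And>h. 0 < h \<Longrightarrow> integrable lborel (\<lambda>y. indicator {0<..<h} y * K y)"
  shows "(\<lambda>k. real (Suc k) * (\<integral>y. indicator {0<..<inverse (real (Suc k))} y * K y \<partial>lborel)) \<longlonglongrightarrow> L"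
proof (rule LIMSEQ_I)
  fix e :: real assume e: "0 < e"
  obtain d where d: "d > 0" "\<And>y. y \<noteq> 0 \<Longrightarrow> \<bar>y\<bar> < d \<Longrightarrow> \<bar>K y - L\<bar> < e / 2"
    using tendstoD[OF K, of "e / 2"] e by (auto simp: eventually_at dist_real_def)
  obtain N where N: "inverse (real (Suc N)) < d" using reals_Archimedean[OF d(1)] by blast
  have "norm (real (Suc k) * (\<integral>y. indicator {0<..<inverse (real (Suc k))} y * K y \<partial>lborel) - L) < e" if k: "k \<ge> N" for k
  proof -
    define h where "h = inverse (real (Suc k))"
    have h: "h > 0" by (simp add: h_def)
    have "h \<le> inverse (real (Suc N))" using k by (simp add: h_def)
    then have hd: "h < d" using N by simp
    have ind: "integrable lborel (indicat_real {0<..<h})" "(\<integral>y. indicat_real {0<..<h} y \<partial>lborel) = h"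
      using h by simp_all
    have "\<bar>(\<integral>y. indicator {0<..<h} y * K y \<partial>lborel) - h * L\<bar> = \<bar>\<integral>y. indicator {0<..<h} y * K y - indicator {0<..<h} y * L \<partial>lborel\<bar>"
      using i[OF h] ind by simp
    also have "\<dots> \<le> (\<integral>y. indicator {0<..<h} y * (e / 2) \<partial>lborel)"
    proof (rule abs_integral_le)
      show "\<bar>indicator {0<..<h} y * K y - indicator {0<..<h} y * L\<bar> \<le> indicator {0<..<h} y * (e / 2)" for y
        using d(2)[of y] hd by (auto split: split_indicator)
    qed (use i[OF h] ind in auto)
    also have "\<dots> = h * (e / 2)" using ind by simp
    finally have "real (Suc k) * \<bar>(\<integral>y. indicator {0<..<h} y * K y \<partial>lborel) - h * L\<bar> \<le> real (Suc k) * (h * (e / 2))"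
      by (intro mult_left_mono) auto
    also have "\<dots> = e / 2" by (simp add: h_def del: of_nat_Suc)
    also have "real (Suc k) * \<bar>(\<integral>y. indicator {0<..<h} y * K y \<partial>lborel) - h * L\<bar>
        = \<bar>real (Suc k) * ((\<integral>y. indicator {0<..<h} y * K y \<partial>lborel) - h * L)\<bar>"
      by (simp add: abs_mult del: of_nat_Suc)
    also have "real (Suc k) * ((\<integral>y. indicator {0<..<h} y * K y \<partial>lborel) - h * L) = real (Suc k) * (\<integral>y. indicator {0<..<h} y * K y \<partial>lborel) - L"
      by (simp add: h_def right_diff_distrib del: of_nat_Suc)
    finally show ?thesis using e by (simp add: h_def del: of_nat_Suc)
  qed
  then show "\<exists>N. \<forall>k\<ge>N. norm (real (Suc k) * (\<integral>y. indicator {0<..<inverse (real (Suc k))} y * K y \<partial>lborel) - L) < e" by blast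
qed

lemma indicator_fst_measurable:
  "(\<lambda>z :: real \<times> 'a::euclidean_space. indicat_real {a<..<b} (fst z)) \<in> borel_measurable borel"
  "(\<lambda>z :: real \<times> 'a::euclidean_space. indicat_real {a<..b} (fst z)) \<in> borel_measurable borel"
proof -
  have m: "(\<lambda>z :: real \<times> 'a. fst z) \<in> borel_measurable borel"
    by (intro borel_measurable_continuous_onI continuous_intros)
  show "(\<lambda>z :: real \<times> 'a. indicat_real {a<..<b} (fst z)) \<in> borel_measurable borel"
    "(\<lambda>z :: real \<times> 'a. indicat_real {a<..b} (fst z)) \<in> borel_measurable borel"
    by (rule measurable_compose[OF m], simp)+
qed

lemma integrable_translates:
  fixes f :: "real \<Rightarrow> 'a::euclidean_space \<Rightarrow> 'b::euclidean_space"
  assumes m[measurable]: "(\<lambda>(y, z). f y z) \<in> borel_measurable borel"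
    and i: "\<And>y. integrable lborel (f y)" and C: "\<And>y. (\<integral>z. norm (f y z) \<partial>lborel) \<le> C" and h: "0 < h"
  shows "integrable lborel (\<lambda>(y, z). indicat_real {0<..<h} y *\<^sub>R f y z)"
proof -
  have m': "(\<lambda>(y, z). indicat_real {0<..<h} y *\<^sub>R f y z) \<in> borel_measurable (lborel \<Otimes>\<^sub>M lborel)"
  proof -
    from borel_measurable_scaleR[OF indicator_fst_measurable(1) m] show ?thesis
      unfolding lborel_prod measurable_lborel2 case_prod_beta' .
  qed
  have mn: "(\<lambda>(y, z). norm (indicat_real {0<..<h} y *\<^sub>R f y z)) \<in> borel_measurable (lborel \<Otimes>\<^sub>M lborel)"
    using measurable_compose[OF m' borel_measurable_norm] unfolding case_prod_beta' .
  have C0: "C \<ge> 0" using order_trans[OF _ C[of 0]] by simp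
  have "integrable (lborel \<Otimes>\<^sub>M lborel) (\<lambda>(y, z). indicat_real {0<..<h} y *\<^sub>R f y z)"
  proof (rule lborel_pair.Fubini_integrable[OF m'])
    have "(\<lambda>y. \<integral>z. norm (case (y, z) of (y, z) \<Rightarrow> indicat_real {0<..<h} y *\<^sub>R f y z) \<partial>lborel) \<in> borel_measurable lborel"
      unfolding prod.case by (rule lborel.borel_measurable_lebesgue_integral[OF mn])
    then show "integrable lborel (\<lambda>y. \<integral>z. norm (case (y, z) of (y, z) \<Rightarrow> indicat_real {0<..<h} y *\<^sub>R f y z) \<partial>lborel)"
    proof (rule Bochner_Integration.integrable_bound[where f = "\<lambda>y. indicat_real {0<..<h} y * C", rotated])
      show "AE y in lborel. norm (\<integral>z. norm (case (y, z) of (y, z) \<Rightarrow> indicat_real {0<..<h} y *\<^sub>R f y z) \<partial>lborel) \<le> norm (indicat_real {0<..<h} y * C)"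
        using C C0 by (intro AE_I2) (auto split: split_indicator)
      show "integrable lborel (\<lambda>y. indicat_real {0<..<h} y * C)"
        using h by (intro integrable_mult_left) simp
    qed
    show "AE y in lborel. integrable lborel (\<lambda>z. case (y, z) of (y, z) \<Rightarrow> indicat_real {0<..<h} y *\<^sub>R f y z)"
      using i by simp
  qed
  then show ?thesis by (simp add: lborel_prod)
qed

text \<open>
  \<open>M h (t, x)\<close> integrates \<open>D\<close> over the times between \<open>t - h\<close> and \<open>t\<close>. Exchanging the integrals exhibits
  the pairing as the integral over \<open>0 < y < h\<close> of the pairings \<open>K y\<close> with the translates of \<open>D\<close> by \<open>y\<close>,
  and \<open>K\<close> is continuous at \<open>0\<close> by continuity of translations.
\<close>
lemma steklov_average:
  fixes D :: "real \<times> 'a::euclidean_space \<Rightarrow> 'b::euclidean_space"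
  assumes p: "1 < p" and Dm[measurable]: "D \<in> borel_measurable borel"
    and D1: "integrable lborel D" and Dp: "integrable lborel (\<lambda>z. norm (D z) powr p)" and bd: "bounded {z. D z \<noteq> 0}"
  defines "M \<equiv> \<lambda>h z. \<integral>y. indicat_real {0<..<h} y *\<^sub>R D (z - (y, 0)) \<partial>lborel"
  shows "\<And>h. 0 < h \<Longrightarrow> integrable lborel (\<lambda>z. pflux p (D z) \<bullet> M h z)"
    "(\<lambda>k. real (Suc k) * (\<integral>z. pflux p (D z) \<bullet> M (inverse (real (Suc k))) z \<partial>lborel)) \<longlonglongrightarrow> (\<integral>z. norm (D z) powr p \<partial>lborel)"
proof -
  define K where "K y = (\<integral>z. pflux p (D z) \<bullet> D (z - (y, 0)) \<partial>lborel)" for y :: real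
  have tr1: "integrable lborel (\<lambda>z. D (z - (y, 0)))" for y by (rule lborel_translate(1)[OF D1])
  have trp: "integrable lborel (\<lambda>z. norm (D (z - (y, 0))) powr p)"
    "(\<integral>z. norm (D (z - (y, 0))) powr p \<partial>lborel) = (\<integral>z. norm (D z) powr p \<partial>lborel)" for y
    using lborel_translate[OF Dp, of "(y, 0)"] by simp_all
  have sm[measurable]: "(\<lambda>z. D (z - (y, 0))) \<in> borel_measurable borel" for y by simp
  have Dl: "D \<in> borel_measurable lborel" and sl: "(\<lambda>z. D (z - (y, 0))) \<in> borel_measurable lborel" for y by simp_all
  have Pi: "integrable lborel (\<lambda>z. pflux p (D z) \<bullet> D (z - (y, 0)))" for y
    by (rule integrable_pflux_inner(1)[OF p Dl sl Dp trp(1)])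
  have pm: "(\<lambda>(y :: real, z). D (z - (y, 0))) \<in> borel_measurable borel"
  proof -
    have "(\<lambda>q :: real \<times> (real \<times> 'a). D (snd q - (fst q, 0))) \<in> borel_measurable borel"
      by (rule measurable_compose[OF _ Dm]) (intro borel_measurable_continuous_onI continuous_intros)
    then show ?thesis by (simp add: case_prod_beta')
  qed
  have pfm: "(\<lambda>(y :: real, z). pflux p (D z) \<bullet> D (z - (y, 0))) \<in> borel_measurable borel"
  proof -
    have "(\<lambda>q :: real \<times> (real \<times> 'a). D (snd q)) \<in> borel_measurable borel"
      by (rule measurable_compose[OF _ Dm]) (intro borel_measurable_continuous_onI continuous_intros)
    from pflux_measurable[OF this, of p] pm show ?thesis
      unfolding case_prod_beta' by (rule borel_measurable_inner)
  qed
  have f2: "integrable lborel (\<lambda>(y, z). indicat_real {0<..<h} y *\<^sub>R D (z - (y, 0)))" if "0 < h" for h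
    by (rule integrable_translates[OF pm tr1 _ that, where C = "\<integral>z. norm (D z) \<partial>lborel"])
      (use lborel_translate(2)[OF integrable_norm[OF D1]] in simp)
  have f1: "integrable lborel (\<lambda>(y, z). indicat_real {0<..<h} y *\<^sub>R (pflux p (D z) \<bullet> D (z - (y, 0))))" if "0 < h" for h
  proof (rule integrable_translates[OF pfm Pi _ that])
    fix y :: real
    have "(\<integral>z. norm (pflux p (D z) \<bullet> D (z - (y, 0))) \<partial>lborel)
        \<le> (\<integral>z. (p - 1) / p * norm (D z) powr p + norm (D (z - (y, 0))) powr p / p \<partial>lborel)"
    proof (rule integral_mono)
      show "norm (pflux p (D z) \<bullet> D (z - (y, 0))) \<le> (p - 1) / p * norm (D z) powr p + norm (D (z - (y, 0))) powr p / p" for z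
        using order_trans[OF pflux_inner_le young_powr[OF p norm_ge_zero norm_ge_zero]] by simp
    qed (use Pi Dp trp in auto)
    also have "\<dots> = (p - 1) / p * (\<integral>z. norm (D z) powr p \<partial>lborel) + (\<integral>z. norm (D z) powr p \<partial>lborel) / p"
      using Dp trp by simp
    finally show "(\<integral>z. norm (pflux p (D z) \<bullet> D (z - (y, 0))) \<partial>lborel)
      \<le> (p - 1) / p * (\<integral>z. norm (D z) powr p \<partial>lborel) + (\<integral>z. norm (D z) powr p \<partial>lborel) / p" .
  qed
  have ae: "AE z in lborel. (\<integral>y. indicat_real {0<..<h} y *\<^sub>R (pflux p (D z) \<bullet> D (z - (y, 0))) \<partial>lborel) = pflux p (D z) \<bullet> M h z" if h: "0 < h" for h
    using lborel_Fubini_swap(1)[OF f2[OF h]]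
  proof eventually_elim
    case (elim z)
    have "(\<integral>y. pflux p (D z) \<bullet> (indicat_real {0<..<h} y *\<^sub>R D (z - (y, 0))) \<partial>lborel) = pflux p (D z) \<bullet> M h z"
      unfolding M_def by (rule integral_inner_right) (use elim in simp)
    then show ?case by simp
  qed
  have Mm: "M h \<in> borel_measurable lborel" if h: "0 < h" for h
    using borel_measurable_integrable[OF lborel_Fubini_swap(2)[OF f2[OF h]]] by (simp add: M_def)
  have Mi: "integrable lborel (\<lambda>z. pflux p (D z) \<bullet> M h z) \<and>
      (\<integral>z. pflux p (D z) \<bullet> M h z \<partial>lborel) = (\<integral>y. indicat_real {0<..<h} y * K y \<partial>lborel)
      \<and> integrable lborel (\<lambda>y. indicat_real {0<..<h} y * K y)" if h: "0 < h" for h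
  proof -
    note sw = lborel_Fubini_swap(2,3)[OF f1[OF h], unfolded prod.case]
    note fu = lborel_Fubini(2,3)[OF f1[OF h], unfolded prod.case]
    have m2: "(\<lambda>z. pflux p (D z) \<bullet> M h z) \<in> borel_measurable lborel"
      by (intro borel_measurable_inner pflux_measurable[OF Dl] Mm h)
    have 1: "integrable lborel (\<lambda>z. pflux p (D z) \<bullet> M h z)"
      using integrable_cong_AE[OF borel_measurable_integrable[OF sw(1)] m2 ae[OF h]] sw(1) by simp
    have "(\<integral>z. pflux p (D z) \<bullet> M h z \<partial>lborel) = (\<integral>z. (\<integral>y. indicat_real {0<..<h} y *\<^sub>R (pflux p (D z) \<bullet> D (z - (y, 0))) \<partial>lborel) \<partial>lborel)"
      using ae[OF h] by (intro integral_cong_AE[OF m2 borel_measurable_integrable[OF sw(1)]]) (auto elim!: eventually_mono)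
    also have "\<dots> = (\<integral>y. (\<integral>z. indicat_real {0<..<h} y *\<^sub>R (pflux p (D z) \<bullet> D (z - (y, 0))) \<partial>lborel) \<partial>lborel)"
      unfolding sw(2) fu(2) ..
    finally show ?thesis using 1 fu(1) by (simp add: K_def)
  qed
  show "integrable lborel (\<lambda>z. pflux p (D z) \<bullet> M h z)" if "0 < h" for h using Mi[OF that] by blast
  have "((\<lambda>y. \<integral>z. norm (D (z - (y, 0)) - D z) powr p \<partial>lborel) \<longlongrightarrow> 0) (at (0 :: real))"
  proof (rule filterlim_compose[OF Lp_translation_continuous[OF p Dm Dp bd]])
    have "((\<lambda>y :: real. (y, 0 :: 'a)) \<longlongrightarrow> (0, 0)) (at 0)" by (intro tendsto_intros)
    then show "filterlim (\<lambda>y :: real. (y, 0 :: 'a)) (at 0) (at 0)"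
      by (auto simp: filterlim_at zero_prod_def eventually_at intro!: exI[of _ 1])
  qed
  from integral_pflux_inner_tendsto[OF p Dl sl Dl Dp trp(1) Dp this]
  have "(K \<longlongrightarrow> (\<integral>z. norm (D z) powr p \<partial>lborel)) (at 0)"
    unfolding K_def by (simp add: pflux_inner_self)
  from average_tendsto[OF this] Mi
  have "(\<lambda>k. real (Suc k) * (\<integral>y. indicator {0<..<inverse (real (Suc k))} y * K y \<partial>lborel)) \<longlonglongrightarrow> (\<integral>z. norm (D z) powr p \<partial>lborel)" by blast
  moreover have "(\<integral>y. indicator {0<..<inverse (real (Suc k))} y * K y \<partial>lborel) = (\<integral>z. pflux p (D z) \<bullet> M (inverse (real (Suc k))) z \<partial>lborel)" for k
    using Mi[of "inverse (real (Suc k))"] by simp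
  ultimately show "(\<lambda>k. real (Suc k) * (\<integral>z. pflux p (D z) \<bullet> M (inverse (real (Suc k))) z \<partial>lborel)) \<longlonglongrightarrow> (\<integral>z. norm (D z) powr p \<partial>lborel)"
    by simp
qed

section \<open>Weak solutions\<close>

lemma AE_real_interval_obtain:
  assumes ae: "AE t in lebesgue_on {0..T}. P t" and ab: "0 \<le> a" "a < b" "b \<le> T"
  obtains x where "a < x" "x < (b::real)" "P x"
proof -
  have "\<not> (AE t in lebesgue. t \<notin> {a<..<b})"
  proof
    assume "AE t in lebesgue. t \<notin> {a<..<b}"
    then have "{a<..<b} \<in> null_sets lebesgue"
      using AE_iff_null_sets[of "{a<..<b}" lebesgue] by simp
    then have "emeasure lborel {a<..<b} = 0" by (simp add: null_sets_def)
    then show False using ab by simp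
  qed
  moreover have "AE t in lebesgue. t \<notin> {a<..<b}" if no: "\<And>x. a < x \<Longrightarrow> x < b \<Longrightarrow> \<not> P x"
  proof -
    have "AE t in lebesgue. t \<in> {0..T} \<longrightarrow> P t"
      using ae by (simp add: AE_restrict_space_iff)
    then show ?thesis
      by eventually_elim (use no ab in auto)
  qed
  ultimately show thesis using that by blast
qed

text \<open>
  Every subinterval has positive measure, so it meets a set of full measure.
\<close>
lemma AE_interval_sequence:
  assumes ae: "AE t in lebesgue_on {0..T}. P t" and t: "0 \<le> t" "t \<le> T" "0 < T"
  obtains x where "\<And>k. x k \<in> {0..T}" "\<And>k. P (x k)" "x \<longlonglongrightarrow> (t::real)"
proof -
  have "\<exists>x. x \<in> {0..T} \<and> P x \<and> \<bar>x - t\<bar> \<le> inverse (real (Suc k))" for k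
  proof -
    have e: "inverse (real (Suc k)) > 0" by simp
    show ?thesis
    proof (cases "t < T")
      case True
      obtain x where "t < x" "x < min T (t + inverse (real (Suc k)))" "P x"
        by (rule AE_real_interval_obtain[OF ae t(1), of "min T (t + inverse (real (Suc k)))"]) (use True e in auto)
      then show ?thesis using t by (intro exI[of _ x]) auto
    next
      case False
      obtain x where "max 0 (t - inverse (real (Suc k))) < x" "x < t" "P x"
        by (rule AE_real_interval_obtain[OF ae, of "max 0 (t - inverse (real (Suc k)))" t]) (use False t e in auto)
      then show ?thesis using t by (intro exI[of _ x]) auto
    qed
  qed
  then obtain x where x: "\<And>k. x k \<in> {0..T}" "\<And>k. P (x k)" "\<And>k. \<bar>x k - t\<bar> \<le> inverse (real (Suc k))"
    by metis
  have "(\<lambda>k. x k - t) \<longlonglongrightarrow> 0"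
    by (rule Lim_null_comparison[OF always_eventually LIMSEQ_inverse_real_of_nat]) (use x(3) in auto)
  then show thesis using that[of x] x by (simp add: LIM_zero_iff)
qed

locale weak_flow =
  fixes \<Omega> :: "(real^'n) set" and p :: real and g :: "real^'n \<Rightarrow> real^'m" and v :: "real \<Rightarrow> real^'n \<Rightarrow> real^'m"
  assumes domain: "bounded_smooth_domain \<Omega>" and p: "1 < p" and g: "g \<in> W01p p \<Omega>" and sol: "weak_solution p \<Omega> g v"
begin

lemma open_dom: "open \<Omega>" and bounded_dom: "bounded \<Omega>"
  using domain by (auto simp: bounded_smooth_domain_def)

lemma lmeasurable_dom: "\<Omega> \<in> lmeasurable" and lebesgue_dom: "\<Omega> \<in> sets lebesgue"
  using open_dom bounded_dom lmeasurable_open by auto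

abbreviation vt :: "real \<Rightarrow> real^'n \<Rightarrow> real^'m" where "vt \<equiv> weak_dt \<Omega> v"

definition E :: "real \<Rightarrow> real" where "E t = energy p \<Omega> (v t)"

lemma dt: "has_weak_dt \<Omega> v vt"
  using sol unfolding weak_solution_def weak_dt_def by (metis (mono_tags, lifting) someI_ex)

lemma vt_Lp: "0 < T \<Longrightarrow> (\<lambda>(t, x). vt t x) \<in> Lp p ({0<..<T} \<times> \<Omega>)"
  using sol by (simp add: weak_solution_def)

lemma v_Lp: "0 \<le> t \<Longrightarrow> v t \<in> Lp p \<Omega>"
  using sol by (simp add: weak_solution_def cont_Lp_def)

lemma v_tendsto:
  assumes x: "x \<longlonglongrightarrow> t" "\<And>k. 0 \<le> x k"
  shows "(\<lambda>k. Lp_mass p \<Omega> (\<lambda>y. v (x k) y - v t y)) \<longlonglongrightarrow> 0"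
proof -
  have t: "0 \<le> t" using LIMSEQ_le_const[OF x(1)] x(2) by blast
  define F where "F s = Lp_mass p \<Omega> (\<lambda>y. v s y - v t y)" for s
  have "F t = 0" by (simp add: F_def Lp_mass_def)
  moreover have "(F \<longlongrightarrow> 0) (at t within {0..})"
    using sol t unfolding weak_solution_def cont_Lp_def F_def Lp_mass_def by blast
  ultimately have "continuous (at t within {0..}) F" by (simp add: continuous_within)
  then have "(\<lambda>k. F (x k)) \<longlonglongrightarrow> F t"
    using x by (intro continuous_within_tendsto_compose'[of t "{0..}" F]) auto
  then have "(\<lambda>k. F (x k)) \<longlonglongrightarrow> 0" by (simp only: \<open>F t = 0\<close>)
  then show ?thesis unfolding F_def .
qed

text \<open>
  The definition of a weak solution bounds the energy at almost every time. An arbitrary time is a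
  limit of such times, and \<open>v\<close> is continuous into \<open>L^p\<close>, so weak closedness carries the bound over.
\<close>
lemma energy_bound:
  assumes T: "0 < T"
  obtains C where "\<And>t. t \<in> {0..T} \<Longrightarrow> v t \<in> W01p p \<Omega>" "\<And>t. t \<in> {0..T} \<Longrightarrow> E t \<le> C"
proof -
  have L: "v \<in> Linf_W01p p \<Omega> T" using sol T by (simp add: weak_solution_def)
  then obtain C where C: "AE t in lebesgue_on {0..T}. W1p_norm p \<Omega> (v t) \<le> C" by (auto simp: Linf_W01p_def)
  have "AE t in lebesgue_on {0..T}. v t \<in> W01p p \<Omega>" using L by (simp add: Linf_W01p_def)
  with C have ae: "AE t in lebesgue_on {0..T}. v t \<in> W01p p \<Omega> \<and> E t \<le> \<bar>C\<bar> powr p"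
  proof eventually_elim
    case (elim t)
    have "Lp_mass p \<Omega> (v t) + E t = ((Lp_mass p \<Omega> (v t) + E t) powr (1 / p)) powr p"
      using p by (simp add: powr_powr E_def add_nonneg_nonneg)
    also have "(Lp_mass p \<Omega> (v t) + E t) powr (1 / p) = W1p_norm p \<Omega> (v t)"
      by (simp add: W1p_norm_def Lp_mass_def E_def energy_def)
    also have "W1p_norm p \<Omega> (v t) powr p \<le> \<bar>C\<bar> powr p"
      using elim p by (intro powr_mono2) (auto simp: W1p_norm_def)
    finally show ?case using elim Lp_mass_nonneg[of p \<Omega> "v t"] by linarith
  qed
  have "v t \<in> W01p p \<Omega> \<and> E t \<le> \<bar>C\<bar> powr p" if t: "t \<in> {0..T}" for t
  proof -
    obtain x where x: "\<And>k. x k \<in> {0..T}" "\<And>k. v (x k) \<in> W01p p \<Omega> \<and> E (x k) \<le> \<bar>C\<bar> powr p" "x \<longlonglongrightarrow> t"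
      by (rule AE_interval_sequence[OF ae]) (use t T in auto)
    show ?thesis
      using W01p_weakly_closed[OF open_dom lmeasurable_dom p, of "\<lambda>k. v (x k)" "\<bar>C\<bar> powr p" "v t"] x v_tendsto[OF x(3)] v_Lp[of t] t
      unfolding E_def by auto
  qed
  then show thesis using that by blast
qed

lemma v_W01p: "0 \<le> t \<Longrightarrow> v t \<in> W01p p \<Omega>"
  by (rule energy_bound[of "t + 1"]) auto

lemma E_lsc:
  assumes "x \<longlonglongrightarrow> t" "\<And>k. 0 \<le> x k" "\<And>k. E (x k) \<le> a"
  shows "E t \<le> a"
proof -
  have t: "0 \<le> t" using LIMSEQ_le_const[OF assms(1)] assms(2) by blast
  have "energy p \<Omega> (v (x k)) \<le> a" for k using assms(3) by (simp add: E_def)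
  from W01p_weakly_closed(2)[OF open_dom lmeasurable_dom p v_W01p[OF assms(2)] this v_Lp[OF t] v_tendsto[OF assms(1,2)]]
  show ?thesis unfolding E_def .
qed

lemma E_lsc_left:
  assumes r: "0 < r" and e: "0 < e"
  shows "\<exists>d>0. d < r \<and> (\<forall>t. r - d < t \<longrightarrow> t \<le> r \<longrightarrow> E r - e < E t)"
proof (rule ccontr)
  assume "\<not> ?thesis"
  then have "\<forall>d>0. d < r \<longrightarrow> (\<exists>t. r - d < t \<and> t \<le> r \<and> \<not> E r - e < E t)"
    by blast
  then have "\<exists>t. r - d < t \<and> t \<le> r \<and> E t \<le> E r - e" if "0 < d" "d < r" for d
    using that by (simp add: not_less)
  moreover have "0 < r * inverse (real (Suc (Suc k)))" "r * inverse (real (Suc (Suc k))) < r" for k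
  proof -
    show "0 < r * inverse (real (Suc (Suc k)))" using r by simp
    have "inverse (real (Suc (Suc k))) < 1" by (simp add: field_simps)
    from mult_strict_left_mono[OF this r] show "r * inverse (real (Suc (Suc k))) < r" by simp
  qed
  ultimately have "\<exists>t. r - r * inverse (real (Suc (Suc k))) < t \<and> t \<le> r \<and> E t \<le> E r - e" for k by blast
  then obtain x where x: "\<And>k. r - r * inverse (real (Suc (Suc k))) < x k" "\<And>k. x k \<le> r" "\<And>k. E (x k) \<le> E r - e" by metis
  have "(\<lambda>k. r - r * inverse (real (Suc (Suc k)))) \<longlonglongrightarrow> r - r * 0"
    by (intro tendsto_intros LIMSEQ_Suc[OF LIMSEQ_inverse_real_of_nat])
  then have l: "(\<lambda>k. r - r * inverse (real (Suc (Suc k)))) \<longlonglongrightarrow> r" by simp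
  have "x \<longlonglongrightarrow> r"
  proof (rule tendsto_sandwich[OF _ _ l tendsto_const])
    show "\<forall>\<^sub>F k in sequentially. r - r * inverse (real (Suc (Suc k))) \<le> x k"
      by (intro always_eventually allI less_imp_le x(1))
    show "\<forall>\<^sub>F k in sequentially. x k \<le> r"
      by (intro always_eventually allI x(2))
  qed
  moreover have "0 \<le> x k" for k
    using x(1)[of k] \<open>\<And>k. r * inverse (real (Suc (Suc k))) < r\<close>[of k] by linarith
  ultimately have "E r \<le> E r - e" using E_lsc[of x r] x(3) by blast
  then show False using e by simp
qed

text \<open>
  Sublevel sets are closed because \<open>E\<close> is lower semicontinuous. Freezing the time at \<open>s\<close> corresponds to
  extending the solution by the constant value \<open>v s\<close> to earlier times.
\<close>
lemma E_measurable:
  assumes "0 \<le> s"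
  shows "(\<lambda>\<tau>. E (max s \<tau>)) \<in> borel_measurable borel"
proof -
  have "closed {\<tau>. E (max s \<tau>) \<le> a}" for a
    unfolding closed_sequential_limits
  proof (intro allI impI, elim conjE)
    fix x l assume x: "\<forall>n. x n \<in> {\<tau>. E (max s \<tau>) \<le> a}" "x \<longlonglongrightarrow> l"
    have "(\<lambda>n. max s (x n)) \<longlonglongrightarrow> max s l" by (intro tendsto_max tendsto_const x(2))
    then show "l \<in> {\<tau>. E (max s \<tau>) \<le> a}" using E_lsc[of "\<lambda>n. max s (x n)" "max s l" a] x(1) assms by auto
  qed
  then show ?thesis by (intro borel_measurable_iff_le[THEN iffD2]) (auto intro: borel_closed)
qed

end

context weak_flow
begin

lemma finite_dom: "finite_measure (lebesgue_on \<Omega>)"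
  by (rule finite_measure_lebesgue_on[OF lmeasurable_dom])

text \<open>
  A Borel representative of the time derivative, to which product measure applies. Cutting it
  off outside a bounded set makes it integrable.
\<close>
lemma dt_borel:
  assumes T: "0 < T"
  obtains D :: "real \<times> (real^'n) \<Rightarrow> real^'m" where
    "D \<in> borel_measurable borel" "\<forall>z. z \<notin> {0<..<T} \<times> \<Omega> \<longrightarrow> D z = 0" "integrable lborel D"
    "integrable lborel (\<lambda>z. norm (D z) powr p)"
    "AE t in lborel. t \<in> {0<..<T} \<longrightarrow> (AE x in lebesgue_on \<Omega>. vt t x = D (t, x))"
proof -
  define Q where "Q = {0<..<T} \<times> \<Omega>"
  have Qo: "open Q" unfolding Q_def by (intro open_Times open_dom) simp
  have QB: "Q \<in> sets borel" "Q \<in> sets lebesgue" using Qo by auto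
  have Qb: "bounded Q" unfolding Q_def by (intro bounded_Times bounded_dom) simp
  have Qi: "integrable lborel (indicat_real Q)"
    using QB emeasure_bounded_finite[OF Qb] by (intro integrable_real_indicator) auto
  define f where "f = (\<lambda>z. if z \<in> Q then (case z of (t, x) \<Rightarrow> vt t x) else 0)"
  have L: "(\<lambda>(t, x). vt t x) \<in> Lp p Q" unfolding Q_def by (rule vt_Lp[OF T])
  have fm: "f \<in> borel_measurable lebesgue"
    unfolding f_def by (rule borel_measurable_if_I[OF LpD(1)[OF L] QB(2)])
  obtain h where h: "h \<in> borel_measurable borel" "AE z in lborel. f z = h z"
    using lebesgue_ex_borel_measurable[OF fm] by blast
  define D where "D = (\<lambda>z. indicat_real Q z *\<^sub>R h z)"
  have Dm: "D \<in> borel_measurable borel" unfolding D_def using h(1) QB(1) by simp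
  have D0: "D z = 0" if "z \<notin> {0<..<T} \<times> \<Omega>" for z using that by (simp add: D_def Q_def)
  have D0': "\<forall>z. z \<notin> {0<..<T} \<times> \<Omega> \<longrightarrow> D z = 0" using D0 by blast
  have fD: "AE z in lborel. f z = D z"
    using h(2) by eventually_elim (auto simp: D_def f_def split: split_indicator)
  have Dp: "integrable lborel (\<lambda>z. norm (D z) powr p)"
  proof -
    have "integrable lebesgue (\<lambda>z. if z \<in> Q then norm (case z of (t, x) \<Rightarrow> vt t x) powr p else 0)"
      using LpD(2)[OF L] by (intro iffD2[OF Lebesgue_Measure.integrable_restrict_UNIV[OF QB(2)]])
    also have "(\<lambda>z. if z \<in> Q then norm (case z of (t, x) \<Rightarrow> vt t x) powr p else 0) = (\<lambda>z. norm (f z) powr p)"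
      using p by (auto simp: f_def)
    finally have fi: "integrable lebesgue (\<lambda>z. norm (f z) powr p)" .
    have Dm': "(\<lambda>z. norm (D z) powr p) \<in> borel_measurable lborel" using Dm by simp
    have "AE z in lebesgue. norm (f z) powr p = norm (D z) powr p"
      using AE_completion[OF fD] by (auto elim!: eventually_mono)
    from integrable_cong_AE[OF borel_measurable_integrable[OF fi] measurable_completion[OF Dm'] this]
    have "integrable lebesgue (\<lambda>z. norm (D z) powr p)" using fi by simp
    then show ?thesis using integrable_completion[OF Dm'] by simp
  qed
  have D1: "integrable lborel D"
  proof (rule Bochner_Integration.integrable_bound[where f = "\<lambda>z. indicat_real Q z + norm (D z) powr p"])
    show "integrable lborel (\<lambda>z. indicat_real Q z + norm (D z) powr p)" using Qi Dp by simp
    show "AE z in lborel. norm (D z) \<le> norm (indicat_real Q z + norm (D z) powr p)"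
    proof (intro AE_I2)
      fix z
      show "norm (D z) \<le> norm (indicat_real Q z + norm (D z) powr p)"
        using norm_le_eps_powr[OF p, of 1 "norm (D z)"] by (cases "z \<in> Q") (auto simp: D_def)
    qed
  qed (use Dm in simp)
  have "AE t in lborel. t \<in> {0<..<T} \<longrightarrow> (AE x in lebesgue_on \<Omega>. vt t x = D (t, x))"
    using AE_lborel_Pair[OF fD]
  proof eventually_elim
    case (elim t)
    show ?case
    proof
      assume t: "t \<in> {0<..<T}"
      have "AE x in lebesgue. f (t, x) = D (t, x)" by (rule AE_completion[OF elim])
      then have "AE x in lebesgue. x \<in> \<Omega> \<longrightarrow> vt t x = D (t, x)"
        by eventually_elim (use t in \<open>auto simp: f_def Q_def\<close>)
      then show "AE x in lebesgue_on \<Omega>. vt t x = D (t, x)"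
        using lebesgue_dom by (simp add: AE_restrict_space_iff)
    qed
  qed
  then show thesis by (rule that[OF Dm D0' D1 Dp])
qed

lemma pairing_continuous:
  assumes \<psi>: "test_fun \<Omega> (\<psi> :: real^'n \<Rightarrow> real)"
  shows "continuous_on {0..} (\<lambda>t. \<integral>x. \<psi> x *\<^sub>R v t x \<partial>lebesgue_on \<Omega>)"
  unfolding continuous_on_sequentially comp_def
proof (intro ballI allI impI, elim conjE)
  fix x t assume t: "t \<in> {0..}" and x: "\<forall>n. x n \<in> {0..}" "x \<longlonglongrightarrow> (t :: real)"
  have d: "(\<lambda>y. v (x k) y - v t y) \<in> Lp p \<Omega>" for k
    using Lp_diff[OF p v_Lp v_Lp, of "x k" t] x(1) t by auto
  have lim: "(\<lambda>k. \<integral>y. norm (v (x k) y - v t y) powr p \<partial>lebesgue_on \<Omega>) \<longlonglongrightarrow> 0"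
    using v_tendsto[OF x(2)] x(1) by (simp add: Lp_mass_def)
  note L1 = L1_tendsto_of_Lp_tendsto[OF p finite_dom LpD(1)[OF d] LpD(2)[OF d] lim]
  show "(\<lambda>k. \<integral>y. \<psi> y *\<^sub>R v (x k) y \<partial>lebesgue_on \<Omega>) \<longlonglongrightarrow> (\<integral>y. \<psi> y *\<^sub>R v t y \<partial>lebesgue_on \<Omega>)"
    by (rule test_integral_tendsto[OF open_dom \<psi> Lp_locally_integrable[OF p open_dom v_Lp] Lp_locally_integrable[OF p open_dom v_Lp] integrable_norm[OF L1(1)] L1(2)])
      (use x(1) t in auto)
qed

lemma pairing_weak_derivative:
  assumes \<psi>: "test_fun \<Omega> (\<psi> :: real^'n \<Rightarrow> real)" and \<eta>: "test_fun {0<..} (\<eta> :: real \<Rightarrow> real)"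
  shows "(\<integral>t. frechet_derivative \<eta> (at t) 1 *\<^sub>R (\<integral>x. \<psi> x *\<^sub>R v t x \<partial>lebesgue_on \<Omega>) \<partial>lebesgue_on {0<..})
    = - (\<integral>t. \<eta> t *\<^sub>R (\<integral>x. \<psi> x *\<^sub>R vt t x \<partial>lebesgue_on \<Omega>) \<partial>lebesgue_on {0<..})"
proof -
  have I: "open {0::real<..}" by simp
  have w: "locally_integrable ({0<..} \<times> \<Omega>) (\<lambda>(t, x). v t x)" "locally_integrable ({0<..} \<times> \<Omega>) (\<lambda>(t, x). vt t x)"
    using dt by (auto simp: has_weak_dt_def has_weak_deriv_def)
  have d: "frechet_derivative (\<lambda>z. \<eta> (fst z) * \<psi> (snd z)) (at z) (1, 0) = frechet_derivative \<eta> (at (fst z)) 1 * \<psi> (snd z)" for z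
    using smooth_product(2)[OF test_fun_smooth[OF \<eta>] test_fun_smooth[OF \<psi>], of "fst z" "snd z" 1] by simp
  have "(\<integral>z. frechet_derivative (\<lambda>z. \<eta> (fst z) * \<psi> (snd z)) (at z) (1, 0) *\<^sub>R (case z of (t, x) \<Rightarrow> v t x) \<partial>lebesgue_on ({0<..} \<times> \<Omega>))
      = - (\<integral>z. (\<eta> (fst z) * \<psi> (snd z)) *\<^sub>R (case z of (t, x) \<Rightarrow> vt t x) \<partial>lebesgue_on ({0<..} \<times> \<Omega>))"
    using dt test_fun_product[OF \<eta> \<psi>] unfolding has_weak_dt_def has_weak_deriv_def by blast
  then show ?thesis
    unfolding d Fubini_test[OF I open_dom w(1) test_fun_derivative[OF \<eta>, of 1] \<psi>] Fubini_test[OF I open_dom w(2) \<eta> \<psi>] .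
qed

lemma integrable_bounded_multiple:
  fixes D :: "'a::euclidean_space \<Rightarrow> 'b::euclidean_space"
  assumes D: "integrable lborel D" and c: "c \<in> borel_measurable borel" "\<And>z. \<bar>c z\<bar> \<le> (B :: real)"
  shows "integrable lborel (\<lambda>z. c z *\<^sub>R D z)"
proof (rule Bochner_Integration.integrable_bound[where f = "\<lambda>z. B *\<^sub>R D z"])
  show "AE z in lborel. norm (c z *\<^sub>R D z) \<le> norm (B *\<^sub>R D z)"
    using order_trans[OF c(2) abs_ge_self] by (intro AE_I2) (simp add: mult_right_mono)
  show "(\<lambda>z. c z *\<^sub>R D z) \<in> borel_measurable lborel"
    using D c(1) by (intro borel_measurable_scaleR) auto
qed (use D in simp)

lemma vt_measurable:
  assumes "D \<in> borel_measurable borel" "AE x in lebesgue_on \<Omega>. vt t x = D (t, x)"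
  shows "vt t \<in> borel_measurable (lebesgue_on \<Omega>)"
proof (rule borel_measurable_lebesgue_on_AE[OF lebesgue_dom])
  have "(\<lambda>x. D (t, x)) \<in> borel_measurable lborel" using assms(1) by simp
  then show "(\<lambda>x. D (t, x)) \<in> borel_measurable (lebesgue_on \<Omega>)"
    by (intro measurable_restrict_space1 measurable_completion)
qed (use assms(2) in \<open>auto elim!: eventually_mono\<close>)

lemma integral_Omega_eq_lborel:
  fixes f :: "real^'n \<Rightarrow> 'b::euclidean_space"
  assumes f: "f \<in> borel_measurable borel" and f0: "\<And>x. x \<notin> \<Omega> \<Longrightarrow> f x = 0"
  shows "(\<integral>x. f x \<partial>lebesgue_on \<Omega>) = (\<integral>x. f x \<partial>lborel)"
proof -
  have "(\<integral>x. f x \<partial>lebesgue_on \<Omega>) = (\<integral>x. (if x \<in> \<Omega> then f x else 0) \<partial>lebesgue)"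
    by (rule Lebesgue_Measure.integral_restrict_UNIV[OF lebesgue_dom, symmetric])
  also have "(\<lambda>x. if x \<in> \<Omega> then f x else 0) = f" using f0 by auto
  also have "(\<integral>x. f x \<partial>lebesgue) = (\<integral>x. f x \<partial>lborel)" using f by (intro integral_completion) simp
  finally show ?thesis .
qed

lemma pairing_borel:
  assumes D: "D \<in> borel_measurable borel" "\<forall>z. z \<notin> {0<..<T} \<times> \<Omega> \<longrightarrow> D z = 0" "integrable lborel D"
    and ae: "AE t in lborel. t \<in> {0<..<T} \<longrightarrow> (AE x in lebesgue_on \<Omega>. vt t x = D (t, x))"
    and \<psi>: "test_fun \<Omega> (\<psi> :: real^'n \<Rightarrow> real)"
  shows "integrable lborel (\<lambda>z. \<psi> (snd z) *\<^sub>R D z)"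
    "AE t in lborel. (if t \<in> {0<..<T} then \<integral>x. \<psi> x *\<^sub>R vt t x \<partial>lebesgue_on \<Omega> else 0) = (\<integral>x. \<psi> x *\<^sub>R D (t, x) \<partial>lborel)"
proof -
  have \<psi>c: "continuous_on UNIV \<psi>" using smooth_continuous[OF test_fun_smooth[OF \<psi>]] .
  obtain B where B: "\<And>x. \<bar>\<psi> x\<bar> \<le> B" using test_fun_bounded[OF \<psi>] by (metis real_norm_def)
  have \<psi>m: "\<psi> \<in> borel_measurable borel" using \<psi>c by (rule borel_measurable_continuous_onI)
  show "integrable lborel (\<lambda>z. \<psi> (snd z) *\<^sub>R D z)"
    by (rule integrable_bounded_multiple[OF D(3) _ B])
      (intro borel_measurable_continuous_onI continuous_on_compose2[OF \<psi>c] continuous_intros, auto)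
  show "AE t in lborel. (if t \<in> {0<..<T} then \<integral>x. \<psi> x *\<^sub>R vt t x \<partial>lebesgue_on \<Omega> else 0) = (\<integral>x. \<psi> x *\<^sub>R D (t, x) \<partial>lborel)"
    using ae
  proof eventually_elim
    case (elim t)
    show ?case
    proof (cases "t \<in> {0<..<T}")
      case True
      with elim have e: "AE x in lebesgue_on \<Omega>. vt t x = D (t, x)" by blast
      have Ds: "(\<lambda>x. D (t, x)) \<in> borel_measurable borel" using D(1) by simp
      have pm: "(\<lambda>x. \<psi> x *\<^sub>R D (t, x)) \<in> borel_measurable borel" by (intro borel_measurable_scaleR \<psi>m Ds)
      have "(\<integral>x. \<psi> x *\<^sub>R vt t x \<partial>lebesgue_on \<Omega>) = (\<integral>x. \<psi> x *\<^sub>R D (t, x) \<partial>lebesgue_on \<Omega>)"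
      proof (rule integral_cong_AE)
        show "(\<lambda>x. \<psi> x *\<^sub>R vt t x) \<in> borel_measurable (lebesgue_on \<Omega>)"
          by (intro borel_measurable_scaleR test_fun_measurable[OF \<psi>] vt_measurable[OF D(1) e])
        show "(\<lambda>x. \<psi> x *\<^sub>R D (t, x)) \<in> borel_measurable (lebesgue_on \<Omega>)"
          using pm by (intro measurable_restrict_space1 measurable_completion) simp
      qed (use e in \<open>auto elim!: eventually_mono\<close>)
      also have "\<dots> = (\<integral>x. \<psi> x *\<^sub>R D (t, x) \<partial>lborel)"
        by (rule integral_Omega_eq_lborel[OF pm]) (simp add: D(2))
      finally show ?thesis using True by simp
    next
      case False
      then have "D (t, x) = 0" for x using D(2) by auto
      then show ?thesis using False by auto
    qed
  qed
qed

lemma pairing_integrable: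
  assumes \<psi>: "test_fun \<Omega> (\<psi> :: real^'n \<Rightarrow> real)" and T: "0 < T"
  shows "integrable (lebesgue_on {0<..<T}) (\<lambda>t. \<integral>x. \<psi> x *\<^sub>R vt t x \<partial>lebesgue_on \<Omega>)"
proof -
  obtain D :: "real \<times> (real^'n) \<Rightarrow> real^'m" where D: "D \<in> borel_measurable borel" "\<forall>z. z \<notin> {0<..<T} \<times> \<Omega> \<longrightarrow> D z = 0"
    "integrable lborel D" "integrable lborel (\<lambda>z. norm (D z) powr p)"
    "AE t in lborel. t \<in> {0<..<T} \<longrightarrow> (AE x in lebesgue_on \<Omega>. vt t x = D (t, x))"
    by (rule dt_borel[OF T]) blast
  note pb = pairing_borel[OF D(1-3,5) \<psi>]
  define b where "b t = (\<integral>x. \<psi> x *\<^sub>R D (t, x) \<partial>lborel)" for t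
  define c where "c t = (if t \<in> {0<..<T} then \<integral>x. \<psi> x *\<^sub>R vt t x \<partial>lebesgue_on \<Omega> else 0)" for t
  have b: "integrable lborel b"
    using lborel_Fubini(2)[OF pb(1)] by (simp add: b_def[abs_def])
  then have bl: "integrable lebesgue b" using integrable_completion[of b lborel] borel_measurable_integrable by blast
  have ae: "AE t in lebesgue. b t = c t"
    using AE_completion[OF pb(2)] by (auto simp: b_def c_def elim!: eventually_mono)
  have "c \<in> borel_measurable lebesgue"
    by (rule borel_measurable_AE[OF borel_measurable_integrable[OF bl] ae])
  then have "integrable lebesgue c"
    using integrable_cong_AE[OF borel_measurable_integrable[OF bl] _ ae] bl by blast
  then show ?thesis
    unfolding c_def by (intro iffD1[OF Lebesgue_Measure.integrable_restrict_UNIV]) auto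
qed

text \<open>
  Paired with a test function of \<open>x\<close>, the increment is the time integral of the pairing of \<open>v_t\<close>, by
  the fundamental theorem of calculus for weak derivatives. After an exchange of integrals the
  fundamental lemma removes the test function.
\<close>
lemma increment_eq_integral:
  assumes D: "D \<in> borel_measurable borel" "\<forall>z. z \<notin> {0<..<T} \<times> \<Omega> \<longrightarrow> D z = 0" "integrable lborel D"
    and ae: "AE t in lborel. t \<in> {0<..<T} \<longrightarrow> (AE x in lebesgue_on \<Omega>. vt t x = D (t, x))"
    and st: "0 \<le> s" "s < t" "t < T"
  shows "AE x in lebesgue_on \<Omega>. v t x - v s x = (\<integral>\<tau>. indicator {s<..t} \<tau> *\<^sub>R D (\<tau>, x) \<partial>lborel)"
proof -
  define G where "G x = (\<integral>\<tau>. indicator {s<..t} \<tau> *\<^sub>R D (\<tau>, x) \<partial>lborel)" for x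
  note indm = indicator_fst_measurable(2)[of s t, where 'a = "real^'n"]
  have H: "integrable lborel (\<lambda>z. indicat_real {s<..t} (fst z) *\<^sub>R D z)"
    by (rule integrable_bounded_multiple[OF D(3) indm, of 1]) (auto split: split_indicator)
  have Gi: "integrable lborel G"
    using lborel_Fubini_swap(2)[OF H] by (simp add: G_def[abs_def])
  have Gil: "integrable lebesgue G" using Gi integrable_completion[of G lborel] borel_measurable_integrable by blast
  have Gloc: "locally_integrable \<Omega> G"
    unfolding locally_integrable_def
  proof (intro allI impI)
    fix K assume "compact K \<and> K \<subseteq> \<Omega>"
    then show "integrable (lebesgue_on K) G"
      using integrable_lebesgue_on_subset[of UNIV G K] Gil by (simp add: lebesgue_on_UNIV_eq compact_imp_closed)
  qed
  have vloc: "locally_integrable \<Omega> (v t)" "locally_integrable \<Omega> (v s)"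
    using st by (intro Lp_locally_integrable[OF p open_dom v_Lp]; simp)+
  have dloc: "locally_integrable \<Omega> (\<lambda>x. v t x - v s x)"
    using locally_integrable_lincomb[OF vloc, of 1 "-1"] by simp
  have floc: "locally_integrable \<Omega> (\<lambda>x. (v t x - v s x) - G x)"
    using locally_integrable_lincomb[OF dloc Gloc, of 1 "-1"] by simp
  have "AE x in lebesgue_on \<Omega>. (v t x - v s x) - G x = 0"
  proof (rule fundamental_lemma_variations[OF open_dom floc])
    fix \<psi> :: "real^'n \<Rightarrow> real" assume \<psi>: "test_fun \<Omega> \<psi>"
    note pb = pairing_borel[OF D ae \<psi>]
    define b where "b \<tau> = (\<integral>x. \<psi> x *\<^sub>R D (\<tau>, x) \<partial>lborel)" for \<tau>
    define A where "A \<tau> = (\<integral>x. \<psi> x *\<^sub>R v \<tau> x \<partial>lebesgue_on \<Omega>)" for \<tau>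
    define c where "c \<tau> = (\<integral>x. \<psi> x *\<^sub>R vt \<tau> x \<partial>lebesgue_on \<Omega>)" for \<tau>
    have b: "integrable lborel b"
      using lborel_Fubini(2)[OF pb(1)] by (simp add: b_def[abs_def])
    have "A t - A s = (\<integral>\<tau>. c \<tau> \<partial>lebesgue_on {s<..t})"
      unfolding A_def c_def
      by (rule weak_derivative_FTC[OF pairing_continuous[OF \<psi>] pairing_integrable[OF \<psi>] pairing_weak_derivative[OF \<psi>] st(1,2)])
    also have "\<dots> = (\<integral>\<tau>. (if \<tau> \<in> {s<..t} then c \<tau> else 0) \<partial>lebesgue)"
      by (rule Lebesgue_Measure.integral_restrict_UNIV[symmetric]) simp
    also have "\<dots> = (\<integral>\<tau>. indicator {s<..t} \<tau> *\<^sub>R b \<tau> \<partial>lebesgue)"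
    proof -
      have m: "(\<lambda>\<tau>. indicat_real {s<..t} \<tau> *\<^sub>R b \<tau>) \<in> borel_measurable lborel"
        using borel_measurable_integrable[OF b] by (intro borel_measurable_scaleR borel_measurable_indicator) auto
      have e: "AE \<tau> in lebesgue. indicat_real {s<..t} \<tau> *\<^sub>R b \<tau> = (if \<tau> \<in> {s<..t} then c \<tau> else 0)"
        using AE_completion[OF pb(2)] by eventually_elim (use st in \<open>auto simp: b_def c_def\<close>)
      have "(\<lambda>\<tau>. if \<tau> \<in> {s<..t} then c \<tau> else 0) \<in> borel_measurable lebesgue"
        by (rule borel_measurable_AE[OF measurable_completion[OF m] e])
      then show ?thesis
        using e measurable_completion[OF m] by (intro integral_cong_AE) (auto elim!: eventually_mono)
    qed
    also have "\<dots> = (\<integral>\<tau>. indicator {s<..t} \<tau> *\<^sub>R b \<tau> \<partial>lborel)"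
      using borel_measurable_integrable[OF b] by (intro integral_completion borel_measurable_scaleR borel_measurable_indicator) auto
    also have "\<dots> = (\<integral>\<tau>. (\<integral>x. indicator {s<..t} \<tau> *\<^sub>R (\<psi> x *\<^sub>R D (\<tau>, x)) \<partial>lborel) \<partial>lborel)"
      unfolding b_def by (simp only: integral_scaleR_right)
    also have "\<dots> = (\<integral>x. \<psi> x *\<^sub>R G x \<partial>lborel)"
    proof -
      have H2: "integrable lborel (\<lambda>z. indicat_real {s<..t} (fst z) *\<^sub>R (\<psi> (snd z) *\<^sub>R D z))"
        by (rule integrable_bounded_multiple[OF pb(1) indm, of 1]) (auto split: split_indicator)
      have "(\<integral>\<tau>. (\<integral>x. indicator {s<..t} \<tau> *\<^sub>R (\<psi> x *\<^sub>R D (\<tau>, x)) \<partial>lborel) \<partial>lborel)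
          = (\<integral>x. (\<integral>\<tau>. indicator {s<..t} \<tau> *\<^sub>R (\<psi> x *\<^sub>R D (\<tau>, x)) \<partial>lborel) \<partial>lborel)"
        using lborel_Fubini(3)[OF H2] lborel_Fubini_swap(3)[OF H2] by simp
      also have "\<dots> = (\<integral>x. (\<integral>\<tau>. \<psi> x *\<^sub>R (indicator {s<..t} \<tau> *\<^sub>R D (\<tau>, x)) \<partial>lborel) \<partial>lborel)"
        by (simp only: scaleR_left_commute)
      finally show ?thesis unfolding G_def by (simp only: integral_scaleR_right)
    qed
    also have "\<dots> = (\<integral>x. \<psi> x *\<^sub>R G x \<partial>lebesgue_on \<Omega>)"
    proof (rule integral_Omega_eq_lborel[symmetric])
      show "(\<lambda>x. \<psi> x *\<^sub>R G x) \<in> borel_measurable borel"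
        using borel_measurable_integrable[OF Gi] smooth_continuous[OF test_fun_smooth[OF \<psi>]]
        by (intro borel_measurable_scaleR) (auto intro: borel_measurable_continuous_onI)
      obtain K where "K \<subseteq> \<Omega>" "\<And>x. x \<notin> K \<Longrightarrow> \<psi> x = 0" by (rule test_fun_support[OF \<psi>]) blast
      then show "\<psi> x *\<^sub>R G x = 0" if "x \<notin> \<Omega>" for x using that by (metis scale_eq_0_iff subsetD)
    qed
    finally have eq: "A t - A s = (\<integral>x. \<psi> x *\<^sub>R G x \<partial>lebesgue_on \<Omega>)" .
    have "(\<integral>x. \<psi> x *\<^sub>R ((v t x - v s x) - G x) \<partial>lebesgue_on \<Omega>) = A t - A s - (\<integral>x. \<psi> x *\<^sub>R G x \<partial>lebesgue_on \<Omega>)"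
      unfolding A_def
      using locally_integrable_mult_test[OF open_dom vloc(1) \<psi>] locally_integrable_mult_test[OF open_dom vloc(2) \<psi>]
        locally_integrable_mult_test[OF open_dom Gloc \<psi>] by (simp add: scaleR_diff_right)
    then show "(\<integral>x. \<psi> x *\<^sub>R ((v t x - v s x) - G x) \<partial>lebesgue_on \<Omega>) = 0" using eq by simp
  qed
  then show ?thesis unfolding G_def by (auto elim!: eventually_mono)
qed

section \<open>The equation at almost every time\<close>

definition equation_at :: "real \<Rightarrow> (real^'n \<Rightarrow> real^'m) \<Rightarrow> bool" where
  "equation_at t w \<longleftrightarrow> (\<integral>x. pflux p (vt t x) \<bullet> w x \<partial>lebesgue_on \<Omega>)
      + (\<integral>x. pflux p (weak_grad \<Omega> (v t) x) \<bullet> weak_grad \<Omega> w x \<partial>lebesgue_on \<Omega>) = 0"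

lemma AE_interval_of_lborel:
  assumes "AE t in lborel. t \<in> {0<..<T} \<longrightarrow> P t"
  shows "AE t in lebesgue_on {0..T}. P (t :: real)"
proof -
  have "AE t in lborel. t \<notin> {0, T}"
    by (intro AE_not_in) (simp add: null_sets_def emeasure_lborel_countable)
  with assms have "AE t in lborel. t \<in> {0..T} \<longrightarrow> P t"
    by eventually_elim auto
  from AE_completion[OF this] show ?thesis by (simp add: AE_restrict_space_iff)
qed

lemma AE_vt_Lp:
  assumes T: "0 < T"
  shows "AE t in lebesgue_on {0..T}. vt t \<in> Lp p \<Omega>"
proof -
  obtain D :: "real \<times> (real^'n) \<Rightarrow> real^'m" where D: "D \<in> borel_measurable borel" "\<forall>z. z \<notin> {0<..<T} \<times> \<Omega> \<longrightarrow> D z = 0"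
    "integrable lborel D" "integrable lborel (\<lambda>z. norm (D z) powr p)"
    "AE t in lborel. t \<in> {0<..<T} \<longrightarrow> (AE x in lebesgue_on \<Omega>. vt t x = D (t, x))"
    by (rule dt_borel[OF T]) blast
  have "AE t in lborel. t \<in> {0<..<T} \<longrightarrow> vt t \<in> Lp p \<Omega>"
    using D(5) lborel_Fubini(1)[OF D(4)]
  proof eventually_elim
    case (elim t)
    show ?case
    proof
      assume "t \<in> {0<..<T}"
      with elim have e: "AE x in lebesgue_on \<Omega>. D (t, x) = vt t x" by (auto elim!: eventually_mono)
      have m: "(\<lambda>x. D (t, x)) \<in> borel_measurable lborel" using D(1) by simp
      have "integrable lebesgue (\<lambda>x. norm (D (t, x)) powr p)"
        using elim(2) integrable_completion[of "\<lambda>x. norm (D (t, x)) powr p" lborel] borel_measurable_integrable by blast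
      then have "integrable (lebesgue_on \<Omega>) (\<lambda>x. norm (D (t, x)) powr p)"
        using integrable_lebesgue_on_subset[of UNIV _ \<Omega>] lebesgue_dom by (simp add: lebesgue_on_UNIV_eq)
      moreover have "(\<lambda>x. D (t, x)) \<in> borel_measurable (lebesgue_on \<Omega>)"
        using m by (intro measurable_restrict_space1 measurable_completion)
      ultimately have "(\<lambda>x. D (t, x)) \<in> Lp p \<Omega>" by (simp add: Lp_def)
      from Lp_cong_AE[OF lebesgue_dom this e] show "vt t \<in> Lp p \<Omega>" .
    qed
  qed
  then show ?thesis by (rule AE_interval_of_lborel)
qed

lemma equation_at_limit:
  assumes t: "0 \<le> t" and vt: "vt t \<in> Lp p \<Omega>" and w: "\<And>k::nat. w k \<in> W01p p \<Omega>" "\<And>k. equation_at t (w k)"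
    and u: "u \<in> W01p p \<Omega>" and lim: "(\<lambda>k. W1p_norm p \<Omega> (\<lambda>x. w k x - u x)) \<longlonglongrightarrow> 0"
  shows "equation_at t u"
proof -
  note w1 = W01pD[OF w(1)] and u1 = W01pD[OF u] and v1 = W01pD[OF v_W01p[OF t]]
  have l: "(\<lambda>k. Lp_mass p \<Omega> (\<lambda>x. w k x - u x)) \<longlonglongrightarrow> 0" "(\<lambda>k. energy p \<Omega> (\<lambda>x. w k x - u x)) \<longlonglongrightarrow> 0"
    using iffD1[OF W1p_norm_tendsto_0_iff[OF p] lim] by simp_all
  have eg: "energy p \<Omega> (\<lambda>x. w k x - u x) = (\<integral>x. norm (weak_grad \<Omega> (w k) x - weak_grad \<Omega> u x) powr p \<partial>lebesgue_on \<Omega>)" for k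
    using energy_lincomb[OF open_dom p w1[of k] u1, where a = 1 and b = "-1"] by (simp add: Lp_mass_def)
  note wL = LpD[OF W1pD(1)[OF open_dom w1]] and uL = LpD[OF W1pD(1)[OF open_dom u1]]
    and wG = LpD[OF W1pD(3)[OF open_dom w1]] and uG = LpD[OF W1pD(3)[OF open_dom u1]] and vG = LpD[OF W1pD(3)[OF open_dom v1]]
  have "(\<lambda>k. (\<integral>x. pflux p (vt t x) \<bullet> w k x \<partial>lebesgue_on \<Omega>) + (\<integral>x. pflux p (weak_grad \<Omega> (v t) x) \<bullet> weak_grad \<Omega> (w k) x \<partial>lebesgue_on \<Omega>))
      \<longlonglongrightarrow> (\<integral>x. pflux p (vt t x) \<bullet> u x \<partial>lebesgue_on \<Omega>) + (\<integral>x. pflux p (weak_grad \<Omega> (v t) x) \<bullet> weak_grad \<Omega> u x \<partial>lebesgue_on \<Omega>)"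
    by (intro tendsto_add integral_pflux_inner_tendsto[OF p LpD(1)[OF vt] wL(1) uL(1) LpD(2)[OF vt] wL(2) uL(2) l(1)[unfolded Lp_mass_def]]
        integral_pflux_inner_tendsto[OF p vG(1) wG(1) uG(1) vG(2) wG(2) uG(2) l(2)[unfolded eg]])
  then have "(\<lambda>k. 0 :: real) \<longlonglongrightarrow> (\<integral>x. pflux p (vt t x) \<bullet> u x \<partial>lebesgue_on \<Omega>) + (\<integral>x. pflux p (weak_grad \<Omega> (v t) x) \<bullet> weak_grad \<Omega> u x \<partial>lebesgue_on \<Omega>)"
    using w(2) by (simp add: equation_at_def)
  then show ?thesis unfolding equation_at_def by (simp add: LIMSEQ_const_iff)
qed

text \<open>
  The set \<open>R\<close> consists of the times at which the simple functions from the definition of strong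
  measurability converge to \<open>v\<close>. All their values together form a countable set, so outside one null
  set of times \<open>t\<close> the equation holds for all of them, and by continuity for their limits \<open>v q\<close> with
  \<open>q \<in> R\<close>. The extra time \<open>s\<close> is prescribed and need not belong to \<open>R\<close>.
\<close>
lemma AE_equation_at:
  assumes T: "0 < T" and s: "0 \<le> s"
  obtains R where "AE t in lebesgue_on {0..T}. t \<in> R"
    "AE t in lebesgue_on {0..T}. vt t \<in> Lp p \<Omega> \<and> (\<forall>q\<in>R \<union> {s}. equation_at t (v q))"
proof -
  have "strongly_measurable_W01p p \<Omega> T v"
    using sol T by (simp add: weak_solution_def Linf_W01p_def)
  then obtain a :: "nat \<Rightarrow> real \<Rightarrow> real^'n \<Rightarrow> real^'m" where
    a: "\<And>k. finite (a k ` {0..T})" "\<And>k. a k ` {0..T} \<subseteq> W01p p \<Omega>"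
      "AE t in lebesgue_on {0..T}. (\<lambda>k. W1p_norm p \<Omega> (\<lambda>x. a k t x - v t x)) \<longlonglongrightarrow> 0"
    unfolding strongly_measurable_W01p_def by blast
  define R where "R = {t \<in> {0..T}. (\<lambda>k. W1p_norm p \<Omega> (\<lambda>x. a k t x - v t x)) \<longlonglongrightarrow> 0}"
  define W where "W = (\<Union>k. a k ` {0..T}) \<union> {v s}"
  have cW: "countable W" unfolding W_def using a(1) by (auto intro: countable_finite)
  have WW: "W \<subseteq> W01p p \<Omega>" unfolding W_def using a(2) v_W01p[OF s] by blast
  have "AE t in lebesgue_on {0..T}. equation_at t w" if "w \<in> W" for w
    using sol T that WW unfolding weak_solution_def equation_at_def by blast
  then have "AE t in lebesgue_on {0..T}. \<forall>w\<in>W. equation_at t w"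
    by (subst AE_ball_countable[OF cW]) blast
  moreover have "AE t in lebesgue_on {0..T}. t \<in> {0..T}"
    by (intro AE_I2) (simp add: space_restrict_space)
  ultimately have "AE t in lebesgue_on {0..T}. vt t \<in> Lp p \<Omega> \<and> (\<forall>q\<in>R \<union> {s}. equation_at t (v q))"
    using AE_vt_Lp[OF T]
  proof eventually_elim
    case (elim t)
    have "equation_at t (v q)" if q: "q \<in> R" for q
    proof (rule equation_at_limit[where w = "\<lambda>k. a k q"])
      show "a k q \<in> W01p p \<Omega>" for k using a(2)[of k] q by (auto simp: R_def image_subset_iff)
      show "equation_at t (a k q)" for k using elim(1) q by (auto simp: W_def R_def)
      show "(\<lambda>k. W1p_norm p \<Omega> (\<lambda>x. a k q x - v q x)) \<longlonglongrightarrow> 0" using q by (simp add: R_def)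
      show "v q \<in> W01p p \<Omega>" using q by (intro v_W01p) (simp add: R_def)
    qed (use elim in auto)
    moreover have "equation_at t (v s)" using elim(1) by (simp add: W_def)
    ultimately show ?case using elim(3) by blast
  qed
  moreover have "AE t in lebesgue_on {0..T}. t \<in> R"
    using a(3) AE_I2[of "lebesgue_on {0..T}" "\<lambda>t. t \<in> {0..T}"]
    by (auto simp: R_def space_restrict_space elim!: eventually_mono intro: AE_conjI)
  ultimately show thesis using that by blast
qed

text \<open>
  Integrate the tangent inequality of \<open>|\<cdot>|^p\<close> at \<open>Dv(t)\<close> and use the equation at time \<open>t\<close>, tested with
  \<open>v(t)\<close> and \<open>v(q)\<close>, to replace the gradients by the time derivative.
\<close>
lemma energy_subgradient:
  assumes t: "0 \<le> t" and q: "0 \<le> q" and vt: "vt t \<in> Lp p \<Omega>" and e: "equation_at t (v t)" "equation_at t (v q)"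
  shows "E t + p * (\<integral>x. pflux p (vt t x) \<bullet> (v t x - v q x) \<partial>lebesgue_on \<Omega>) \<le> E q"
proof -
  note v1 = W01pD[OF v_W01p[OF t]] and q1 = W01pD[OF v_W01p[OF q]]
  note vL = LpD[OF W1pD(1)[OF open_dom v1]] and qL = LpD[OF W1pD(1)[OF open_dom q1]]
    and vG = LpD[OF W1pD(3)[OF open_dom v1]] and qG = LpD[OF W1pD(3)[OF open_dom q1]]
  note i = integrable_pflux_inner(1)[OF p vG(1) vG(1) vG(2) vG(2)] integrable_pflux_inner(1)[OF p vG(1) qG(1) vG(2) qG(2)]
    integrable_pflux_inner(1)[OF p LpD(1)[OF vt] vL(1) LpD(2)[OF vt] vL(2)] integrable_pflux_inner(1)[OF p LpD(1)[OF vt] qL(1) LpD(2)[OF vt] qL(2)]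
  have "(\<integral>x. norm (weak_grad \<Omega> (v t) x) powr p + p * (pflux p (weak_grad \<Omega> (v t) x) \<bullet> (weak_grad \<Omega> (v q) x - weak_grad \<Omega> (v t) x)) \<partial>lebesgue_on \<Omega>)
      \<le> (\<integral>x. norm (weak_grad \<Omega> (v q) x) powr p \<partial>lebesgue_on \<Omega>)"
    using i vG(2) qG(2) by (intro integral_mono powr_norm_subgradient[OF p]) (auto simp: inner_diff_right)
  then have "E t + p * ((\<integral>x. pflux p (weak_grad \<Omega> (v t) x) \<bullet> weak_grad \<Omega> (v q) x \<partial>lebesgue_on \<Omega>)
      - (\<integral>x. pflux p (weak_grad \<Omega> (v t) x) \<bullet> weak_grad \<Omega> (v t) x \<partial>lebesgue_on \<Omega>)) \<le> E q"
    using i vG(2) by (simp add: E_def energy_def inner_diff_right)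
  moreover have "(\<integral>x. pflux p (weak_grad \<Omega> (v t) x) \<bullet> weak_grad \<Omega> (v q) x \<partial>lebesgue_on \<Omega>)
      - (\<integral>x. pflux p (weak_grad \<Omega> (v t) x) \<bullet> weak_grad \<Omega> (v t) x \<partial>lebesgue_on \<Omega>)
      = (\<integral>x. pflux p (vt t x) \<bullet> (v t x - v q x) \<partial>lebesgue_on \<Omega>)"
    using e i by (simp add: equation_at_def inner_diff_right)
  ultimately show ?thesis by simp
qed

end

lemma integrable_indicator_Ioo: "integrable lborel (indicat_real {a<..<b :: real})"
  using emeasure_bounded_finite[of "{a<..<b}"] by (intro integrable_real_indicator) simp_all

context weak_flow
begin

section \<open>Energy dissipation\<close>

lemma AE_shift:
  assumes "AE t in lborel. P t" shows "AE t in lborel. P (t - h :: real)"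
proof -
  have m: "(+) (- h) \<in> lborel \<rightarrow>\<^sub>M lborel" by simp
  have d: "distr lborel lborel ((+) (- h)) = (lborel :: real measure)"
    using lborel_distr_plus[of "- h"] by (simp cong: distr_cong)
  have "AE t in distr lborel lborel ((+) (- h)). P t" using assms unfolding d .
  from AE_distrD[OF m this] show ?thesis by simp
qed

text \<open>
  Extend the solution by \<open>v s\<close> to times before \<open>s\<close>, so that \<open>F\<close> is its energy, and apply the subgradient
  inequality at \<open>\<tau>\<close> and \<open>\<tau> - h\<close> for almost every \<open>\<tau>\<close> between \<open>s\<close> and \<open>r\<close>. Integrated over \<open>\<tau>\<close>, the energies
  telescope to the integral of \<open>F\<close> over the last interval of length \<open>h\<close> minus \<open>h E s\<close>. Lower
  semicontinuity at \<open>r\<close> bounds the former from below by \<open>h (E r - e)\<close>; dividing by \<open>h\<close>, the Steklov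
  averages converge to the dissipated energy.
\<close>
lemma energy_dissipation:
  assumes s: "0 \<le> s" and sr: "s < r"
    and Dm: "D \<in> borel_measurable borel" and D0: "\<forall>z. z \<notin> {0<..<r+1} \<times> \<Omega> \<longrightarrow> D z = 0"
    and D1: "integrable lborel D" and Dp: "integrable lborel (\<lambda>z. norm (D z) powr p)"
    and ae: "AE t in lborel. t \<in> {0<..<r+1} \<longrightarrow> (AE x in lebesgue_on \<Omega>. vt t x = D (t, x))"
  shows "E r + p * (\<integral>z. norm (indicat_real {s<..<r} (fst z) *\<^sub>R D z) powr p \<partial>lborel) \<le> E s"
proof -
  \<comment> \<open>A horizon beyond \<open>r\<close>, so that the endpoint \<open>r\<close> is an interior time.\<close>
  define T where "T = r + 1"
  have T: "0 < T" using s sr by (simp add: T_def)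
  note indm = indicator_fst_measurable(1)[of s r, where 'a = "real^'n"]
  define Ds where "Ds z = indicat_real {s<..<r} (fst z) *\<^sub>R D z" for z
  have Dsm: "Ds \<in> borel_measurable borel"
    unfolding Ds_def by (intro borel_measurable_scaleR indm Dm)
  have Ds1: "integrable lborel Ds"
    unfolding Ds_def by (rule integrable_bounded_multiple[OF D1 indm, of 1]) (auto split: split_indicator)
  have Dsp: "integrable lborel (\<lambda>z. norm (Ds z) powr p)"
  proof (rule Bochner_Integration.integrable_bound[OF Dp])
    show "(\<lambda>z. norm (Ds z) powr p) \<in> borel_measurable lborel" using Dsm by simp
    show "AE z in lborel. norm (norm (Ds z) powr p) \<le> norm (norm (D z) powr p)"
      using p by (intro AE_I2) (auto simp: Ds_def split: split_indicator)
  qed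
  have Ds0: "Ds (\<tau>, x) = 0" if "\<tau> \<notin> {s<..<r} \<or> x \<notin> \<Omega>" for \<tau> x
    using that D0 by (auto simp: Ds_def)
  have Dsb: "bounded {z. Ds z \<noteq> 0}"
  proof (rule bounded_subset)
    show "bounded ({s<..<r} \<times> \<Omega>)" by (intro bounded_Times bounded_dom) simp
    show "{z. Ds z \<noteq> 0} \<subseteq> {s<..<r} \<times> \<Omega>" using Ds0 by force
  qed
  define M where "M h z = (\<integral>y. indicat_real {0<..<h} y *\<^sub>R Ds (z - (y, 0)) \<partial>lborel)" for h z
  define J where "J h = (\<integral>z. pflux p (Ds z) \<bullet> M h z \<partial>lborel)" for h
  have Ji: "integrable lborel (\<lambda>z. pflux p (Ds z) \<bullet> M h z)" if "0 < h" for h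
    using steklov_average(1)[OF p Dsm Ds1 Dsp Dsb that] unfolding M_def .
  have Jlim: "(\<lambda>k. real (Suc k) * J (inverse (real (Suc k)))) \<longlonglongrightarrow> (\<integral>z. norm (Ds z) powr p \<partial>lborel)"
    using steklov_average(2)[OF p Dsm Ds1 Dsp Dsb] unfolding J_def M_def .
  define j where "j h \<tau> = (\<integral>x. pflux p (Ds (\<tau>, x)) \<bullet> M h (\<tau>, x) \<partial>lborel)" for h \<tau>
  have ji: "integrable lborel (j h)" "(\<integral>\<tau>. j h \<tau> \<partial>lborel) = J h" if "0 < h" for h
    using lborel_Fubini(2,3)[OF Ji[OF that]] unfolding j_def[abs_def] J_def by simp_all
  have j0: "j h \<tau> = 0" if "\<tau> \<notin> {s<..<r}" for h \<tau>
    using that by (simp add: j_def Ds0 pflux_def)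
  obtain R where R: "AE t in lebesgue_on {0..T}. t \<in> R"
    "AE t in lebesgue_on {0..T}. vt t \<in> Lp p \<Omega> \<and> (\<forall>q\<in>R \<union> {s}. equation_at t (v q))"
    by (rule AE_equation_at[OF T s]) blast
  have toB: "AE t in lborel. t \<in> {0..T} \<longrightarrow> P t" if "AE t in lebesgue_on {0..T}. P t" for P
    using that by (simp add: AE_restrict_space_iff AE_completion_iff)
  define F where "F \<tau> = E (max s \<tau>)" for \<tau>
  have Fm: "F \<in> borel_measurable borel" unfolding F_def by (rule E_measurable[OF s])
  have M_eq: "M h (\<tau>, x) = (\<integral>\<sigma>. indicator {max s (\<tau> - h)<..\<tau>} \<sigma> *\<^sub>R D (\<sigma>, x) \<partial>lborel)"
    if "\<tau> < r" for h \<tau> x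
  proof -
    have "M h (\<tau>, x) = \<bar>-1\<bar> *\<^sub>R (\<integral>\<sigma>. indicat_real {0<..<h} (\<tau> + (-1) * \<sigma>) *\<^sub>R Ds ((\<tau>, x) - (\<tau> + (-1) * \<sigma>, 0)) \<partial>lborel)"
      unfolding M_def by (rule lborel_integral_real_affine) simp
    also have "\<dots> = (\<integral>\<sigma>. indicat_real {0<..<h} (\<tau> - \<sigma>) *\<^sub>R Ds (\<sigma>, x) \<partial>lborel)" by simp
    also have "\<dots> = (\<integral>\<sigma>. indicator {max s (\<tau> - h)<..\<tau>} \<sigma> *\<^sub>R D (\<sigma>, x) \<partial>lborel)"
    proof (rule integral_cong_AE)
      have sec: "(\<lambda>\<sigma>. D (\<sigma>, x)) \<in> borel_measurable borel" "(\<lambda>\<sigma>. Ds (\<sigma>, x)) \<in> borel_measurable borel"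
        using Dm Dsm by simp_all
      show "(\<lambda>\<sigma>. indicat_real {0<..<h} (\<tau> - \<sigma>) *\<^sub>R Ds (\<sigma>, x)) \<in> borel_measurable lborel"
      proof -
        have "(\<lambda>\<sigma>. \<tau> - \<sigma>) \<in> borel_measurable borel" by simp
        then have "(\<lambda>\<sigma>. indicat_real {0<..<h} (\<tau> - \<sigma>)) \<in> borel_measurable borel" by (rule measurable_compose) simp
        then show ?thesis using sec by simp
      qed
      show "(\<lambda>\<sigma>. indicat_real {max s (\<tau> - h)<..\<tau>} \<sigma> *\<^sub>R D (\<sigma>, x)) \<in> borel_measurable lborel" using sec by simp
      have "AE \<sigma> in lborel. \<sigma> \<notin> {\<tau>}" by (intro AE_not_in) (simp add: null_sets_def)
      then show "AE \<sigma> in lborel. indicat_real {0<..<h} (\<tau> - \<sigma>) *\<^sub>R Ds (\<sigma>, x) = indicator {max s (\<tau> - h)<..\<tau>} \<sigma> *\<^sub>R D (\<sigma>, x)"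
        by eventually_elim (use that in \<open>auto simp: Ds_def split: split_indicator\<close>)
    qed
    finally show ?thesis .
  qed
  have step: "AE \<tau> in lborel. indicat_real {s<..<r} \<tau> * (F \<tau> - F (\<tau> - h)) \<le> - p * j h \<tau>" if h: "0 < h" for h
    using toB[OF R(1)] AE_shift[OF toB[OF R(1)], of h] toB[OF R(2)] ae
  proof eventually_elim
    case (elim \<tau>)
    show ?case
    proof (cases "\<tau> \<in> {s<..<r}")
      case True
      define q where "q = max s (\<tau> - h)"
      have q: "s \<le> q" "q < \<tau>" "0 \<le> q" using True h s by (auto simp: q_def)
      have \<tau>T: "\<tau> \<in> {0..T}" "\<tau> \<in> {0<..<r+1}" "\<tau> < r + 1" "0 \<le> \<tau>" using True s by (auto simp: T_def)
      have "q \<in> R \<union> {s}"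
        using elim(2) True s h by (auto simp: q_def max_def T_def split: if_splits)
      with elim \<tau>T have w: "vt \<tau> \<in> Lp p \<Omega>" "equation_at \<tau> (v \<tau>)" "equation_at \<tau> (v q)" by blast+
      have D\<tau>: "AE x in lebesgue_on \<Omega>. vt \<tau> x = D (\<tau>, x)" using elim(4) \<tau>T by blast
      have inc: "AE x in lebesgue_on \<Omega>. v \<tau> x - v q x = (\<integral>\<sigma>. indicator {q<..\<tau>} \<sigma> *\<^sub>R D (\<sigma>, x) \<partial>lborel)"
        by (rule increment_eq_integral[OF Dm D0 D1 ae q(3,2) \<tau>T(3)])
      have jm: "(\<lambda>x. pflux p (Ds (\<tau>, x)) \<bullet> M h (\<tau>, x)) \<in> borel_measurable borel"
      proof -
        have "(\<lambda>z. pflux p (Ds z) \<bullet> M h z) \<in> borel_measurable borel" using borel_measurable_integrable[OF Ji[OF h]] by simp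
        then show ?thesis by simp
      qed
      have "(\<integral>x. pflux p (vt \<tau> x) \<bullet> (v \<tau> x - v q x) \<partial>lebesgue_on \<Omega>)
          = (\<integral>x. pflux p (Ds (\<tau>, x)) \<bullet> M h (\<tau>, x) \<partial>lebesgue_on \<Omega>)"
      proof (rule integral_cong_AE)
        show "(\<lambda>x. pflux p (vt \<tau> x) \<bullet> (v \<tau> x - v q x)) \<in> borel_measurable (lebesgue_on \<Omega>)"
          using LpD(1)[OF w(1)] LpD(1)[OF v_Lp[OF q(3)]] LpD(1)[OF v_Lp[OF \<tau>T(4)]]
          by (intro borel_measurable_inner pflux_measurable borel_measurable_diff)
        show "(\<lambda>x. pflux p (Ds (\<tau>, x)) \<bullet> M h (\<tau>, x)) \<in> borel_measurable (lebesgue_on \<Omega>)"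
          using jm by (intro measurable_restrict_space1 measurable_completion) simp
        show "AE x in lebesgue_on \<Omega>. pflux p (vt \<tau> x) \<bullet> (v \<tau> x - v q x) = pflux p (Ds (\<tau>, x)) \<bullet> M h (\<tau>, x)"
          using D\<tau> inc
        proof eventually_elim
          case (elim x)
          have "Ds (\<tau>, x) = D (\<tau>, x)" using True by (simp add: Ds_def)
          then show ?case using elim M_eq[of \<tau> h x] True by (simp add: q_def)
        qed
      qed
      also have "\<dots> = j h \<tau>"
        unfolding j_def by (rule integral_Omega_eq_lborel[OF jm]) (simp add: Ds0 pflux_def)
      finally have "E \<tau> + p * j h \<tau> \<le> E q"
        using energy_subgradient[OF \<tau>T(4) q(3) w] by simp
      then show ?thesis using True by (simp add: F_def q_def)
    qed (simp add: j0)
  qed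
  obtain C where C: "\<And>t. t \<in> {0..T} \<Longrightarrow> E t \<le> C" by (rule energy_bound[OF T]) blast
  have Fi: "integrable lborel (\<lambda>\<tau>. indicat_real {a<..<b} \<tau> *\<^sub>R F \<tau>)" if "b \<le> T" for a b
  proof (rule Bochner_Integration.integrable_bound[where f = "\<lambda>\<tau>. indicat_real {a<..<b} \<tau> * C"])
    show "integrable lborel (\<lambda>\<tau>. indicat_real {a<..<b} \<tau> * C)"
      by (intro integrable_mult_left integrable_indicator_Ioo)
    show "(\<lambda>\<tau>. indicat_real {a<..<b} \<tau> *\<^sub>R F \<tau>) \<in> borel_measurable lborel" using Fm by simp
    show "AE \<tau> in lborel. norm (indicat_real {a<..<b} \<tau> *\<^sub>R F \<tau>) \<le> norm (indicat_real {a<..<b} \<tau> * C)"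
    proof (intro AE_I2)
      fix \<tau>
      show "norm (indicat_real {a<..<b} \<tau> *\<^sub>R F \<tau>) \<le> norm (indicat_real {a<..<b} \<tau> * C)"
      proof (cases "\<tau> \<in> {a<..<b}")
        case True
        then have "F \<tau> \<le> C" unfolding F_def using that s sr by (intro C) (auto simp: T_def)
        moreover have "0 \<le> F \<tau>" by (simp add: F_def E_def)
        ultimately show ?thesis using True by simp
      qed simp
    qed
  qed
  have main: "E r - e + p * (\<integral>z. norm (Ds z) powr p \<partial>lborel) \<le> E s" if e: "0 < e" for e
  proof -
    obtain d where d: "0 < d" "\<And>t. r - d < t \<Longrightarrow> t \<le> r \<Longrightarrow> E r - e < E t"
      using E_lsc_left[of r e] s sr e by auto
    have bound: "h * (E r - e) - h * E s \<le> - p * J h" if h: "0 < h" "h < d" "h < r - s" for h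
    proof -
      \<comment> \<open>Shifting the variable moves the translate from \<open>F\<close> to the interval; away from the overlap of the
        two intervals only the pieces of length \<open>h\<close> at both ends remain.\<close>
      have sh: "(\<lambda>\<tau>. indicat_real {s<..<r} \<tau> * F (\<tau> - h)) = (\<lambda>\<tau>. (\<lambda>\<sigma>. indicat_real {s-h<..<r-h} \<sigma> *\<^sub>R F \<sigma>) (\<tau> - h))"
        by (auto simp: fun_eq_iff split: split_indicator)
      have rT: "r \<le> T" "r - h \<le> T" using h by (auto simp: T_def)
      have i1: "integrable lborel (\<lambda>\<tau>. indicat_real {s<..<r} \<tau> * F \<tau>)" using Fi[OF rT(1)] by simp
      have i3: "integrable lborel (\<lambda>\<sigma>. indicat_real {s-h<..<r-h} \<sigma> *\<^sub>R F \<sigma>)" by (rule Fi[OF rT(2)])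
      have i2: "integrable lborel (\<lambda>\<tau>. indicat_real {s<..<r} \<tau> * F (\<tau> - h))"
        unfolding sh by (rule lborel_translate(1)[OF i3])
      have "h * (E r - e) - h * E s = (\<integral>\<sigma>. indicat_real {r-h<..<r} \<sigma> * (E r - e) - indicat_real {s-h<..<s} \<sigma> * E s \<partial>lborel)"
        using h by simp
      also have "\<dots> \<le> (\<integral>\<sigma>. indicat_real {s<..<r} \<sigma> * F \<sigma> - indicat_real {s-h<..<r-h} \<sigma> *\<^sub>R F \<sigma> \<partial>lborel)"
      proof (rule integral_mono_AE)
        have "AE \<sigma> in lborel. \<sigma> \<notin> {s, r - h}" by (intro AE_not_in) (simp add: null_sets_def emeasure_lborel_countable)
        then show "AE \<sigma> in lborel. indicat_real {r-h<..<r} \<sigma> * (E r - e) - indicat_real {s-h<..<s} \<sigma> * E s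
            \<le> indicat_real {s<..<r} \<sigma> * F \<sigma> - indicat_real {s-h<..<r-h} \<sigma> *\<^sub>R F \<sigma>"
        proof eventually_elim
          case (elim \<sigma>)
          consider "\<sigma> \<in> {r-h<..<r}" | "\<sigma> \<in> {s-h<..<s}" | "\<sigma> \<notin> {r-h<..<r}" "\<sigma> \<notin> {s-h<..<s}" by blast
          then show ?case
          proof cases
            case 1
            then have "F \<sigma> = E \<sigma>" "E r - e < E \<sigma>" using h d(2)[of \<sigma>] by (auto simp: F_def max_def)
            then show ?thesis using 1 h by (auto split: split_indicator)
          next
            case 2
            then have "F \<sigma> = E s" by (simp add: F_def)
            then show ?thesis using 2 h by (auto split: split_indicator)
          next
            case 3
            then show ?thesis using elim h by (auto split: split_indicator)
          qed
        qed
      qed (use i1 i3 in \<open>auto intro!: integrable_mult_left integrable_indicator_Ioo\<close>)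
      also have "\<dots> = (\<integral>\<sigma>. indicat_real {s<..<r} \<sigma> * F \<sigma> \<partial>lborel) - (\<integral>\<sigma>. indicat_real {s-h<..<r-h} \<sigma> *\<^sub>R F \<sigma> \<partial>lborel)"
        by (rule Bochner_Integration.integral_diff[OF i1 i3])
      also have "(\<integral>\<sigma>. indicat_real {s-h<..<r-h} \<sigma> *\<^sub>R F \<sigma> \<partial>lborel) = (\<integral>\<tau>. indicat_real {s<..<r} \<tau> * F (\<tau> - h) \<partial>lborel)"
        unfolding sh by (rule lborel_translate(2)[OF i3, symmetric])
      also have "(\<integral>\<sigma>. indicat_real {s<..<r} \<sigma> * F \<sigma> \<partial>lborel) - \<dots> = (\<integral>\<tau>. indicat_real {s<..<r} \<tau> * (F \<tau> - F (\<tau> - h)) \<partial>lborel)"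
        using i1 i2 by (simp add: right_diff_distrib)
      also have "\<dots> \<le> (\<integral>\<tau>. - p * j h \<tau> \<partial>lborel)"
        using i1 i2 ji(1)[OF h(1)] step[OF h(1)]
        by (intro integral_mono_AE) (auto simp: right_diff_distrib)
      also have "\<dots> = - p * J h" using ji(2)[OF h(1)] by simp
      finally show ?thesis .
    qed
    have m0: "min d (r - s) > 0" using d sr by simp
    obtain N where N: "inverse (real (Suc N)) < min d (r - s)" using reals_Archimedean[OF m0] by blast
    have "E r - e - E s \<le> - p * (real (Suc k) * J (inverse (real (Suc k))))" if k: "k \<ge> N" for k
    proof -
      define h where "h = inverse (real (Suc k))"
      have h: "0 < h" by (simp add: h_def)
      have "h \<le> inverse (real (Suc N))" using k by (simp add: h_def)
      with N have "h * (E r - e) - h * E s \<le> - p * J h" using h by (intro bound) auto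
      then have "real (Suc k) * (h * (E r - e) - h * E s) \<le> real (Suc k) * (- p * J h)"
        by (intro mult_left_mono) auto
      moreover have "real (Suc k) * (h * (E r - e) - h * E s) = E r - e - E s"
      proof -
        have "real (Suc k) * (h * (E r - e) - h * E s) = (real (Suc k) * h) * (E r - e - E s)" by (simp add: algebra_simps)
        also have "real (Suc k) * h = 1" by (simp add: h_def del: of_nat_Suc)
        finally show ?thesis by simp
      qed
      ultimately show ?thesis by (simp add: h_def mult.left_commute del: of_nat_Suc)
    qed
    then have "E r - e - E s \<le> - p * (\<integral>z. norm (Ds z) powr p \<partial>lborel)"
      by (intro LIMSEQ_le_const[OF tendsto_mult[OF tendsto_const Jlim]]) blast
    then show ?thesis by simp
  qed
  have "E r + p * (\<integral>z. norm (Ds z) powr p \<partial>lborel) \<le> E s + e" if "0 < e" for e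
    using main[OF that] by simp
  then have "E r + p * (\<integral>z. norm (Ds z) powr p \<partial>lborel) \<le> E s"
    by (rule field_le_epsilon)
  then show ?thesis by (simp add: Ds_def)
qed

section \<open>The Rayleigh quotient and exponential decay\<close>

text \<open>
  Both degenerate cases are trivial: the energy vanishes by the equation if \<open>v t\<close> does, and \<open>\<Upsilon>\<close>
  vanishes if \<open>\<Lambda>\<close> does. Otherwise the weight \<open>l\<close> in Young's inequality is chosen such that the term with
  \<open>v t\<close> becomes \<open>\<Lambda>/p\<close> times the integral of \<open>|v t|^p\<close>, which is at most \<open>E t / p\<close> and is absorbed.
\<close>
lemma Upsilon_energy_le:
  assumes t: "0 \<le> t" and vt: "vt t \<in> Lp p \<Omega>" and e: "equation_at t (v t)"
  shows "Upsilon_p TYPE('m) p \<Omega> * E t \<le> Lp_mass p \<Omega> (vt t)"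
proof -
  note v1 = W01pD[OF v_W01p[OF t]]
  note vL = LpD[OF W1pD(1)[OF open_dom v1]] and dL = LpD[OF vt]
  have Eq: "E t = - (\<integral>x. pflux p (vt t x) \<bullet> v t x \<partial>lebesgue_on \<Omega>)"
    using e by (simp add: equation_at_def pflux_inner_self E_def energy_def)
  define \<Lambda> where "\<Lambda> = Lambda_p TYPE('m) p \<Omega>"
  have Y: "Upsilon_p TYPE('m) p \<Omega> = \<Lambda> powr (1 / (p - 1))" by (simp add: Upsilon_p_def \<Lambda>_def)
  show ?thesis
  proof (cases "AE x in lebesgue_on \<Omega>. v t x = 0")
    case True
    have "(\<integral>x. pflux p (vt t x) \<bullet> v t x \<partial>lebesgue_on \<Omega>) = 0"
      by (rule integral_eq_zero_AE) (use True in \<open>auto elim!: eventually_mono\<close>)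
    then show ?thesis using Eq by simp
  next
    case False
    define Qs where "Qs = {(\<integral>x. norm (weak_grad \<Omega> u x) powr p \<partial>lebesgue_on \<Omega>)
            / (\<integral>x. norm (u x) powr p \<partial>lebesgue_on \<Omega>) | u :: real^'n \<Rightarrow> real^'m.
          u \<in> W01p p \<Omega> \<and> \<not> (AE x in lebesgue_on \<Omega>. u x = 0)}"
    have mem: "E t / Lp_mass p \<Omega> (v t) \<in> Qs"
      unfolding Qs_def E_def energy_def Lp_mass_def using v_W01p[OF t] False by blast
    have nn: "0 \<le> y" if "y \<in> Qs" for y using that by (auto simp: Qs_def)
    have \<Lambda>Q: "\<Lambda> = Inf Qs" by (simp add: \<Lambda>_def Lambda_p_def Qs_def)
    have \<Lambda>0: "0 \<le> \<Lambda>" unfolding \<Lambda>Q using mem nn by (intro cInf_greatest) auto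
    have le: "\<Lambda> \<le> E t / Lp_mass p \<Omega> (v t)"
      unfolding \<Lambda>Q by (rule cInf_lower[OF mem bdd_belowI[of _ 0]]) (use nn in auto)
    show ?thesis
    proof (cases "\<Lambda> = 0")
      case True
      then show ?thesis by (simp add: Y)
    next
      case pos: False
      then have \<Lambda>: "\<Lambda> > 0" using \<Lambda>0 by simp
      have m0: "Lp_mass p \<Omega> (v t) \<noteq> 0"
        using le \<Lambda> by auto
      then have mle: "Lp_mass p \<Omega> (v t) \<le> E t / \<Lambda>"
        using le \<Lambda> Lp_mass_nonneg[of p \<Omega> "v t"] by (simp add: field_simps)
      define Y where "Y = \<Lambda> powr (1 / (p - 1))"
      \<comment> \<open>This is the weight with \<open>l^(p (1-p)) = \<Lambda>\<close>.\<close>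
      define l where "l = \<Lambda> powr (- 1 / (p * (p - 1)))"
      have l: "0 < l" using \<Lambda> by (simp add: l_def)
      have lp: "l powr p = 1 / Y"
      proof -
        have "l powr p = \<Lambda> powr (- 1 / (p * (p - 1)) * p)" unfolding l_def by (rule powr_powr)
        also have "- 1 / (p * (p - 1)) * p = - (1 / (p - 1))" using p by (simp add: field_simps)
        finally show ?thesis by (simp add: Y_def powr_minus_divide)
      qed
      have lq: "l powr (p * (1 - p)) = \<Lambda>"
      proof -
        have "l powr (p * (1 - p)) = \<Lambda> powr (- 1 / (p * (p - 1)) * (p * (1 - p)))" unfolding l_def by (rule powr_powr)
        also have "- 1 / (p * (p - 1)) * (p * (1 - p)) = 1" using p by (simp add: field_simps)
        finally show ?thesis using \<Lambda> by simp
      qed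
      have "E t \<le> \<bar>\<integral>x. pflux p (vt t x) \<bullet> v t x \<partial>lebesgue_on \<Omega>\<bar>" using Eq by simp
      also have "\<dots> \<le> (\<integral>x. (p - 1) / p * (1 / Y * norm (vt t x) powr p) + \<Lambda> * norm (v t x) powr p / p \<partial>lebesgue_on \<Omega>)"
      proof (rule abs_integral_le)
        show "\<bar>pflux p (vt t x) \<bullet> v t x\<bar> \<le> (p - 1) / p * (1 / Y * norm (vt t x) powr p) + \<Lambda> * norm (v t x) powr p / p" for x
          using order_trans[OF pflux_inner_le young_powr_weighted[OF p norm_ge_zero norm_ge_zero l]] by (simp add: lp lq)
      qed (use integrable_pflux_inner(1)[OF p dL(1) vL(1) dL(2) vL(2)] dL vL in auto)
      also have "\<dots> = (p - 1) / p * (1 / Y * Lp_mass p \<Omega> (vt t)) + \<Lambda> * Lp_mass p \<Omega> (v t) / p"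
        using dL vL by (simp add: Lp_mass_def)
      also have "\<dots> \<le> (p - 1) / p * (1 / Y * Lp_mass p \<Omega> (vt t)) + E t / p"
      proof -
        have "\<Lambda> * Lp_mass p \<Omega> (v t) \<le> E t" using mle \<Lambda> by (simp add: field_simps)
        then show ?thesis using p by (simp add: divide_right_mono)
      qed
      finally have "p * E t \<le> p * ((p - 1) / p * (1 / Y * Lp_mass p \<Omega> (vt t)) + E t / p)"
        using p by (intro mult_left_mono) auto
      also have "\<dots> = (p - 1) * (1 / Y * Lp_mass p \<Omega> (vt t)) + E t" using p by (simp add: distrib_left)
      finally have "(p - 1) * E t \<le> (p - 1) * (1 / Y * Lp_mass p \<Omega> (vt t))" by (simp add: left_diff_distrib)
      then have "E t \<le> 1 / Y * Lp_mass p \<Omega> (vt t)" by (rule mult_left_le_imp_le) (use p in simp)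
      moreover have "Y > 0" using \<Lambda> by (simp add: Y_def)
      ultimately show ?thesis by (simp add: \<open>Upsilon_p TYPE('m) p \<Omega> = \<Lambda> powr (1 / (p - 1))\<close> Y_def[symmetric] field_simps)
    qed
  qed
qed

lemma AE_Upsilon_energy_le:
  assumes T: "0 < T"
  shows "AE t in lebesgue_on {0..T}. Upsilon_p TYPE('m) p \<Omega> * E t \<le> Lp_mass p \<Omega> (vt t)"
proof -
  obtain R where R: "AE t in lebesgue_on {0..T}. t \<in> R"
    "AE t in lebesgue_on {0..T}. vt t \<in> Lp p \<Omega> \<and> (\<forall>q\<in>R \<union> {0}. equation_at t (v q))"
    by (rule AE_equation_at[OF T order_refl]) blast
  have "AE t in lebesgue_on {0..T}. t \<in> {0..T}"
    by (intro AE_I2) (simp add: space_restrict_space)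
  with R show ?thesis
    by eventually_elim (auto intro!: Upsilon_energy_le)
qed

text \<open>
  On the interval from \<open>s\<close> to \<open>r\<close> the dissipation rate is at least \<open>\<Upsilon>\<close> times the current energy, which is
  at least \<open>E r\<close> by monotonicity.
\<close>
lemma energy_decay_step:
  assumes s: "0 \<le> s" and sr: "s < r"
  shows "E r * (1 + p * Upsilon_p TYPE('m) p \<Omega> * (r - s)) \<le> E s" "E r \<le> E s"
proof -
  define Y where "Y = Upsilon_p TYPE('m) p \<Omega>"
  have Y0: "0 \<le> Y" by (simp add: Y_def Upsilon_p_def)
  have T: "0 < r + 1" using s sr by simp
  obtain D :: "real \<times> (real^'n) \<Rightarrow> real^'m" where D: "D \<in> borel_measurable borel" "\<forall>z. z \<notin> {0<..<r+1} \<times> \<Omega> \<longrightarrow> D z = 0"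
    "integrable lborel D" "integrable lborel (\<lambda>z. norm (D z) powr p)"
    "AE t in lborel. t \<in> {0<..<r+1} \<longrightarrow> (AE x in lebesgue_on \<Omega>. vt t x = D (t, x))"
    by (rule dt_borel[OF T]) blast
  have mono: "E b \<le> E a" if ab: "0 \<le> a" "a < b" for a b
  proof -
    have Tb: "0 < b + 1" using ab by simp
    obtain D :: "real \<times> (real^'n) \<Rightarrow> real^'m" where D: "D \<in> borel_measurable borel" "\<forall>z. z \<notin> {0<..<b+1} \<times> \<Omega> \<longrightarrow> D z = 0"
      "integrable lborel D" "integrable lborel (\<lambda>z. norm (D z) powr p)"
      "AE t in lborel. t \<in> {0<..<b+1} \<longrightarrow> (AE x in lebesgue_on \<Omega>. vt t x = D (t, x))"
      by (rule dt_borel[OF Tb]) blast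
    have "0 \<le> p * (\<integral>z. norm (indicat_real {a<..<b} (fst z) *\<^sub>R D z) powr p \<partial>lborel)"
      using p by (intro mult_nonneg_nonneg integral_nonneg_AE) auto
    then show ?thesis using energy_dissipation[OF ab D] by linarith
  qed
  show "E r \<le> E s" by (rule mono[OF s sr])
  define N where "N \<tau> = (\<integral>x. norm (D (\<tau>, x)) powr p \<partial>lborel)" for \<tau>
  have Ni: "integrable lborel N" using lborel_Fubini(2)[OF D(4)] by (simp add: N_def[abs_def])
  note indm = indicator_fst_measurable(1)[of s r, where 'a = "real^'n"]
  have Hi: "integrable lborel (\<lambda>z. indicat_real {s<..<r} (fst z) *\<^sub>R norm (D z) powr p)"
    by (rule integrable_bounded_multiple[OF D(4) indm, of 1]) (auto split: split_indicator)
  have "(\<integral>z. norm (indicat_real {s<..<r} (fst z) *\<^sub>R D z) powr p \<partial>lborel) = (\<integral>z. indicat_real {s<..<r} (fst z) *\<^sub>R norm (D z) powr p \<partial>lborel)"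
    using p by (intro Bochner_Integration.integral_cong refl) (auto split: split_indicator)
  also have "\<dots> = (\<integral>\<tau>. indicat_real {s<..<r} \<tau> * N \<tau> \<partial>lborel)"
    using lborel_Fubini(3)[OF Hi] by (simp add: N_def)
  finally have dint: "(\<integral>z. norm (indicat_real {s<..<r} (fst z) *\<^sub>R D z) powr p \<partial>lborel) = (\<integral>\<tau>. indicat_real {s<..<r} \<tau> * N \<tau> \<partial>lborel)" .
  have "Y * E r * (r - s) = (\<integral>\<tau>. indicat_real {s<..<r} \<tau> * (Y * E r) \<partial>lborel)"
    using sr by simp
  also have "\<dots> \<le> (\<integral>\<tau>. indicat_real {s<..<r} \<tau> * N \<tau> \<partial>lborel)"
  proof (rule integral_mono_AE)
    have "AE \<tau> in lborel. \<tau> \<in> {0..r+1} \<longrightarrow> Y * E \<tau> \<le> Lp_mass p \<Omega> (vt \<tau>)"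
      using AE_Upsilon_energy_le[OF T] by (simp add: AE_restrict_space_iff AE_completion_iff Y_def)
    then show "AE \<tau> in lborel. indicat_real {s<..<r} \<tau> * (Y * E r) \<le> indicat_real {s<..<r} \<tau> * N \<tau>"
      using D(5)
    proof eventually_elim
      case (elim \<tau>)
      show ?case
      proof (cases "\<tau> \<in> {s<..<r}")
        case True
        then have \<tau>: "\<tau> \<in> {0..r+1}" "\<tau> \<in> {0<..<r+1}" "0 \<le> \<tau>" "\<tau> < r" using s by auto
        have e: "AE x in lebesgue_on \<Omega>. vt \<tau> x = D (\<tau>, x)" using elim(2) \<tau> by blast
        have m: "(\<lambda>x. D (\<tau>, x)) \<in> borel_measurable borel" using D(1) by simp
        have "Lp_mass p \<Omega> (vt \<tau>) = Lp_mass p \<Omega> (\<lambda>x. D (\<tau>, x))"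
          by (rule Lp_mass_cong_AE[OF e vt_measurable[OF D(1) e]])
            (use m in \<open>intro measurable_restrict_space1 measurable_completion, simp\<close>)
        also have "\<dots> = N \<tau>"
          unfolding Lp_mass_def N_def using m p D(2) by (intro integral_Omega_eq_lborel) auto
        finally have "Y * E \<tau> \<le> N \<tau>" using elim(1) \<tau> by simp
        moreover have "Y * E r \<le> Y * E \<tau>" using mono[OF \<tau>(3,4)] Y0 by (intro mult_left_mono) auto
        ultimately show ?thesis using True by simp
      qed simp
    qed
    show "integrable lborel (\<lambda>\<tau>. indicat_real {s<..<r} \<tau> * (Y * E r))"
      by (intro integrable_mult_left integrable_indicator_Ioo)
    show "integrable lborel (\<lambda>\<tau>. indicat_real {s<..<r} \<tau> * N \<tau>)"
      using integrable_mult_indicator[of "{s<..<r}" lborel N] Ni by simp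
  qed
  finally have "p * (Y * E r * (r - s)) \<le> p * (\<integral>\<tau>. indicat_real {s<..<r} \<tau> * N \<tau> \<partial>lborel)"
    using p by (intro mult_left_mono) auto
  with energy_dissipation[OF s sr D] have "E r + p * (Y * E r * (r - s)) \<le> E s"
    unfolding dint by linarith
  then show "E r * (1 + p * Upsilon_p TYPE('m) p \<Omega> * (r - s)) \<le> E s"
    by (simp add: Y_def algebra_simps)
qed

text \<open>
  Applying the previous estimate on \<open>n\<close> equal steps is the implicit Euler scheme for \<open>y' = - c y\<close>; the
  compounded factors tend to the exponential.
\<close>
lemma energy_decay:
  assumes t: "0 < t"
  shows "E t \<le> exp (- (p * Upsilon_p TYPE('m) p \<Omega>) * t) * E 0"
proof -
  define c where "c = p * Upsilon_p TYPE('m) p \<Omega>"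
  have c: "0 \<le> c" using p by (simp add: c_def Upsilon_p_def)
  have "E t * (1 + c * t / real n) ^ n \<le> E 0" if n: "n > 0" for n
  proof -
    define h where "h = t / real n"
    have h: "h > 0" using t n by (simp add: h_def)
    have "E (real k * h) * (1 + c * h) ^ k \<le> E 0" for k
    proof (induction k)
      case (Suc k)
      have "E (real (Suc k) * h) * (1 + c * (real (Suc k) * h - real k * h)) \<le> E (real k * h)"
        unfolding c_def using h by (intro energy_decay_step(1)) auto
      also have "real (Suc k) * h - real k * h = h" by (simp add: algebra_simps)
      finally have "E (real (Suc k) * h) * (1 + c * h) * (1 + c * h) ^ k \<le> E (real k * h) * (1 + c * h) ^ k"
        using c h by (intro mult_right_mono) auto
      with Suc.IH show ?case by (simp add: mult.assoc)
    qed simp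
    from this[of n] show ?thesis using n by (simp add: h_def)
  qed
  then have ev: "\<forall>\<^sub>F n in sequentially. E t * (1 + c * t / real n) ^ n \<le> E 0"
    by (intro eventually_sequentiallyI[of 1]) auto
  have "(\<lambda>n. E t * (1 + c * t / real n) ^ n) \<longlonglongrightarrow> E t * exp (c * t)"
    by (intro tendsto_mult tendsto_const tendsto_exp_limit_sequentially)
  then have "E t * exp (c * t) \<le> E 0"
    using ev by (rule tendsto_upperbound) simp
  then show ?thesis
    unfolding c_def[symmetric] by (simp add: exp_minus field_simps)
qed

text \<open>
  The initial value is attained only almost everywhere, so the two weak gradients are compared through
  their uniqueness.
\<close>
lemma E_0: "E 0 = energy p \<Omega> g"
proof -
  have g1: "g \<in> W1p p \<Omega>" and v1: "v 0 \<in> W1p p \<Omega>" using W01pD[OF g] W01pD[OF v_W01p[of 0]] by auto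
  have ae: "AE x in lebesgue_on \<Omega>. g x = v 0 x"
    using sol by (auto simp: weak_solution_def elim!: eventually_mono)
  have "has_weak_grad \<Omega> (v 0) (weak_grad \<Omega> g)"
    unfolding has_weak_grad_def
  proof
    fix j
    have "has_weak_deriv \<Omega> (axis j 1) g (\<lambda>x. column j (weak_grad \<Omega> g x))"
      using W1pD(2)[OF open_dom g1] by (simp add: has_weak_grad_def)
    from has_weak_deriv_cong_AE[OF open_dom this ae Lp_locally_integrable[OF p open_dom W1pD(1)[OF open_dom v1]]]
    show "has_weak_deriv \<Omega> (axis j 1) (v 0) (\<lambda>x. column j (weak_grad \<Omega> g x))" .
  qed
  from weak_grad_AE[OF open_dom this] show ?thesis
    unfolding E_def energy_eq_Lp_mass
    by (rule Lp_mass_cong_AE[OF _ LpD(1)[OF W1pD(3)[OF open_dom v1]] LpD(1)[OF W1pD(3)[OF open_dom g1]]])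
qed

end

theorem lemma5p6:
  fixes \<Omega> :: "(real^'n) set" and p :: real
    and g :: "real^'n \<Rightarrow> real^'m" and v :: "real \<Rightarrow> real^'n \<Rightarrow> real^'m"
  assumes "bounded_smooth_domain \<Omega>"
    and "1 < p"
    and "g \<in> W01p p \<Omega>"
    and "weak_solution p \<Omega> g v"
  shows "(AE t in lebesgue_on {0<..}.
            Upsilon_p TYPE('m) p \<Omega> * (\<integral>x. norm (weak_grad \<Omega> (v t) x) powr p \<partial>lebesgue_on \<Omega>)
              \<le> (\<integral>x. norm (weak_dt \<Omega> v t x) powr p \<partial>lebesgue_on \<Omega>)) \<and>
         (\<forall>t>0. v t \<in> W01p p \<Omega> \<and>
            (\<integral>x. norm (weak_grad \<Omega> (v t) x) powr p \<partial>lebesgue_on \<Omega>)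
              \<le> exp (- (p * Upsilon_p TYPE('m) p \<Omega>) * t)
                  * (\<integral>x. norm (weak_grad \<Omega> g x) powr p \<partial>lebesgue_on \<Omega>))"
proof -
  interpret weak_flow \<Omega> p g v
    using assms by unfold_locales
  have "AE t in lebesgue_on {0<..}. Upsilon_p TYPE('m) p \<Omega> * E t \<le> Lp_mass p \<Omega> (vt t)"
  proof (rule AE_lebesgue_on_UN[where I = "UNIV :: nat set" and A = "\<lambda>k. {0..real (Suc k)}"])
    show "AE t in lebesgue. t \<in> {0..real (Suc k)} \<longrightarrow> Upsilon_p TYPE('m) p \<Omega> * E t \<le> Lp_mass p \<Omega> (vt t)" for k
      using AE_Upsilon_energy_le[of "real (Suc k)"] by (simp add: AE_restrict_space_iff)
    show "{0<..} \<subseteq> (\<Union>k\<in>(UNIV :: nat set). {0..real (Suc k)})"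
    proof
      fix t :: real assume "t \<in> {0<..}"
      moreover obtain k :: nat where "t \<le> real k" using real_arch_simple by blast
      ultimately show "t \<in> (\<Union>k\<in>(UNIV :: nat set). {0..real (Suc k)})" by (auto intro!: exI[of _ k])
    qed
  qed auto
  moreover have "v t \<in> W01p p \<Omega> \<and> E t \<le> exp (- (p * Upsilon_p TYPE('m) p \<Omega>) * t) * energy p \<Omega> g" if "0 < t" for t
    using v_W01p[of t] energy_decay[OF that] that by (simp add: E_0)
  ultimately show ?thesis
    by (simp add: E_def energy_def Lp_mass_def)
qed

end
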